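(* Let $M\subset\mathbb{R}^m$ be compact, let $F:\mathbb{R}^m\rightrightarrows\mathbb{R}^m$ be a standard set-valued map with induced set-valued dynamical system $\Phi$, let $(\gamma_n)_{n\ge1}$ be a positive decreasing deterministic sequence with $\sum_n\gamma_n=+\infty$, and let $(x_n)_{n\ge 0}$ and $(U_n)_{n\ge1}$ be random sequences in $\mathbb{R}^m$ on a probability space $(\Omega,\mathcal{F},\mathbb{P})$, adapted to a filtration $(\mathcal{F}_n)_n$, with $x_n\in M$ for all $n$ and $$x_{n+1}-x_n-\gamma_{n+1}U_{n+1}\in\gamma_{n+1}F(x_n)\quad\text{for all } n\ge 0.$$ Assume that (i) for all $c>0$, $\sum_n e^{-c/\gamma_n}<\infty$; (ii) $(U_n)_n$ is uniformly bounded and $\mathbb{E}(U_{n+1}\mid\mathcal{F}_n)=0$ for all $n$. Let $X$ be the continuous-time affine interpolated process of $(x_n)_n$, $\mathcal{L}(X)$ its limit set and $Att(X)$ its set of attainable points. Let $A\subset M$ be an attractor for $\Phi$ with basin of attraction $\mathcal{B}(A)$. If $Att(X)\cap\mathcal{B}(A)\neq\emptyset$, then $$\mathbb{P}(\mathcal{L}(X)\subset A)>0.$$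
   Context: A set-valued map $F:\mathbb{R}^m\rightrightarrows\mathbb{R}^m$ is standard if: $F(x)$ is non-empty, compact and convex for every $x$; its graph $\{(x,y): y\in F(x)\}$ is closed; there is $c>0$ with $\sup_{z\in F(x)}\|z\|\le c(1+\|x\|)$ for all $x$. A solution of $\dot{\mathbf{x}}\in F(\mathbf{x})$ is an absolutely continuous $\mathbf{x}:\mathbb{R}\to\mathbb{R}^m$ with $\dot{\mathbf{x}}(t)\in F(\mathbf{x}(t))$ for almost every $t$. $S_x$ is the set of solutions with $\mathbf{x}(0)=x$, and $\Phi_t(x)=\{\mathbf{x}(t):\mathbf{x}\in S_x\}$, $\Phi_t(U)=\bigcup_{x\in U}\Phi_t(x)$, $\Phi_I(x)=\bigcup_{t\in I}\Phi_t(x)$. A non-empty compact set $A$ is an attractor for $\Phi$ if it is invariant (for all $x\in A$ there is $\mathbf{x}\in S_x$ with $\mathbf{x}(\mathbb{R})\subset A$) and there is a neighborhood $U$ of $A$ such that for every $\epsilon>0$ there is $t_\epsilon>0$ with $\Phi_t(U)\subset N^\epsilon(A)$ for all $t\ge t_\epsilon$, where $N^\epsilon(A)$ is the $\epsilon$-neighborhood of $A$. Its basin of attraction is $\mathcal{B}(A)=\{x\in\mathbb{R}^m:\Phi_{[0,+\infty[}(x)\text{ bounded and }\omega_\Phi(x)\subset A\}$, where $\omega_\Phi(x)=\bigcap_{t\ge0}\overline{\Phi_{[t,\infty[}(x)}$. Set $\tau_0=0$, $\tau_n=\sum_{i=1}^n\gamma_i$. The affine interpolated process is $X(\tau_i+s)=x_i+s\frac{x_{i+1}-x_i}{\gamma_{i+1}}$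 for $s\in[0,\gamma_{i+1}]$, $i\ge 0$. Its limit set is $\mathcal{L}(X)=\bigcap_{t\ge0}\overline{\{X(s):s\ge t\}}$. A point $p\in M$ is attainable if for any $t>0$ and any neighborhood $U$ of $p$, $\mathbb{P}(\exists s\ge t: X(s)\in U)>0$; $Att(X)$ is the set of attainable points. *)

theory Defs
  imports "HOL-Probability.Probability"
begin

section \<open>Standard set-valued maps and differential inclusions\<close>

definition standard_map :: "('a::euclidean_space \<Rightarrow> 'a set) \<Rightarrow> bool" where
  "standard_map F \<longleftrightarrow>
     (\<forall>x. F x \<noteq> {} \<and> compact (F x) \<and> convex (F x)) \<and>
     closed {(x, y). y \<in> F x} \<and>
     (\<exists>c>0. \<forall>x. (SUP z\<in>F x. norm z) \<le> c * (1 + norm x))"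

text \<open>The usual epsilon-delta notion; a pair \<open>(u, v)\<close> in \<open>D\<close> stands for the interval from \<open>u\<close>
  to \<open>v\<close>, and the intervals of \<open>D\<close> do not overlap.\<close>

definition abs_continuous_on :: "real set \<Rightarrow> (real \<Rightarrow> 'a::real_normed_vector) \<Rightarrow> bool" where
  "abs_continuous_on S f \<longleftrightarrow>
     (\<forall>e>0. \<exists>d>0. \<forall>D. finite D \<and>
        (\<forall>(u, v)\<in>D. u \<le> v \<and> {u..v} \<subseteq> S) \<and>
        disjoint_family_on (\<lambda>(u, v). {u<..<v}) D \<and>
        (\<Sum>(u, v)\<in>D. v - u) < d
        \<longrightarrow> (\<Sum>(u, v)\<in>D. norm (f v - f u)) < e)"

text \<open>For curves defined on the whole line, absolute continuity is understood on every compact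
  interval: solutions may grow exponentially, so no uniformity over the line is asked for.\<close>

definition solution :: "('a::euclidean_space \<Rightarrow> 'a set) \<Rightarrow> (real \<Rightarrow> 'a) \<Rightarrow> bool" where
  "solution F y \<longleftrightarrow>
     (\<forall>a b. abs_continuous_on {a..b} y) \<and>
     (AE t in lebesgue. \<exists>v\<in>F (y t). (y has_vector_derivative v) (at t))"

definition solutions_from :: "('a::euclidean_space \<Rightarrow> 'a set) \<Rightarrow> 'a \<Rightarrow> (real \<Rightarrow> 'a) set" where
  "solutions_from F x = {y. solution F y \<and> y 0 = x}"

definition flow :: "('a::euclidean_space \<Rightarrow> 'a set) \<Rightarrow> real \<Rightarrow> 'a \<Rightarrow> 'a set" where
  "flow F t x = {y t |y. y \<in> solutions_from F x}"

definition omega_limit :: "('a::euclidean_space \<Rightarrow> 'a set) \<Rightarrow> 'a \<Rightarrow> 'a set" where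
  "omega_limit F x = (\<Inter>t\<in>{0..}. closure (\<Union>s\<in>{t..}. flow F s x))"

definition invariant :: "('a::euclidean_space \<Rightarrow> 'a set) \<Rightarrow> 'a set \<Rightarrow> bool" where
  "invariant F A \<longleftrightarrow> (\<forall>x\<in>A. \<exists>y\<in>solutions_from F x. range y \<subseteq> A)"

definition attractor :: "('a::euclidean_space \<Rightarrow> 'a set) \<Rightarrow> 'a set \<Rightarrow> bool" where
  "attractor F A \<longleftrightarrow>
     A \<noteq> {} \<and> compact A \<and> invariant F A \<and>
     (\<exists>U. A \<subseteq> interior U \<and>
        (\<forall>e>0. \<exists>T>0. \<forall>t\<ge>T. (\<Union>x\<in>U. flow F t x) \<subseteq> (\<Union>a\<in>A. ball a e)))"

definition basin :: "('a::euclidean_space \<Rightarrow> 'a set) \<Rightarrow> 'a set \<Rightarrow> 'a set" where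
  "basin F A = {x. bounded (\<Union>t\<in>{0..}. flow F t x) \<and> omega_limit F x \<subseteq> A}"

section \<open>The affine interpolated process\<close>

text \<open>Step sizes are indexed from 1; the value \<open>\<gamma> 0\<close> is never used.\<close>

definition step_time :: "(nat \<Rightarrow> real) \<Rightarrow> nat \<Rightarrow> real" where
  "step_time \<gamma> n = (\<Sum>i=1..n. \<gamma> i)"

text \<open>A time \<open>t \<ge> 0\<close> is located in the first interval from \<open>step_time \<gamma> i\<close> to
  \<open>step_time \<gamma> (Suc i)\<close> containing it; \<open>interpolation_eq\<close> below shows that the choice at the
  common endpoints does not matter.\<close>

definition interpolation ::
    "(nat \<Rightarrow> real) \<Rightarrow> (nat \<Rightarrow> 'a::real_normed_vector) \<Rightarrow> real \<Rightarrow> 'a" where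
  "interpolation \<gamma> x t =
     (let i = (LEAST i. t \<le> step_time \<gamma> (Suc i))
      in x i + ((t - step_time \<gamma> i) / \<gamma> (Suc i)) *\<^sub>R (x (Suc i) - x i))"

lemma step_time_Suc: "step_time \<gamma> (Suc n) = step_time \<gamma> n + \<gamma> (Suc n)"
  by (simp add: step_time_def)

lemma step_time_less:
  assumes "\<And>n. n \<ge> 1 \<Longrightarrow> \<gamma> n > 0" and "m < n"
  shows "step_time \<gamma> m < step_time \<gamma> n"
  by (rule lift_Suc_mono_less[OF _ \<open>m < n\<close>]) (simp add: step_time_Suc assms(1))

lemma interpolation_eq:
  assumes pos: "\<And>n. n \<ge> 1 \<Longrightarrow> \<gamma> n > 0" and s: "0 \<le> s" "s \<le> \<gamma> (Suc i)"
  shows "interpolation \<gamma> x (step_time \<gamma> i + s) = x i + (s / \<gamma> (Suc i)) *\<^sub>R (x (Suc i) - x i)"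
proof (cases "s = 0 \<and> i > 0")
  case True
  then obtain j where j: "i = Suc j" by (cases i) auto
  have "(LEAST k. step_time \<gamma> i + s \<le> step_time \<gamma> (Suc k)) = j"
  proof (rule Least_equality)
    show "step_time \<gamma> i + s \<le> step_time \<gamma> (Suc j)" using True j by simp
    fix k assume k: "step_time \<gamma> i + s \<le> step_time \<gamma> (Suc k)"
    show "j \<le> k"
    proof (rule ccontr)
      assume "\<not> j \<le> k"
      then have "step_time \<gamma> (Suc k) < step_time \<gamma> i" using step_time_less[of \<gamma> "Suc k" i] pos j by simp
      then show False using k s by simp
    qed
  qed
  moreover have "\<gamma> i \<noteq> 0" using pos[of i] j by simp
  ultimately show ?thesis using True j by (simp add: interpolation_def step_time_Suc)
next
  case False
  have "(LEAST k. step_time \<gamma> i + s \<le> step_time \<gamma> (Suc k)) = i"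
  proof (rule Least_equality)
    show "step_time \<gamma> i + s \<le> step_time \<gamma> (Suc i)" using s by (simp add: step_time_Suc)
    fix k assume k: "step_time \<gamma> i + s \<le> step_time \<gamma> (Suc k)"
    show "i \<le> k"
    proof (rule ccontr)
      assume "\<not> i \<le> k"
      then have ki: "Suc k \<le> i" by simp
      then have "step_time \<gamma> (Suc k) \<le> step_time \<gamma> i"
        using step_time_less[of \<gamma> "Suc k" i] pos by (cases "Suc k = i") auto
      moreover have "s > 0" using False ki s by auto
      ultimately show False using k by simp
    qed
  qed
  then show ?thesis by (simp add: interpolation_def)
qed

definition limit_set :: "(real \<Rightarrow> 'a::topological_space) \<Rightarrow> 'a set" where
  "limit_set Y = (\<Inter>t\<in>{0..}. closure (Y ` {t..}))"

text \<open>The event below is measurable for open \<open>V\<close>, but need not be for an arbitrary neighborhood,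
  where \<open>measure\<close> would return 0. Since every neighborhood contains an open one, the restriction to
  open neighborhoods loses nothing.\<close>

definition attainable_set ::
    "'w measure \<Rightarrow> (real \<Rightarrow> 'w \<Rightarrow> 'a::topological_space) \<Rightarrow> 'a set \<Rightarrow> 'a set" where
  "attainable_set P X M =
     {p\<in>M. \<forall>t>0. \<forall>V. open V \<and> p \<in> V \<longrightarrow> \<P>(\<omega> in P. \<exists>s\<ge>t. X s \<omega> \<in> V) > 0}"

end

theory Submission
  imports Defs "HOL-Library.Diagonal_Subsequence"
begin

text \<open>
  Limits of perturbed Euler schemes with vanishing steps and vanishing noise are solutions of the
  inclusion: a limit curve is Lipschitz, hence differentiable almost everywhere, and its difference
  quotients are limits of convex combinations of values of \<open>F\<close> at nearby points, so by upper
  semicontinuity the derivative lies in \<open>F\<close>. By compactness, a scheme with small steps and small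
  noise follows the flow over a bounded time. Started close to a point of the basin it therefore
  enters the region uniformly attracted by \<open>A\<close>, and it never leaves that region again; since the
  noise eventually drops below every level, it converges to \<open>A\<close>.

  Because the noise is bounded, its fluctuation over a time window is controlled by boundedly many
  grid points of the window. The exponential bound at each of them and the summability of
  \<open>exp (- c / \<gamma> n)\<close> show that, conditionally on the past, the noise after step \<open>N\<close> is small with
  probability at least one half once \<open>N\<close> is large. Attainability provides such an \<open>N\<close> at which the
  scheme is close to a point of the basin with positive probability.
\<close>

section \<open>Differentiability of Lipschitz curves\<close>

text \<open>Path and noise vary with \<open>\<omega>\<close>, so every tolerance must depend only on
  the set-valued map, the bounds and the chosen point of the basin. This is why the compactness
  arguments run over all step sequences, schemes and noises at once. Almost all of the analysis
  takes place at grid indices; the interpolated process enters only through attainability and the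
  limit set.

  The noise estimate avoids conditional probabilities: for an event \<open>E\<close> of the past,
  the part of \<open>E\<close> on which the noise is too large has at most a prescribed fraction of
  the mass of \<open>E\<close>. The tolerance is fixed before the index from which this holds, and
  attainability, which permits arbitrarily late times, is used after both. The rate
  \<open>exp (- c / \<gamma> n)\<close> comes from monotonicity: in a window of length
  \<open>T\<close> after step \<open>n\<close>, the squared steps sum to at most
  \<open>\<gamma> (Suc n) * T\<close>.

  That the noise is eventually small on almost every path is the same estimate, with the whole space
  as \<open>E\<close> and arbitrarily small fractions.\<close>

lemma vitali_cover_measure_le:
  fixes E V :: "real set" and Q :: "real \<Rightarrow> real \<Rightarrow> bool"
  assumes "open V" "E \<subseteq> V"
    and cover: "\<And>x d. x \<in> E \<Longrightarrow> d > 0 \<Longrightarrow> \<exists>u v. u < v \<and> u \<le> x \<and> x \<le> v \<and> v - u < d \<and> Q u v"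
    and sets: "sets N1 = sets borel" "sets N2 = sets borel"
    and le: "\<And>u v. u < v \<Longrightarrow> Q u v \<Longrightarrow> emeasure N1 {u..v} \<le> emeasure N2 {u..v}"
  obtains B where "B \<in> sets borel" "B \<subseteq> V" "negligible (E - B)" "emeasure N1 B \<le> emeasure N2 B"
proof -
  \<comment> \<open>The covering theorem speaks of closed balls, so an interval is passed to it by
    midpoint and half-length. The selected intervals are countable and disjoint, hence the
    inequality between the two measures can be summed over them; \<open>E\<close> itself may be
    non-measurable.\<close>
  define K where "K = {(u, v). u < v \<and> {u..v} \<subseteq> V \<and> Q u v}"
  define c :: "real \<times> real \<Rightarrow> real" where "c = (\<lambda>(u, v). (u + v) / 2)"
  define r :: "real \<times> real \<Rightarrow> real" where "r = (\<lambda>(u, v). (v - u) / 2)"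
  have cb: "cball (c i) (r i) = {fst i..snd i}" for i
    by (cases i) (simp add: c_def r_def cball_eq_atLeastAtMost field_simps)
  have "\<exists>i. i \<in> K \<and> x \<in> cball (c i) (r i) \<and> r i < d" if x: "x \<in> E" and d: "d > 0" for x d
  proof -
    obtain e where e: "e > 0" "ball x e \<subseteq> V" using \<open>open V\<close> \<open>E \<subseteq> V\<close> x openE by blast
    obtain u v where uv: "u < v" "u \<le> x" "x \<le> v" "v - u < min d e" "Q u v"
      using cover[OF x, of "min d e"] d e by auto
    have "{u..v} \<subseteq> V" using uv e(2) by (auto simp: dist_real_def subset_eq)
    then show ?thesis
      using uv by (intro exI[of _ "(u, v)"], subst cb) (auto simp: K_def r_def)
  qed
  moreover have "\<And>i. i \<in> K \<Longrightarrow> 0 < r i" by (auto simp: K_def r_def)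
  ultimately obtain C where C: "countable C" "C \<subseteq> K"
     "pairwise (\<lambda>i j. disjnt (cball (c i) (r i)) (cball (c j) (r j))) C"
     "negligible (E - (\<Union>i \<in> C. cball (c i) (r i)))"
    using Vitali_covering_theorem_cballs[of K r E c] by blast
  have disj: "disjoint_family_on (\<lambda>i. {fst i..snd i}) C"
    using C(3) unfolding cb by (auto simp: disjoint_family_on_def pairwise_def disjnt_def)
  show ?thesis
  proof
    show "(\<Union>i\<in>C. {fst i..snd i}) \<in> sets borel" using C(1) by (intro sets.countable_UN'') auto
    show "(\<Union>i\<in>C. {fst i..snd i}) \<subseteq> V" using C(2) by (auto simp: K_def subset_eq)
    show "negligible (E - (\<Union>i\<in>C. {fst i..snd i}))" using C(4) unfolding cb .
    have "emeasure N1 (\<Union>i\<in>C. {fst i..snd i}) = (\<integral>\<^sup>+i. emeasure N1 {fst i..snd i} \<partial>count_space C)"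
      using C(1) disj by (intro emeasure_UN_countable) (auto simp: sets)
    also have "\<dots> \<le> (\<integral>\<^sup>+i. emeasure N2 {fst i..snd i} \<partial>count_space C)"
      using C(2) by (intro nn_integral_mono le) (auto simp: K_def)
    also have "\<dots> = emeasure N2 (\<Union>i\<in>C. {fst i..snd i})"
      using C(1) disj by (intro emeasure_UN_countable[symmetric]) (auto simp: sets)
    finally show "emeasure N1 (\<Union>i\<in>C. {fst i..snd i}) \<le> emeasure N2 (\<Union>i\<in>C. {fst i..snd i})" .
  qed
qed

text \<open>The near-covers for the tolerances \<open>1 / (n + 1)\<close> are intersected: the
  intersection is null, and what it misses of \<open>E\<close> lies in a countable union of null
  sets. The factor \<open>c\<close> absorbs the constant that each application produces.\<close>

lemma negligible_small_cover:
  fixes E :: "real set" and c :: real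
  assumes "\<And>e. e > 0 \<Longrightarrow> \<exists>B\<in>sets borel. negligible (E - B) \<and> emeasure lborel B \<le> ennreal (c * e)"
  shows "negligible E"
proof -
  have "\<forall>n::nat. \<exists>B\<in>sets borel. negligible (E - B) \<and> emeasure lborel B \<le> ennreal (c * inverse (real (Suc n)))"
    using assms by simp
  then obtain B where B: "\<And>n::nat. B n \<in> sets borel" "\<And>n. negligible (E - B n)"
     "\<And>n. emeasure lborel (B n) \<le> ennreal (c * inverse (real (Suc n)))" by metis
  have lim: "(\<lambda>n. ennreal (c * inverse (real (Suc n)))) \<longlonglongrightarrow> ennreal (c * 0)"
    by (intro tendsto_ennrealI tendsto_intros LIMSEQ_inverse_real_of_nat)
  have "emeasure lborel (\<Inter>n. B n) \<le> ennreal (c * inverse (real (Suc n)))" for n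
    using B(3)[of n] emeasure_mono[of "\<Inter>n. B n" "B n" lborel] B(1)[of n]
    by (metis INF_lower UNIV_I order_trans sets_lborel)
  then have "emeasure lborel (\<Inter>n. B n) \<le> 0"
    using LIMSEQ_le_const[OF lim, of "emeasure lborel (\<Inter>n. B n)"] by auto
  then have "(\<Inter>n. B n) \<in> null_sets lborel" using B(1) by (auto intro!: null_setsI)
  then have "negligible (\<Inter>n. B n)"
    by (simp add: negligible_iff_null_sets null_sets_completionI)
  moreover have "negligible (\<Union>n. E - B n)" using B(2) by blast
  ultimately have "negligible ((\<Inter>n. B n) \<union> (\<Union>n. E - B n))" by (rule negligible_Un)
  then show ?thesis by (rule negligible_subset) blast
qed

text \<open>The image measure of \<open>lborel\<close> under the inverse of an increasing bi-Lipschitz map is absolutely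
  continuous; by the Vitali covering theorem the map has its density as derivative almost
  everywhere.\<close>

lemma bilipschitz_differentiable_AE:
  fixes f :: "real \<Rightarrow> real"
  assumes lower: "\<And>x y. x \<le> y \<Longrightarrow> y - x \<le> f y - f x"
    and upper: "\<And>x y. x \<le> y \<Longrightarrow> f y - f x \<le> L * (y - x)"
  shows "AE x in lebesgue. f differentiable (at x)"
proof -
  have mono: "f x \<le> f y \<longleftrightarrow> x \<le> y" for x y using lower[of x y] lower[of y x] by linarith
  have L1: "L \<ge> 1" using lower[of 0 1] upper[of 0 1] by simp
  have flip: "\<bar>f y - f x\<bar> \<le> L * \<bar>y - x\<bar>" for x y
    using upper[of x y] upper[of y x] lower[of x y] lower[of y x] by (cases "x \<le> y") auto
  have "L-lipschitz_on UNIV f" using flip L1 by (intro lipschitz_onI) (auto simp: dist_real_def)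
  then have contf: "continuous_on UNIV f" by (rule lipschitz_on_continuous_on)
  have surj: "\<exists>x. f x = y" for y
  proof -
    define R where "R = \<bar>y - f 0\<bar>"
    have "f (-R) \<le> y" "y \<le> f R" using lower[of "-R" 0] lower[of 0 R] by (auto simp: R_def)
    then show ?thesis using IVT'[of f "-R" y R] contf by (auto simp: R_def intro: continuous_on_subset)
  qed

  \<comment> \<open>The inverse function and its image measure\<close>
  define h where "h = inv f"
  have inj: "inj f" by (rule injI) (metis mono order_antisym order_refl)
  have fh: "f (h y) = y" for y unfolding h_def using surj by (metis f_inv_into_f rangeI)
  have hf: "h (f x) = x" for x unfolding h_def using inj by simp
  have hmono: "h x \<le> h y \<longleftrightarrow> x \<le> y" for x y using mono[of "h x" "h y"] fh by simp
  have "1-lipschitz_on UNIV h"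
  proof (intro lipschitz_onI)
    fix x y show "dist (h x) (h y) \<le> 1 * dist x y"
      using lower[of "h x" "h y"] lower[of "h y" "h x"] fh hmono[of x y] hmono[of y x]
      by (auto simp: dist_real_def)
  qed simp
  then have conth: "continuous_on UNIV h" by (rule lipschitz_on_continuous_on)
  then have [measurable]: "h \<in> borel_measurable borel" by (rule borel_measurable_continuous_onI)
  \<comment> \<open>This is the Stieltjes measure of \<open>f\<close>: the interval from
    \<open>u\<close> to \<open>v\<close> receives the mass \<open>f v - f u\<close>. Its density is
    the candidate for the derivative.\<close>
  define \<mu> where "\<mu> = distr lborel borel h"
  have sets_\<mu>: "sets \<mu> = sets borel" by (simp add: \<mu>_def)
  have em: "emeasure \<mu> A = emeasure lborel (h -` A)" if "A \<in> sets borel" for A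
    unfolding \<mu>_def using that by (subst emeasure_distr) auto
  have vim: "h -` A = f ` A" for A using fh hf by (auto simp: image_iff) (metis)+
  have em_Icc: "emeasure \<mu> {u..v} = ennreal (f v - f u)" if "u < v" for u v
  proof -
    have "h -` {u..v} = {f u..f v}" using hmono fh hf by (auto) (metis hmono fh hf)+
    then show ?thesis using that mono[of u v] by (simp add: em)
  qed
  have "absolutely_continuous lborel \<mu>"
    unfolding absolutely_continuous_def
  proof
    fix A assume A: "A \<in> null_sets (lborel :: real measure)"
    then have "negligible A" by (simp add: negligible_iff_null_sets null_sets_completionI)
    then have "negligible (f ` A)"
    proof (rule negligible_locally_Lipschitz_image[rotated])
      show "\<exists>T B. open T \<and> x \<in> T \<and> (\<forall>y\<in>A \<inter> T. norm (f y - f x) \<le> B * norm (y - x))" for x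
        using flip by (intro exI[of _ UNIV] exI[of _ L]) auto
    qed simp
    moreover have "h -` A \<in> sets borel" using A measurable_sets_borel[of h borel A] by auto
    ultimately have "h -` A \<in> null_sets lborel"
      by (simp add: vim negligible_iff_null_sets null_sets_completion_iff)
    then show "A \<in> null_sets \<mu>" using A em[of A] by (auto simp: null_sets_def sets_\<mu>)
  qed
  then obtain g where [measurable]: "g \<in> borel_measurable lborel" and g: "density lborel g = \<mu>"
    using sigma_finite_measure.Radon_Nikodym[OF sigma_finite_lborel, of \<mu>] sets_\<mu> by auto
  have emg: "emeasure \<mu> A = (\<integral>\<^sup>+x\<in>A. g x \<partial>lborel)" if "A \<in> sets borel" for A
    unfolding g[symmetric] using that by (subst emeasure_density) auto

  \<comment> \<open>Points where difference quotients disagree with the density form a null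
    set\<close>
  define up where "up = (\<lambda>p q x. g x < ennreal p \<and>
    (\<forall>d>0. \<exists>u v. u < v \<and> u \<le> x \<and> x \<le> v \<and> v - u < d \<and> q * (v - u) \<le> f v - f u))"
  define lo where "lo = (\<lambda>p q x. g x > ennreal q \<and>
    (\<forall>d>0. \<exists>u v. u < v \<and> u \<le> x \<and> x \<le> v \<and> v - u < d \<and> f v - f u \<le> p * (v - u)))"
  \<comment> \<open>Density below \<open>p\<close> together with quotients of at least
    \<open>q\<close> on arbitrarily short intervals gives \<open>q * b \<le> p * b + e\<close> for
    the measure \<open>b\<close> of a Vitali selection, whence the constant
    \<open>1 / (q - p)\<close>. The cut-off \<open>R\<close> keeps \<open>b\<close> finite, so that
    it may be subtracted.\<close>
  have neg_up: "negligible {x. up p q x \<and> \<bar>x\<bar> < R}" if pq: "0 < p" "p < q" for p q R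
  proof (rule negligible_small_cover[where c = "1 / (q - p)"])
    fix e :: real assume e: "e > 0"
    define G where "G = {x. g x < ennreal p \<and> \<bar>x\<bar> < R}"
    have G: "G \<in> sets borel" unfolding G_def by measurable
    then have "h -` G \<in> sets borel" using measurable_sets_borel[of h borel G] by auto
    \<comment> \<open>Here \<open>\<mu> (W - G)\<close> has to be small, and \<open>\<mu>\<close> is
      the Lebesgue measure of preimages under \<open>h\<close>. Hence outer regularity is applied to
      the preimage of \<open>G\<close>, and the open set is pulled back by \<open>f\<close>.\<close>
    from outer_regular_lborel[OF this e] obtain V where
      V: "open V" "h -` G \<subseteq> V" "emeasure lborel (V - h -` G) < e" by blast
    define W where "W = f -` V \<inter> {-R<..<R}"
    have "open W" unfolding W_def using V(1) contf by (intro open_Int open_vimage) auto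
    have "f x \<in> V" if "x \<in> G" for x using V(2) that by (auto simp: hf)
    then have GW: "G \<subseteq> W" by (auto simp: W_def G_def)
    have \<mu>W: "emeasure \<mu> (W - G) \<le> e"
    proof -
      have "emeasure \<mu> (W - G) = emeasure lborel (h -` (W - G))"
        using \<open>open W\<close> G by (intro em) auto
      also have "\<dots> \<le> emeasure lborel (V - h -` G)"
        using V(1) \<open>h -` G \<in> sets borel\<close> by (intro emeasure_mono) (auto simp: W_def fh)
      finally show ?thesis using V(3) by simp
    qed
    obtain B where B: "B \<in> sets borel" "B \<subseteq> W" "negligible ({x. up p q x \<and> \<bar>x\<bar> < R} - B)"
      "emeasure (scale_measure (ennreal q) lborel) B \<le> emeasure \<mu> B"
    proof (rule vitali_cover_measure_le[of W "{x. up p q x \<and> \<bar>x\<bar> < R}" "\<lambda>u v. q * (v - u) \<le> f v - f u"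
         "scale_measure (ennreal q) lborel" \<mu>])
      show "{x. up p q x \<and> \<bar>x\<bar> < R} \<subseteq> W" using GW by (auto simp: up_def G_def)
      fix u v :: real assume "u < v" "q * (v - u) \<le> f v - f u"
      then show "emeasure (scale_measure (ennreal q) lborel) {u..v} \<le> emeasure \<mu> {u..v}"
        using pq by (simp add: em_Icc ennreal_mult'[symmetric] ennreal_leI)
    qed (use \<open>open W\<close> in \<open>auto simp: up_def sets_\<mu>\<close>)
    have "emeasure \<mu> B \<le> emeasure \<mu> (B \<inter> G) + emeasure \<mu> (W - G)"
      using B(1,2) G \<open>open W\<close> by (intro order_trans[OF emeasure_mono emeasure_subadditive]) (auto simp: sets_\<mu>)
    also have "emeasure \<mu> (B \<inter> G) \<le> (\<integral>\<^sup>+x. ennreal p * indicator B x \<partial>lborel)"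
      using B(1) G by (subst emg) (auto intro!: nn_integral_mono simp: G_def split: split_indicator)
    also have "\<dots> = ennreal p * emeasure lborel B" using B(1) by (simp add: nn_integral_cmult_indicator)
    finally have *: "ennreal q * emeasure lborel B \<le> ennreal p * emeasure lborel B + ennreal e"
      using B(4) \<mu>W by (auto intro: order_trans add_left_mono)
    have "emeasure lborel B \<le> emeasure lborel {-R<..<R}" using B(2) by (intro emeasure_mono) (auto simp: W_def)
    also have "\<dots> < \<infinity>" by (cases "-R \<le> R") auto
    finally have "emeasure lborel B < \<infinity>" .
    then obtain b where b: "b \<ge> 0" "emeasure lborel B = ennreal b" by (cases "emeasure lborel B") auto
    have "q * b \<le> p * b + e"
      using * pq e b by (simp add: ennreal_mult[symmetric] ennreal_plus[symmetric] del: ennreal_plus)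
    then have "b \<le> 1 / (q - p) * e" using pq by (simp add: field_simps)
    then show "\<exists>B\<in>sets borel. negligible ({x. up p q x \<and> \<bar>x\<bar> < R} - B) \<and> emeasure lborel B \<le> ennreal (1 / (q - p) * e)"
      using B b by (intro bexI[of _ B]) (auto intro: ennreal_leI)
  qed
  \<comment> \<open>The mirror image, with the roles of \<open>\<mu>\<close> and
    \<open>lborel\<close> exchanged, so that \<open>lborel\<close> of \<open>W - G\<close> has to be
    small. From \<open>q * c \<le> p * b\<close> and \<open>b \<le> c + e\<close> comes the constant
    \<open>q / (q - p)\<close>.\<close>
  have neg_lo: "negligible {x. lo p q x \<and> \<bar>x\<bar> < R}" if pq: "0 \<le> p" "p < q" for p q R
  proof (rule negligible_small_cover[where c = "q / (q - p)"])
    fix e :: real assume e: "e > 0"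
    define G where "G = {x. g x > ennreal q \<and> \<bar>x\<bar> < R}"
    have G: "G \<in> sets borel" unfolding G_def by measurable
    from outer_regular_lborel[OF this e] obtain V where
      V: "open V" "G \<subseteq> V" "emeasure lborel (V - G) < e" by blast
    define W where "W = V \<inter> {-R<..<R}"
    have "open W" unfolding W_def using V(1) by auto
    have GW: "G \<subseteq> W" using V(2) by (auto simp: W_def G_def)
    have \<mu>W: "emeasure lborel (W - G) \<le> e"
      using V G by (intro order_trans[OF emeasure_mono less_imp_le[OF V(3)]]) (auto simp: W_def)
    obtain B where B: "B \<in> sets borel" "B \<subseteq> W" "negligible ({x. lo p q x \<and> \<bar>x\<bar> < R} - B)"
      "emeasure \<mu> B \<le> emeasure (scale_measure (ennreal p) lborel) B"
    proof (rule vitali_cover_measure_le[of W "{x. lo p q x \<and> \<bar>x\<bar> < R}" "\<lambda>u v. f v - f u \<le> p * (v - u)"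
         \<mu> "scale_measure (ennreal p) lborel"])
      show "{x. lo p q x \<and> \<bar>x\<bar> < R} \<subseteq> W" using GW by (auto simp: lo_def G_def)
      fix u v :: real assume "u < v" "f v - f u \<le> p * (v - u)"
      then show "emeasure \<mu> {u..v} \<le> emeasure (scale_measure (ennreal p) lborel) {u..v}"
        using pq by (simp add: em_Icc ennreal_mult'[symmetric] ennreal_leI)
    qed (use \<open>open W\<close> in \<open>auto simp: lo_def sets_\<mu>\<close>)
    have "ennreal q * emeasure lborel (B \<inter> G) = (\<integral>\<^sup>+x. ennreal q * indicator (B \<inter> G) x \<partial>lborel)"
      using B(1) G by (simp add: nn_integral_cmult_indicator)
    also have "\<dots> \<le> emeasure \<mu> (B \<inter> G)"
      using B(1) G by (subst emg) (auto intro!: nn_integral_mono intro: less_imp_le simp: G_def split: split_indicator)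
    also have "\<dots> \<le> emeasure \<mu> B" using B(1) G by (intro emeasure_mono) (auto simp: sets_\<mu>)
    also have "\<dots> \<le> ennreal p * emeasure lborel B" using B(4) by simp
    finally have 1: "ennreal q * emeasure lborel (B \<inter> G) \<le> ennreal p * emeasure lborel B" .
    have "emeasure lborel B \<le> emeasure lborel (B \<inter> G) + emeasure lborel (W - G)"
      using B(1,2) G \<open>open W\<close> by (intro order_trans[OF emeasure_mono emeasure_subadditive]) auto
    then have 2: "emeasure lborel B \<le> emeasure lborel (B \<inter> G) + ennreal e"
      using \<mu>W by (auto intro: order_trans add_left_mono)
    have "emeasure lborel B \<le> emeasure lborel {-R<..<R}" using B(2) by (intro emeasure_mono) (auto simp: W_def)
    also have "\<dots> < \<infinity>" by (cases "-R \<le> R") auto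
    finally have "emeasure lborel B < \<infinity>" .
    then obtain b where b: "b \<ge> 0" "emeasure lborel B = ennreal b" by (cases "emeasure lborel B") auto
    have "emeasure lborel (B \<inter> G) \<le> emeasure lborel B" using B(1) by (intro emeasure_mono) auto
    then obtain c where c: "c \<ge> 0" "emeasure lborel (B \<inter> G) = ennreal c"
      using b by (cases "emeasure lborel (B \<inter> G)") (auto simp: top_unique)
    have "q * c \<le> p * b" "b \<le> c + e"
      using 1 2 pq e b c by (simp_all add: ennreal_mult[symmetric] ennreal_plus[symmetric] del: ennreal_plus)
    moreover have "q * b \<le> q * (c + e)" using \<open>b \<le> c + e\<close> pq by (intro mult_left_mono) auto
    ultimately have "b \<le> q / (q - p) * e" using pq by (simp add: field_simps)
    then show "\<exists>B\<in>sets borel. negligible ({x. lo p q x \<and> \<bar>x\<bar> < R} - B) \<and> emeasure lborel B \<le> ennreal (q / (q - p) * e)"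
      using B b by (intro bexI[of _ B]) (auto intro: ennreal_leI)
  qed

  \<comment> \<open>Off the null set, the density is the derivative\<close>
  define Z where "Z = (\<Union>(p, q, R)\<in>{(p, q, R). p \<in> \<rat> \<and> q \<in> \<rat> \<and> 0 < p \<and> p < q \<and> R \<in> \<nat>}.
     {x. up p q x \<and> \<bar>x\<bar> < R} \<union> {x. lo p q x \<and> \<bar>x\<bar> < R})"
  have "countable ((\<rat> \<times> \<rat> \<times> \<nat>) :: (real \<times> real \<times> real) set)"
    by (intro countable_SIGMA countable_rat) (auto simp: Nats_def)
  then have "countable {(p :: real, q :: real, R :: real). p \<in> \<rat> \<and> q \<in> \<rat> \<and> 0 < p \<and> p < q \<and> R \<in> \<nat>}"
    by (rule countable_subset[rotated]) auto
  then have "negligible Z"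
    unfolding Z_def by (intro negligible_countable_Union countable_image) (auto intro!: neg_up neg_lo)
  moreover have "f differentiable (at x)" if x: "x \<notin> Z" for x
  proof -
    have nup: "\<not> up p q x" if "p \<in> \<rat>" "q \<in> \<rat>" "0 < p" "p < q" for p q
    proof -
      obtain n :: nat where "\<bar>x\<bar> < real n" using reals_Archimedean2 by blast
      then show ?thesis using x that unfolding Z_def by fastforce
    qed
    have nlo: "\<not> lo p q x" if "p \<in> \<rat>" "q \<in> \<rat>" "0 < p" "p < q" for p q
    proof -
      obtain n :: nat where "\<bar>x\<bar> < real n" using reals_Archimedean2 by blast
      then show ?thesis using x that unfolding Z_def by fastforce
    qed
    \<comment> \<open>This rules out an infinite density: all quotients are at most
      \<open>L\<close>, so with a density above \<open>L + 2\<close> two rationals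
      \<open>p < q\<close> between \<open>L\<close> and \<open>L + 2\<close> would put
      \<open>x\<close> into a \<open>lo\<close> set.\<close>
    have "g x \<le> ennreal (L + 2)"
    proof (rule ccontr)
      assume "\<not> g x \<le> ennreal (L + 2)"
      then have g1: "g x > ennreal (L + 2)" by simp
      obtain p where p: "p \<in> \<rat>" "L < p" "p < L + 1" using Rats_dense_in_real[of L "L + 1"] by auto
      obtain q where q: "q \<in> \<rat>" "p < q" "q < L + 2" using Rats_dense_in_real[of p "L + 2"] p by auto
      have "g x > ennreal q" using g1 q(3) by (meson ennreal_leI le_less_trans less_imp_le)
      moreover have "\<exists>u v. u < v \<and> u \<le> x \<and> x \<le> v \<and> v - u < d \<and> f v - f u \<le> p * (v - u)" if "d > 0" for d
      proof (intro exI conjI)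
        have "f (x + d/2) - f x \<le> L * (x + d / 2 - x)" using that by (intro upper) auto
        also have "\<dots> \<le> p * (x + d / 2 - x)" using that p by (intro mult_right_mono) auto
        finally show "f (x + d/2) - f x \<le> p * (x + d / 2 - x)" .
      qed (use that in auto)
      ultimately have "lo p q x" by (simp add: lo_def)
      then show False using nlo[of p q] p q L1 by auto
    qed
    then obtain D where D: "D \<ge> 0" "g x = ennreal D" by (cases "g x") (auto simp: top_unique)
    have upD: "\<exists>d>0. \<forall>u v. u < v \<and> u \<le> x \<and> x \<le> v \<and> v - u < d \<longrightarrow> f v - f u \<le> (D + e) * (v - u)" if e: "e > 0" for e
    proof -
      obtain p where p: "p \<in> \<rat>" "D < p" "p < D + e" using Rats_dense_in_real[of D "D + e"] e by auto
      obtain q where q: "q \<in> \<rat>" "p < q" "q < D + e" using Rats_dense_in_real[of p "D + e"] p by auto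
      have "g x < ennreal p" using D p by (simp add: ennreal_lessI)
      then obtain d where d: "d > 0" "\<And>u v. u < v \<and> u \<le> x \<and> x \<le> v \<and> v - u < d \<Longrightarrow> f v - f u \<le> q * (v - u)"
        using nup[of p q] p q D by (force simp: up_def not_le)
      show ?thesis
      proof (intro exI[of _ d] conjI allI impI d(1))
        fix u v assume uv: "u < v \<and> u \<le> x \<and> x \<le> v \<and> v - u < d"
        have "q * (v - u) \<le> (D + e) * (v - u)" using q uv by (intro mult_right_mono) auto
        then show "f v - f u \<le> (D + e) * (v - u)" using d(2)[OF uv] by linarith
      qed
    qed
    \<comment> \<open>The exceptional set is built from positive rationals only. For negative
      \<open>D - e\<close> the lower bound comes from \<open>f\<close> being increasing
      instead.\<close>
    have loD: "\<exists>d>0. \<forall>u v. u < v \<and> u \<le> x \<and> x \<le> v \<and> v - u < d \<longrightarrow> f v - f u \<ge> (D - e) * (v - u)" if e: "e > 0" for e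
    proof (cases "D - e \<ge> 0")
      case True
      obtain q where q: "q \<in> \<rat>" "D - e < q" "q < D" using Rats_dense_in_real[of "D - e" D] e by auto
      obtain p where p: "p \<in> \<rat>" "D - e < p" "p < q" using Rats_dense_in_real[of "D - e" q] q by auto
      have "g x > ennreal q" using D q True by (auto simp: ennreal_less_iff)
      then obtain d where d: "d > 0" "\<And>u v. u < v \<and> u \<le> x \<and> x \<le> v \<and> v - u < d \<Longrightarrow> f v - f u \<ge> p * (v - u)"
        using nlo[of p q] p q D True by (force simp: lo_def not_le)
      show ?thesis
      proof (intro exI[of _ d] conjI allI impI d(1))
        fix u v assume uv: "u < v \<and> u \<le> x \<and> x \<le> v \<and> v - u < d"
        have "p * (v - u) \<ge> (D - e) * (v - u)" using p uv by (intro mult_right_mono) auto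
        then show "f v - f u \<ge> (D - e) * (v - u)" using d(2)[OF uv] by linarith
      qed
    next
      case False
      show ?thesis
      proof (intro exI[of _ 1] conjI allI impI)
        fix u v assume uv: "u < v \<and> u \<le> x \<and> x \<le> v \<and> v - u < (1::real)"
        have "(D - e) * (v - u) \<le> 0" using False uv by (intro mult_nonpos_nonneg) auto
        then show "f v - f u \<ge> (D - e) * (v - u)" using uv lower[of u v] by auto
      qed simp
    qed
    \<comment> \<open>\<open>x\<close> may be either endpoint of the intervals in \<open>upD\<close>
      and \<open>loD\<close>, so both one-sided quotients are controlled.\<close>
    have "(f has_derivative (\<lambda>h. D * h)) (at x)"
      unfolding has_derivative_at_alt
    proof (intro conjI allI impI bounded_linear_mult_right)
      fix e :: real assume e: "e > 0"
      obtain d1 where d1: "d1 > 0" "\<And>u v. u < v \<Longrightarrow> u \<le> x \<Longrightarrow> x \<le> v \<Longrightarrow> v - u < d1 \<Longrightarrow> f v - f u \<le> (D + e) * (v - u)"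
        using upD[OF e] by auto
      obtain d2 where d2: "d2 > 0" "\<And>u v. u < v \<Longrightarrow> u \<le> x \<Longrightarrow> x \<le> v \<Longrightarrow> v - u < d2 \<Longrightarrow> f v - f u \<ge> (D - e) * (v - u)"
        using loD[OF e] by auto
      show "\<exists>d>0. \<forall>y. norm (y - x) < d \<longrightarrow> norm (f y - f x - D * (y - x)) \<le> e * norm (y - x)"
      proof (intro exI[of _ "min d1 d2"] conjI allI impI)
        fix y assume y: "norm (y - x) < min d1 d2"
        consider "y = x" | "y < x" | "x < y" by linarith
        then show "norm (f y - f x - D * (y - x)) \<le> e * norm (y - x)"
        proof cases
          case 2
          then show ?thesis using d1(2)[of y x] d2(2)[of y x] y by (auto simp: algebra_simps abs_le_iff)
        next
          case 3
          then show ?thesis using d1(2)[of x y] d2(2)[of x y] y by (auto simp: algebra_simps abs_le_iff)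
        qed simp
      qed (use d1 d2 in auto)
    qed
    then show ?thesis by (auto simp: differentiable_def)
  qed
  ultimately show ?thesis
    by (intro AE_I'[of Z]) (auto simp: negligible_iff_null_sets)
qed

text \<open>Adding \<open>(L + 1) * x\<close> moves slopes between \<open>- L\<close> and
  \<open>L\<close> to slopes between \<open>1\<close> and \<open>2 * L + 1\<close>, which is the
  bi-Lipschitz case; the linear term is subtracted afterwards.\<close>

lemma lipschitz_real_differentiable_AE:
  fixes f :: "real \<Rightarrow> real"
  assumes "L-lipschitz_on UNIV f"
  shows "AE x in lebesgue. f differentiable (at x)"
proof -
  have L: "\<bar>f y - f x\<bar> \<le> L * \<bar>y - x\<bar>" for x y
    using lipschitz_onD[OF assms, of y x] by (simp add: dist_real_def)
  have "AE x in lebesgue. (\<lambda>x. f x + (L + 1) * x) differentiable (at x)"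
  proof (rule bilipschitz_differentiable_AE)
    fix x y :: real assume "x \<le> y"
    then show "y - x \<le> f y + (L + 1) * y - (f x + (L + 1) * x)"
      using L[of y x] by (simp add: abs_le_iff algebra_simps)
    show "f y + (L + 1) * y - (f x + (L + 1) * x) \<le> (2 * L + 1) * (y - x)"
      using L[of y x] \<open>x \<le> y\<close> by (simp add: abs_le_iff algebra_simps)
  qed
  then show ?thesis
  proof (rule AE_mp, intro AE_I2 impI)
    fix x assume "(\<lambda>x. f x + (L + 1) * x) differentiable (at x)"
    then have "(\<lambda>x. (f x + (L + 1) * x) - (L + 1) * x) differentiable (at x)"
      by (rule differentiable_diff) auto
    then show "f differentiable (at x)" by simp
  qed
qed

lemma lipschitz_differentiable_AE:
  fixes f :: "real \<Rightarrow> 'a::euclidean_space"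
  assumes "L-lipschitz_on UNIV f"
  shows "AE x in lebesgue. f differentiable (at x)"
proof -
  have "AE x in lebesgue. (\<lambda>t. f t \<bullet> b) differentiable (at x)" if b: "b \<in> Basis" for b
  proof (rule lipschitz_real_differentiable_AE)
    have L: "0 \<le> L" using assms by (rule lipschitz_on_nonneg)
    show "L-lipschitz_on UNIV (\<lambda>t. f t \<bullet> b)"
    proof (rule lipschitz_onI)
      fix x y
      show "dist (f x \<bullet> b) (f y \<bullet> b) \<le> L * dist x y"
        using lipschitz_onD[OF assms, of x y] Basis_le_norm[OF b, of "f x - f y"]
        by (auto simp: dist_norm inner_diff_left)
    qed (rule L)
  qed
  then have "AE x in lebesgue. \<forall>b\<in>Basis. (\<lambda>t. f t \<bullet> b) differentiable (at x)"
    by (subst AE_ball_countable) (auto intro: countable_finite)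
  then show ?thesis
    by (rule AE_mp) (auto simp: differentiable_componentwise_within[of f])
qed

section \<open>Standard set-valued maps\<close>

text \<open>The supremum in the definition is a conditionally complete one, so it dominates the
  individual norms because \<open>F x\<close>, being compact, is bounded.\<close>

lemma standard_map_linear_growth:
  assumes "standard_map F"
  obtains c where "c > 0" "\<And>x v. v \<in> F x \<Longrightarrow> norm v \<le> c * (1 + norm x)"
proof -
  obtain c where c: "c > 0" "\<And>x. (SUP z\<in>F x. norm z) \<le> c * (1 + norm x)"
    using assms by (auto simp: standard_map_def)
  have "norm v \<le> c * (1 + norm x)" if "v \<in> F x" for x v
  proof -
    have "bounded (F x)" using assms by (auto simp: standard_map_def compact_imp_bounded)
    then have "bdd_above (norm ` F x)" by (auto simp: bounded_iff bdd_above_def)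
    then have "norm v \<le> (SUP z\<in>F x. norm z)" using that by (intro cSUP_upper)
    then show ?thesis using c(2)[of x] by linarith
  qed
  then show ?thesis using that c(1) by blast
qed

text \<open>Closed graph plus local boundedness: values \<open>v n\<close> at points tending to
  \<open>a\<close> have a convergent subsequence, its limit lies in \<open>F a\<close> by
  closedness, and so they cannot all stay at distance more than \<open>e\<close> from
  \<open>F a\<close>.\<close>

lemma standard_map_upper_semicontinuous:
  fixes F :: "'a::euclidean_space \<Rightarrow> 'a set"
  assumes F: "standard_map F" and e: "e > 0"
  obtains d where "d > 0" "\<And>w v. dist w a \<le> d \<Longrightarrow> v \<in> F w \<Longrightarrow> \<exists>z\<in>F a. dist v z \<le> e"
proof (rule ccontr)
  assume "\<not> thesis"
  then have "\<forall>n. \<exists>w v. dist w a \<le> inverse (real (Suc n)) \<and> v \<in> F w \<and> (\<forall>z\<in>F a. dist v z > e)"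
    using that by (metis inverse_positive_iff_positive not_le of_nat_0_less_iff zero_less_Suc)
  then obtain w v where wv: "\<And>n. dist (w n) a \<le> inverse (real (Suc n))" "\<And>n. v n \<in> F (w n)"
    "\<And>n z. z \<in> F a \<Longrightarrow> dist (v n) z > e" by metis
  obtain c where c: "c > 0" "\<And>x v. v \<in> F x \<Longrightarrow> norm v \<le> c * (1 + norm x)"
    using standard_map_linear_growth[OF F] by blast
  have "norm (v n) \<le> c * (1 + (norm a + 1))" for n
  proof -
    have "norm (w n) \<le> norm a + dist (w n) a" by (metis dist_norm norm_triangle_sub)
    also have "dist (w n) a \<le> 1" using wv(1)[of n] by (rule order_trans) (simp add: inverse_le_1_iff)
    finally show ?thesis using c(2)[OF wv(2)[of n]] c(1)
      by (elim order_trans) (intro mult_left_mono, auto)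
  qed
  then have "bounded (range v)" by (auto simp: bounded_iff)
  then obtain l r where lr: "strict_mono r" "(v \<circ> r) \<longlonglongrightarrow> l"
    using bounded_imp_convergent_subsequence by blast
  have "w \<longlonglongrightarrow> a"
    by (rule tendsto_dist_iff[THEN iffD2],
        rule tendsto_sandwich[OF _ _ tendsto_const LIMSEQ_inverse_real_of_nat])
       (use wv(1) in auto)
  then have "(w \<circ> r) \<longlonglongrightarrow> a" using lr(1) by (rule LIMSEQ_subseq_LIMSEQ)
  then have "(\<lambda>n. ((w \<circ> r) n, (v \<circ> r) n)) \<longlonglongrightarrow> (a, l)" using lr(2) by (rule tendsto_Pair)
  moreover have "closed {(x, y). y \<in> F x}" using F by (simp add: standard_map_def)
  ultimately have "(a, l) \<in> {(x, y). y \<in> F x}"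
    by (rule closed_sequentially[rotated 2]) (use wv(2) in auto)
  then have "dist ((v \<circ> r) n) l > e" for n using wv(3) by auto
  moreover have "\<forall>\<^sub>F n in sequentially. dist ((v \<circ> r) n) l < e" using lr(2) e by (rule tendstoD)
  ultimately show False by (auto simp: eventually_sequentially) (meson less_asym order_refl)
qed

text \<open>Time reversal exchanges solutions for \<open>- F\<close> and for \<open>F\<close>; this
  supplies the past of a curve known only on the half line.\<close>

lemma standard_map_uminus:
  fixes F :: "'a::euclidean_space \<Rightarrow> 'a set"
  assumes "standard_map F"
  shows "standard_map (\<lambda>x. uminus ` F x)"
  unfolding standard_map_def
proof (intro conjI allI)
  fix x
  show "uminus ` F x \<noteq> {}" "compact (uminus ` F x)" "convex (uminus ` F x)"
    using assms by (auto simp: standard_map_def compact_negations convex_negations)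
next
  have "{(x, y). y \<in> uminus ` F x} = (\<lambda>p. (fst p, - snd p)) -` {(x, y). y \<in> F x}"
    by (auto simp: image_iff) (metis minus_minus)
  moreover have "closed {(x, y). y \<in> F x}" using assms by (simp add: standard_map_def)
  ultimately show "closed {(x, y). y \<in> uminus ` F x}"
    by (simp only:) (intro closed_vimage continuous_intros)
next
  have "(SUP z\<in>uminus ` F x. norm z) = (SUP z\<in>F x. norm z)" for x
    by (simp add: image_image)
  then show "\<exists>c>0. \<forall>x. (SUP z\<in>uminus ` F x. norm z) \<le> c * (1 + norm x)"
    using assms by (simp add: standard_map_def)
qed

section \<open>Step sizes and perturbed Euler schemes\<close>

locale step_sizes =
  fixes \<gamma> :: "nat \<Rightarrow> real"
  assumes pos: "n \<ge> 1 \<Longrightarrow> \<gamma> n > 0"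
    and unbounded: "filterlim (step_time \<gamma>) at_top sequentially"

text \<open>The inverse of \<open>step_time\<close>. Because of the strict inequality a grid time
  \<open>step_time \<gamma> n\<close> has index \<open>n\<close> itself, whereas
  \<open>interpolation\<close> counts a positive grid time to the interval on its left.\<close>

definition step_index :: "(nat \<Rightarrow> real) \<Rightarrow> real \<Rightarrow> nat" where
  "step_index \<gamma> t = (LEAST n. t < step_time \<gamma> (Suc n))"

lemma step_time_0 [simp]: "step_time \<gamma> 0 = 0"
  by (simp add: step_time_def)

context step_sizes begin

lemma step_time_le: "m \<le> n \<Longrightarrow> step_time \<gamma> m \<le> step_time \<gamma> n"
  using step_time_less[of \<gamma> m n] pos by (cases "m = n") (auto simp: less_le)

lemma step_time_nonneg: "0 \<le> step_time \<gamma> n"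
  using step_time_le[of 0 n] by simp

lemma step_index_bounds:
  assumes "0 \<le> t"
  shows "step_time \<gamma> (step_index \<gamma> t) \<le> t" "t < step_time \<gamma> (Suc (step_index \<gamma> t))"
proof -
  have "\<forall>\<^sub>F n in sequentially. t < step_time \<gamma> n"
    using unbounded by (simp add: filterlim_at_top_dense)
  then obtain n where "t < step_time \<gamma> n" by (auto simp: eventually_sequentially)
  then have "t < step_time \<gamma> (Suc n)" using step_time_le[of n "Suc n"] by simp
  then show u: "t < step_time \<gamma> (Suc (step_index \<gamma> t))"
    unfolding step_index_def by (rule LeastI)
  show "step_time \<gamma> (step_index \<gamma> t) \<le> t"
  proof (cases "step_index \<gamma> t")
    case (Suc j)
    then have "\<not> t < step_time \<gamma> (Suc j)" unfolding step_index_def by (metis lessI not_less_Least)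
    then show ?thesis using Suc by simp
  qed (use assms in simp)
qed

lemma step_index_greatest: "step_time \<gamma> n \<le> t \<Longrightarrow> n \<le> step_index \<gamma> t"
  using step_index_bounds(2)[of t] step_time_nonneg[of n] step_time_le[of "Suc (step_index \<gamma> t)" n]
  by (cases "n \<le> step_index \<gamma> t") auto

lemma step_index_mono: "0 \<le> s \<Longrightarrow> s \<le> t \<Longrightarrow> step_index \<gamma> s \<le> step_index \<gamma> t"
  using step_index_bounds(1)[of s] step_index_greatest[of "step_index \<gamma> s" t] by simp

lemma step_index_step_time: "step_index \<gamma> (step_time \<gamma> n) = n"
proof (rule antisym)
  show "n \<le> step_index \<gamma> (step_time \<gamma> n)" by (rule step_index_greatest) simp
  show "step_index \<gamma> (step_time \<gamma> n) \<le> n"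
    using step_index_bounds(1)[OF step_time_nonneg, of n] step_time_less[of \<gamma> n "step_index \<gamma> (step_time \<gamma> n)"] pos
    by (cases "step_index \<gamma> (step_time \<gamma> n) \<le> n") auto
qed

lemma step_index_0: "step_index \<gamma> 0 = 0"
  using step_index_step_time[of 0] by simp

end

definition perturbed_scheme ::
    "('a::real_vector \<Rightarrow> 'a set) \<Rightarrow> (nat \<Rightarrow> real) \<Rightarrow> (nat \<Rightarrow> 'a) \<Rightarrow> (nat \<Rightarrow> 'a) \<Rightarrow> bool" where
  "perturbed_scheme F \<gamma> x u \<longleftrightarrow>
     (\<forall>n. x (Suc n) - x n - \<gamma> (Suc n) *\<^sub>R u (Suc n) \<in> (\<lambda>v. \<gamma> (Suc n) *\<^sub>R v) ` F (x n))"

definition noise_sum :: "(nat \<Rightarrow> real) \<Rightarrow> (nat \<Rightarrow> 'a::real_vector) \<Rightarrow> nat \<Rightarrow> 'a" where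
  "noise_sum \<gamma> u n = (\<Sum>i=1..n. \<gamma> i *\<^sub>R u i)"

lemma noise_sum_0 [simp]: "noise_sum \<gamma> u 0 = 0"
  and noise_sum_Suc: "noise_sum \<gamma> u (Suc n) = noise_sum \<gamma> u n + \<gamma> (Suc n) *\<^sub>R u (Suc n)"
  by (simp_all add: noise_sum_def)

text \<open>After removal of the noise, the mean slope is the convex combination of the selected
  velocities, with the step sizes divided by the elapsed time as weights. For \<open>Q\<close> a
  convex neighborhood of a value of \<open>F\<close>, this is the discrete form of a difference
  quotient staying near \<open>F\<close>.\<close>

lemma (in step_sizes) perturbed_scheme_average:
  assumes x: "perturbed_scheme F \<gamma> x u" and "m < n" and "convex Q"
    and Q: "\<And>i. m \<le> i \<Longrightarrow> i < n \<Longrightarrow> F (x i) \<subseteq> Q"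
  shows "(1 / (step_time \<gamma> n - step_time \<gamma> m)) *\<^sub>R
           (x n - x m - (noise_sum \<gamma> u n - noise_sum \<gamma> u m)) \<in> Q"
proof -
  have "\<forall>i. \<exists>v. v \<in> F (x i) \<and> x (Suc i) = x i + \<gamma> (Suc i) *\<^sub>R u (Suc i) + \<gamma> (Suc i) *\<^sub>R v"
  proof
    fix i
    have "x (Suc i) - x i - \<gamma> (Suc i) *\<^sub>R u (Suc i) \<in> (\<lambda>v. \<gamma> (Suc i) *\<^sub>R v) ` F (x i)"
      using x by (simp add: perturbed_scheme_def)
    then obtain v where v: "v \<in> F (x i)" "x (Suc i) - x i - \<gamma> (Suc i) *\<^sub>R u (Suc i) = \<gamma> (Suc i) *\<^sub>R v"
      by blast
    have "x (Suc i) = x i + \<gamma> (Suc i) *\<^sub>R u (Suc i) + \<gamma> (Suc i) *\<^sub>R v"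
      unfolding v(2)[symmetric] by simp
    then show "\<exists>v. v \<in> F (x i) \<and> x (Suc i) = x i + \<gamma> (Suc i) *\<^sub>R u (Suc i) + \<gamma> (Suc i) *\<^sub>R v"
      using v(1) by blast
  qed
  then obtain v where v: "\<And>i. v i \<in> F (x i)"
    "\<And>i. x (Suc i) = x i + \<gamma> (Suc i) *\<^sub>R u (Suc i) + \<gamma> (Suc i) *\<^sub>R v i" by metis
  let ?D = "step_time \<gamma> n - step_time \<gamma> m"
  have D: "?D > 0" using step_time_less[of \<gamma> m n] pos \<open>m < n\<close> by simp
  have x_sum: "x k - x m - (noise_sum \<gamma> u k - noise_sum \<gamma> u m) = (\<Sum>i=m..<k. \<gamma> (Suc i) *\<^sub>R v i)
      \<and> step_time \<gamma> k - step_time \<gamma> m = (\<Sum>i=m..<k. \<gamma> (Suc i))" if "m \<le> k" for k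
    using that
  proof (induction k rule: dec_induct)
    case (step k)
    then show ?case
      by (simp add: v(2)[of k] noise_sum_Suc step_time_Suc algebra_simps)
  qed simp
  have "(\<Sum>i=m..<n. (\<gamma> (Suc i) / ?D) *\<^sub>R v i) \<in> Q"
  proof (rule convex_sum)
    show "(\<Sum>i=m..<n. \<gamma> (Suc i) / ?D) = 1"
      using x_sum[of n] D \<open>m < n\<close> by (simp add: sum_divide_distrib[symmetric])
  qed (use D pos v(1) subsetD[OF Q v(1)] \<open>convex Q\<close> in \<open>auto simp: less_imp_le\<close>)
  also have "(\<Sum>i=m..<n. (\<gamma> (Suc i) / ?D) *\<^sub>R v i) = (1 / ?D) *\<^sub>R (\<Sum>i=m..<n. \<gamma> (Suc i) *\<^sub>R v i)"
    by (simp add: scaleR_right.sum)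
  finally show ?thesis using x_sum[of n] \<open>m < n\<close> by simp
qed

lemma (in step_sizes) perturbed_scheme_step_le:
  assumes x: "perturbed_scheme F \<gamma> x u"
    and c: "\<And>v. v \<in> F (x n) \<Longrightarrow> norm v \<le> C" and u: "norm (u (Suc n)) \<le> K"
  shows "norm (x (Suc n) - x n) \<le> (C + K) * \<gamma> (Suc n)"
proof -
  obtain v where v: "v \<in> F (x n)" "x (Suc n) - x n - \<gamma> (Suc n) *\<^sub>R u (Suc n) = \<gamma> (Suc n) *\<^sub>R v"
    using x by (auto simp: perturbed_scheme_def)
  have "x (Suc n) - x n = \<gamma> (Suc n) *\<^sub>R (v + u (Suc n))"
    using v(2) by (simp add: algebra_simps)
  then have "norm (x (Suc n) - x n) = \<gamma> (Suc n) * norm (v + u (Suc n))"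
    using pos[of "Suc n"] by simp
  also have "\<dots> \<le> \<gamma> (Suc n) * (C + K)"
    using pos[of "Suc n"] c[OF v(1)] u norm_triangle_ineq[of v "u (Suc n)"]
    by (intro mult_left_mono) auto
  finally show ?thesis by (simp add: mult.commute)
qed

lemma (in step_sizes) perturbed_scheme_lipschitz:
  assumes x: "perturbed_scheme F \<gamma> x u"
    and c: "\<And>i v. i < n \<Longrightarrow> v \<in> F (x i) \<Longrightarrow> norm v \<le> C" and u: "\<And>n. n \<ge> 1 \<Longrightarrow> norm (u n) \<le> K"
    and "m \<le> n"
  shows "norm (x n - x m) \<le> (C + K) * (step_time \<gamma> n - step_time \<gamma> m)"
  using \<open>m \<le> n\<close> c
proof (induction n rule: dec_induct)
  case (step k)
  have "norm (x (Suc k) - x m) \<le> norm (x (Suc k) - x k) + norm (x k - x m)"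
    by (metis add_diff_cancel_left' diff_add_cancel diff_diff_eq2 norm_triangle_ineq)
  also have "norm (x (Suc k) - x k) \<le> (C + K) * \<gamma> (Suc k)"
    using step.prems u by (intro perturbed_scheme_step_le[OF x]) auto
  also have "norm (x k - x m) \<le> (C + K) * (step_time \<gamma> k - step_time \<gamma> m)"
    using step.prems by (intro step.IH) (metis less_SucI)
  finally show ?case by (simp add: step_time_Suc algebra_simps)
qed simp


text \<open>A compactness argument in the manner of Arzela and Ascoli. Boundedness of
  \<open>u\<close> yields the Lipschitz bound, while the smallness of the accumulated noise makes it
  disappear from the slopes. The bound on \<open>x\<close> is only asked for on each time horizon
  because Euler schemes may grow exponentially. The Lipschitz constant for the schemes is part of
  the conclusion since positions at varying times are later compared with \<open>y\<close>.\<close>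

lemma euler_limit:
  fixes F :: "'a::euclidean_space \<Rightarrow> 'a set" and x u :: "nat \<Rightarrow> nat \<Rightarrow> 'a"
  assumes F: "standard_map F"
    and steps: "\<And>k. step_sizes (g k)"
    and mesh: "\<And>k n. n \<ge> 1 \<Longrightarrow> g k n \<le> \<mu> k" "\<mu> \<longlonglongrightarrow> 0"
    and scheme: "\<And>k. perturbed_scheme F (g k) (x k) (u k)"
    and start: "(\<lambda>k. x k 0) \<longlonglongrightarrow> z"
    and bound: "\<And>R. \<exists>B. \<forall>k n. step_time (g k) n \<le> R \<longrightarrow> norm (x k n) \<le> B"
    and u: "\<And>k n. n \<ge> 1 \<Longrightarrow> norm (u k n) \<le> K"
    and noise: "\<And>R e. e > 0 \<Longrightarrow> \<forall>\<^sub>F k in sequentially. \<forall>n. step_time (g k) n \<le> R \<longrightarrow>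
                  norm (noise_sum (g k) (u k) n) \<le> e"
  obtains r y where "strict_mono r" "y 0 = z"
    "\<And>t. t \<ge> 0 \<Longrightarrow> (\<lambda>j. x (r j) (step_index (g (r j)) t)) \<longlonglongrightarrow> y t"
    "\<And>R. \<exists>L\<ge>0. (\<forall>k m n. m \<le> n \<longrightarrow> step_time (g k) n \<le> R \<longrightarrow>
        norm (x k n - x k m) \<le> L * (step_time (g k) n - step_time (g k) m)) \<and> L-lipschitz_on {0..R} y"
    "AE t in lebesgue. 0 < t \<longrightarrow> (\<exists>v\<in>F (y t). (y has_vector_derivative v) (at t))"
proof -
  define \<tau> where "\<tau> = (\<lambda>k. step_time (g k))"
  define \<iota> where "\<iota> = (\<lambda>k. step_index (g k))"
  define Y where "Y = (\<lambda>k t. x k (\<iota> k t))"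
  define S where "S = (\<lambda>k. noise_sum (g k) (u k))"
  obtain c where c: "c > 0" "\<And>x v. v \<in> F x \<Longrightarrow> norm v \<le> c * (1 + norm x)"
    using standard_map_linear_growth[OF F] by blast
  have \<tau>\<iota>: "\<tau> k (\<iota> k t) \<le> t" "t \<le> \<tau> k (\<iota> k t) + \<mu> k" if "0 \<le> t" for k t
    using step_sizes.step_index_bounds[OF steps that, of k] mesh(1)[of "Suc (\<iota> k t)" k]
    by (auto simp: \<tau>_def \<iota>_def step_time_Suc)
  have \<iota>_mono: "\<iota> k s \<le> \<iota> k t" if "0 \<le> s" "s \<le> t" for k s t
    using step_sizes.step_index_mono[OF steps that] by (simp add: \<iota>_def)
  have \<mu>0: "\<mu> k \<ge> 0" for k using mesh(1)[of 1 k] step_sizes.pos[OF steps, of 1 k] by simp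
  have K0: "K \<ge> 0" using u[of 1 0] norm_ge_zero[of "u 0 1"] by linarith

  \<comment> \<open>Lipschitz bounds that are uniform in the scheme\<close>
  have "\<exists>L\<ge>0. \<forall>k m n. m \<le> n \<longrightarrow> \<tau> k n \<le> R \<longrightarrow> norm (x k n - x k m) \<le> L * (\<tau> k n - \<tau> k m)" for R
  proof -
    obtain B where B: "\<And>k n. \<tau> k n \<le> R \<Longrightarrow> norm (x k n) \<le> B" using bound[of R] by (auto simp: \<tau>_def)
    show ?thesis
    proof (intro exI conjI allI impI)
      show "c * (1 + \<bar>B\<bar>) + K \<ge> 0" using c K0 by simp
      fix k m n assume mn: "m \<le> n" "\<tau> k n \<le> R"
      show "norm (x k n - x k m) \<le> (c * (1 + \<bar>B\<bar>) + K) * (\<tau> k n - \<tau> k m)"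
        unfolding \<tau>_def
      proof (rule step_sizes.perturbed_scheme_lipschitz[OF steps scheme _ u mn(1)])
        fix i v assume iv: "i < n" "v \<in> F (x k i)"
        have "\<tau> k i \<le> R" using step_sizes.step_time_le[OF steps, of i n k] iv(1) mn(2) by (simp add: \<tau>_def)
        then have "norm (x k i) \<le> \<bar>B\<bar>" using B[of k i] by linarith
        then show "norm v \<le> c * (1 + \<bar>B\<bar>)"
          using c(2)[OF iv(2)] c(1) by (elim order_trans) (intro mult_left_mono, auto)
      qed
    qed
  qed
  then obtain L where L: "\<And>R. L R \<ge> 0"
    "\<And>R k m n. m \<le> n \<Longrightarrow> \<tau> k n \<le> R \<Longrightarrow> norm (x k n - x k m) \<le> L R * (\<tau> k n - \<tau> k m)" by metis
  \<comment> \<open>\<open>Y k\<close> is a step function and jumps at grid times, so it is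
    Lipschitz only up to the mesh; this is the origin of the extra \<open>\<mu> k\<close>, which
    vanishes in the limit.\<close>
  have Y_lip: "norm (Y k t - Y k s) \<le> L R * (t - s + \<mu> k)" if "0 \<le> s" "s \<le> t" "t \<le> R" for k s t R
  proof -
    have "norm (Y k t - Y k s) \<le> L R * (\<tau> k (\<iota> k t) - \<tau> k (\<iota> k s))"
      unfolding Y_def using that \<iota>_mono \<tau>\<iota>(1)[of t k] by (intro L(2)) auto
    also have "\<dots> \<le> L R * (t - s + \<mu> k)"
      using that \<tau>\<iota>(1)[of t k] \<tau>\<iota>(2)[of s k] L(1)[of R] by (intro mult_left_mono) auto
    finally show ?thesis .
  qed
  have Y0: "Y k 0 = x k 0" for k by (simp add: Y_def \<iota>_def step_sizes.step_index_0[OF steps])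
  have Y_bounded: "\<exists>B. \<forall>k. norm (Y k t) \<le> B" if "0 \<le> t" for t
    using bound[of t] \<tau>\<iota>(1)[OF that] unfolding Y_def \<tau>_def by blast

  \<comment> \<open>A subsequence that converges at every time\<close>
  define q where "q = from_nat_into (\<rat> \<inter> {0::real..})"
  have cq: "countable (\<rat> \<inter> {0::real..})" using countable_rat by (rule countable_subset[rotated]) auto
  have q0: "0 \<le> q n" for n using from_nat_into[of "\<rat> \<inter> {0::real..}" n] by (auto simp: q_def)
  interpret subseqs "\<lambda>n s. convergent (\<lambda>j. Y (s j) (q n))"
  proof
    fix n and s :: "nat \<Rightarrow> nat" assume "strict_mono s"
    obtain B where "\<And>k. norm (Y k (q n)) \<le> B" using Y_bounded[OF q0] by blast
    then have "bounded (range (\<lambda>j. Y (s j) (q n)))" by (auto simp: bounded_iff)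
    then obtain l r' where "strict_mono r'" "((\<lambda>j. Y (s j) (q n)) \<circ> r') \<longlonglongrightarrow> l"
      using bounded_imp_convergent_subsequence by blast
    then show "\<exists>r'. strict_mono r' \<and> convergent (\<lambda>j. Y ((s \<circ> r') j) (q n))"
      by (auto simp: convergent_def o_def)
  qed
  define r where "r = diagseq"
  have r: "strict_mono r" unfolding r_def by (rule subseq_diagseq)
  have conv_q: "convergent (\<lambda>j. Y (r j) (q n))" for n
  proof -
    have "convergent (\<lambda>j. Y ((diagseq \<circ> (+) (Suc n)) j) (q n))"
    proof (rule diagseq_holds)
      fix r s :: "nat \<Rightarrow> nat" and n assume "strict_mono r" "convergent (\<lambda>j. Y (s j) (q n))"
      then show "convergent (\<lambda>j. Y ((s \<circ> r) j) (q n))"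
        using convergent_subseq_convergent[of "\<lambda>j. Y (s j) (q n)" r] by (simp add: o_def)
    qed
    then have "convergent (\<lambda>j. Y (r (j + Suc n)) (q n))" by (simp add: r_def add.commute)
    then show ?thesis by (rule convergent_ignore_initial_segment[THEN iffD1])
  qed
  have \<mu>r: "(\<lambda>j. \<mu> (r j)) \<longlonglongrightarrow> 0" using LIMSEQ_subseq_LIMSEQ[OF mesh(2) r] by (simp add: o_def)
  have "convergent (\<lambda>j. Y (r j) t)" if t: "0 \<le> t" for t
  proof (rule Cauchy_convergent, rule metric_CauchyI)
    fix e :: real assume e: "e > 0"
    \<comment> \<open>Moving from \<open>t\<close> to a rational \<open>p\<close> at distance less
      than \<open>d\<close> costs at most \<open>L (t + 1) * (d + d)\<close>, hence at most
      \<open>e / 4\<close>, once the mesh is below \<open>d\<close>. The \<open>1\<close> in the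
      minimum keeps \<open>p\<close> within the horizon \<open>t + 1\<close>; the added
      \<open>1\<close> in the denominator keeps it positive.\<close>
    define d where "d = min 1 (e / (8 * (L (t + 1) + 1)))"
    have d: "d > 0" "L (t + 1) * d \<le> e / 8"
    proof -
      show "d > 0" using e L(1)[of "t + 1"] by (simp add: d_def)
      have "L (t + 1) * d \<le> (L (t + 1) + 1) * (e / (8 * (L (t + 1) + 1)))"
        using L(1)[of "t + 1"] e \<open>d > 0\<close> by (intro mult_mono) (auto simp: d_def)
      also have "\<dots> = e / 8" using L(1)[of "t + 1"] by (simp add: field_simps)
      finally show "L (t + 1) * d \<le> e / 8" .
    qed
    obtain p where p: "p \<in> \<rat>" "t < p" "p < t + d" using Rats_dense_in_real[of t "t + d"] d by auto
    then have "p \<in> \<rat> \<inter> {0..}" using t by auto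
    then obtain n where n: "q n = p" using from_nat_into_surj[OF cq] unfolding q_def by blast
    have "Cauchy (\<lambda>j. Y (r j) p)" using conv_q[of n] unfolding n by (rule convergent_Cauchy)
    then obtain N1 where N1: "\<And>i j. i \<ge> N1 \<Longrightarrow> j \<ge> N1 \<Longrightarrow> dist (Y (r i) p) (Y (r j) p) < e / 4"
      using e by (metis metric_CauchyD zero_less_divide_iff zero_less_numeral)
    obtain N2 where N2: "\<And>j. j \<ge> N2 \<Longrightarrow> \<mu> (r j) < d"
      using order_tendstoD(2)[OF \<mu>r d(1)] by (auto simp: eventually_sequentially)
    have close: "dist (Y (r j) p) (Y (r j) t) \<le> e / 4" if "j \<ge> N2" for j
    proof -
      have "norm (Y (r j) p - Y (r j) t) \<le> L (t + 1) * (p - t + \<mu> (r j))"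
        using p d t by (intro Y_lip) (auto simp: d_def)
      also have "\<dots> \<le> L (t + 1) * (d + d)"
        using p N2[OF that] L(1)[of "t + 1"] by (intro mult_left_mono) auto
      also have "\<dots> \<le> e / 4" using d(2) by (simp add: algebra_simps)
      finally show ?thesis by (simp add: dist_norm)
    qed
    show "\<exists>M. \<forall>i\<ge>M. \<forall>j\<ge>M. dist (Y (r i) t) (Y (r j) t) < e"
    proof (intro exI allI impI)
      fix i j assume ij: "max N1 N2 \<le> i" "max N1 N2 \<le> j"
      have "dist (Y (r i) t) (Y (r j) t) \<le> dist (Y (r i) p) (Y (r i) t) + dist (Y (r i) p) (Y (r j) p) + dist (Y (r j) p) (Y (r j) t)"
        using dist_triangle[of "Y (r i) t" "Y (r j) t" "Y (r i) p"] dist_triangle[of "Y (r i) p" "Y (r j) t" "Y (r j) p"]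
        by (simp add: dist_commute)
      then show "dist (Y (r i) t) (Y (r j) t) < e" using close[of i] close[of j] N1[of i j] ij e by auto
    qed
  qed
  then obtain y where y: "\<And>t. 0 \<le> t \<Longrightarrow> (\<lambda>j. Y (r j) t) \<longlonglongrightarrow> y t"
    unfolding convergent_def by metis
  have y_lip: "(L R)-lipschitz_on {0..R} y" for R
  proof (rule lipschitz_on_leI)
    fix s t assume st: "s \<in> {0..R}" "t \<in> {0..R}" "s \<le> t"
    have "(\<lambda>j. L R * (t - s + \<mu> (r j))) \<longlonglongrightarrow> L R * (t - s + 0)"
      by (intro tendsto_intros \<mu>r)
    moreover have "(\<lambda>j. norm (Y (r j) t - Y (r j) s)) \<longlonglongrightarrow> norm (y t - y s)"
      using st by (intro tendsto_intros y) auto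
    ultimately have "norm (y t - y s) \<le> L R * (t - s + 0)"
      by (rule tendsto_le[rotated]) (use Y_lip st in auto)
    then show "dist (y s) (y t) \<le> L R * dist s t"
      using st by (simp add: dist_norm norm_minus_commute)
  qed (rule L(1))

  \<comment> \<open>Derivatives of the limit curve are values of \<open>F\<close>\<close>
  have deriv: "v \<in> F (y t)" if t: "0 < t" and v: "(y has_vector_derivative v) (at t)" for t v
  proof -
    have near: "\<exists>w\<in>F (y t). dist w v \<le> 2 * e" if e: "e > 0" for e
    proof -
      \<comment> \<open>The closed \<open>e\<close>-neighborhood of \<open>F (y t)\<close>. As a sum
        of two compact convex sets it is convex and closed, so it is preserved by averages and by
        limits.\<close>
      define Q where "Q = (\<Union>w\<in>F (y t). \<Union>b\<in>cball 0 e. {w + b})"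
      have "compact (F (y t))" "convex (F (y t))" using F by (auto simp: standard_map_def)
      then have "convex Q" "compact Q" unfolding Q_def by (auto intro!: convex_sums compact_sums')
      then have "closed Q" by (simp add: compact_imp_closed)
      obtain d where d: "d > 0" "\<And>w v. dist w (y t) \<le> d \<Longrightarrow> v \<in> F w \<Longrightarrow> \<exists>z\<in>F (y t). dist v z \<le> e"
        using standard_map_upper_semicontinuous[OF F e] by blast
      have FQ: "F w \<subseteq> Q" if w: "dist w (y t) \<le> d" for w
      proof
        fix v assume "v \<in> F w"
        then obtain z where "z \<in> F (y t)" "dist v z \<le> e" using d(2)[OF w] by blast
        then have "z \<in> F (y t)" "v - z \<in> cball 0 e" "v \<in> {z + (v - z)}"
          by (auto simp: dist_norm norm_minus_commute)
        then show "v \<in> Q" unfolding Q_def by blast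
      qed
      \<comment> \<open>For \<open>h\<close> and mesh below \<open>\<eta>\<close> the window is
        shorter than \<open>2 * \<eta>\<close>, so the scheme moves by at most \<open>d / 2\<close>
        in it. Starting within \<open>d / 4\<close> of \<open>y t\<close>, it stays where all values
        of \<open>F\<close> belong to \<open>Q\<close>.\<close>
      define \<eta> where "\<eta> = min 1 (d / (4 * (L (t + 1) + 1)))"
      have \<eta>: "\<eta> > 0" "\<eta> \<le> 1" "L (t + 1) * \<eta> \<le> d / 4"
      proof -
        show "\<eta> > 0" "\<eta> \<le> 1" using d L(1)[of "t + 1"] by (auto simp: \<eta>_def)
        have "L (t + 1) * \<eta> \<le> (L (t + 1) + 1) * (d / (4 * (L (t + 1) + 1)))"
          using L(1)[of "t + 1"] d \<open>\<eta> > 0\<close> by (intro mult_mono) (auto simp: \<eta>_def)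
        also have "\<dots> = d / 4" using L(1)[of "t + 1"] by (simp add: field_simps)
        finally show "L (t + 1) * \<eta> \<le> d / 4" .
      qed
      \<comment> \<open>The slope of \<open>y\<close> is the limit of noise-corrected slopes of the
        schemes: the elapsed grid time \<open>D j\<close> tends to \<open>h\<close>, and the noise
        increment \<open>N j\<close> tends to 0 as a difference of two uniformly small partial
        sums.\<close>
      have quot: "(1 / h) *\<^sub>R (y (t + h) - y t) \<in> Q" if h: "0 < h" "h < \<eta>" for h
      proof -
        define D where "D = (\<lambda>j. \<tau> (r j) (\<iota> (r j) (t + h)) - \<tau> (r j) (\<iota> (r j) t))"
        define N where "N = (\<lambda>j. S (r j) (\<iota> (r j) (t + h)) - S (r j) (\<iota> (r j) t))"
        have D_bounds: "h - \<mu> (r j) \<le> D j" "D j \<le> h + \<mu> (r j)" for j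
          using \<tau>\<iota>[of t "r j"] \<tau>\<iota>[of "t + h" "r j"] t h by (auto simp: D_def)
        have D: "D \<longlonglongrightarrow> h"
        proof (rule tendsto_sandwich)
          show "(\<lambda>j. h - \<mu> (r j)) \<longlonglongrightarrow> h" using tendsto_diff[OF tendsto_const \<mu>r, of h] by simp
          show "(\<lambda>j. h + \<mu> (r j)) \<longlonglongrightarrow> h" using tendsto_add[OF tendsto_const \<mu>r, of h] by simp
        qed (use D_bounds in auto)
        have N: "N \<longlonglongrightarrow> 0"
        proof (rule tendstoI)
          fix a :: real assume a: "a > 0"
          have "\<forall>\<^sub>F k in sequentially. \<forall>n. \<tau> k n \<le> t + h \<longrightarrow> norm (S k n) \<le> a / 3"
            using noise[of "a / 3" "t + h"] a by (simp add: \<tau>_def S_def)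
          then have "\<forall>\<^sub>F j in sequentially. \<forall>n. \<tau> (r j) n \<le> t + h \<longrightarrow> norm (S (r j) n) \<le> a / 3"
            by (rule eventually_subseq[OF r])
          then show "\<forall>\<^sub>F j in sequentially. dist (N j) 0 < a"
          proof eventually_elim
            case (elim j)
            have "norm (N j) \<le> a / 3 + a / 3"
              unfolding N_def using elim \<tau>\<iota>(1)[of "t + h" "r j"] \<tau>\<iota>(1)[of t "r j"] t h
              by (intro order_trans[OF norm_triangle_ineq4 add_mono]) auto
            then show ?case using a by simp
          qed
        qed
        have Yt: "(\<lambda>j. Y (r j) t) \<longlonglongrightarrow> y t" "(\<lambda>j. Y (r j) (t + h)) \<longlonglongrightarrow> y (t + h)"
          using t h by (auto intro: y)
        have lim: "(\<lambda>j. (1 / D j) *\<^sub>R (Y (r j) (t + h) - Y (r j) t - N j)) \<longlonglongrightarrow> (1 / h) *\<^sub>R (y (t + h) - y t - 0)"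
          using h by (intro tendsto_intros D N Yt) auto
        have "\<forall>\<^sub>F j in sequentially. (1 / D j) *\<^sub>R (Y (r j) (t + h) - Y (r j) t - N j) \<in> Q"
        proof -
          have "\<forall>\<^sub>F j in sequentially. \<mu> (r j) < \<eta>" "\<forall>\<^sub>F j in sequentially. \<mu> (r j) < h"
            using order_tendstoD(2)[OF \<mu>r] h \<eta>(1) by auto
          moreover have "\<forall>\<^sub>F j in sequentially. dist (Y (r j) t) (y t) < d / 4"
            using Yt(1) d(1) by (intro tendstoD) auto
          ultimately show ?thesis
          proof eventually_elim
            case (elim j)
            let ?m = "\<iota> (r j) t" and ?n = "\<iota> (r j) (t + h)"
            have Dj: "D j > 0" using D_bounds(1)[of j] elim by simp
            have mn: "?m < ?n"
            proof (rule ccontr)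
              assume "\<not> ?m < ?n"
              then have "?m = ?n" using \<iota>_mono[of t "t + h" "r j"] t h by simp
              then show False using Dj by (simp add: D_def)
            qed
            have "F (x (r j) i) \<subseteq> Q" if i: "?m \<le> i" "i < ?n" for i
            proof (rule FQ)
              have \<tau>i: "\<tau> (r j) i \<le> \<tau> (r j) ?n"
                using step_sizes.step_time_le[OF steps, of i ?n "r j"] i by (simp add: \<tau>_def)
              have "norm (x (r j) i - Y (r j) t) \<le> L (t + 1) * (\<tau> (r j) i - \<tau> (r j) ?m)"
                unfolding Y_def using i \<tau>i \<tau>\<iota>(1)[of "t + h" "r j"] t h \<eta> by (intro L(2)) auto
              also have "\<dots> \<le> L (t + 1) * (\<eta> + \<eta>)"
                using \<tau>i D_bounds(2)[of j] h elim L(1)[of "t + 1"] by (intro mult_left_mono) (auto simp: D_def)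
              also have "\<dots> \<le> d / 2" using \<eta>(3) by (simp add: algebra_simps)
              finally have "dist (x (r j) i) (Y (r j) t) \<le> d / 2" by (simp add: dist_norm)
              then show "dist (x (r j) i) (y t) \<le> d"
                using dist_triangle[of "x (r j) i" "y t" "Y (r j) t"] elim d(1) by linarith
            qed
            then show ?case
              using step_sizes.perturbed_scheme_average[OF steps scheme mn \<open>convex Q\<close>]
              by (simp add: D_def N_def S_def Y_def \<tau>_def)
          qed
        qed
        then show ?thesis
          using Lim_in_closed_set[OF \<open>closed Q\<close> _ _ lim] by simp
      qed
      obtain d' where d': "d' > 0" "\<And>s. norm (s - t) < d' \<Longrightarrow> norm (y s - y t - (s - t) *\<^sub>R v) \<le> e * norm (s - t)"
        using v e unfolding has_vector_derivative_def has_derivative_at_alt by metis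
      define h where "h = min \<eta> d' / 2"
      have h: "0 < h" "h < \<eta>" "h < d'" using d' \<eta> by (auto simp: h_def min_def)
      have "norm (y (t + h) - y t - h *\<^sub>R v) \<le> e * h" using d'(2)[of "t + h"] h by simp
      then have "(1 / h) * norm (y (t + h) - y t - h *\<^sub>R v) \<le> e" using h by (simp add: field_simps)
      also have "(1 / h) * norm (y (t + h) - y t - h *\<^sub>R v) = norm ((1 / h) *\<^sub>R (y (t + h) - y t - h *\<^sub>R v))"
        using h by simp
      also have "(1 / h) *\<^sub>R (y (t + h) - y t - h *\<^sub>R v) = (1 / h) *\<^sub>R (y (t + h) - y t) - v"
        using h by (simp add: algebra_simps)
      finally have 1: "dist ((1 / h) *\<^sub>R (y (t + h) - y t)) v \<le> e" by (simp add: dist_norm)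
      obtain w b where w: "w \<in> F (y t)" "norm b \<le> e" "(1 / h) *\<^sub>R (y (t + h) - y t) = w + b"
        using quot[OF h(1,2)] unfolding Q_def by auto
      have "dist w v \<le> dist w (w + b) + dist (w + b) v" by (rule dist_triangle)
      also have "\<dots> \<le> e + e" using 1 w by (intro add_mono) (auto simp: dist_norm)
      finally show ?thesis using w(1) by auto
    qed
    have "\<exists>w\<in>F (y t). dist w v < e" if "e > 0" for e
      using near[of "e / 3"] that by force
    moreover have "closed (F (y t))" using F by (auto simp: standard_map_def compact_imp_closed)
    ultimately show ?thesis by (metis closed_approachable)
  qed

  \<comment> \<open>Differentiability of the limit curve almost everywhere\<close>
  have "AE t in lebesgue. \<forall>N::nat. t \<in> {0<..<real N} \<longrightarrow> y differentiable (at t)"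
    unfolding AE_all_countable
  proof
    fix N :: nat
    \<comment> \<open>Clamping the time to the interval from 0 to \<open>N\<close> gives a curve
      that is Lipschitz on the whole line and agrees with \<open>y\<close> near each interior
      time.\<close>
    define w where "w = (\<lambda>t. y (max 0 (min (real N) t)))"
    have "(L (real N))-lipschitz_on UNIV w"
    proof (rule lipschitz_onI)
      fix s t :: real
      have "dist (w s) (w t) \<le> L (real N) * dist (max 0 (min (real N) s)) (max 0 (min (real N) t))"
        unfolding w_def by (rule lipschitz_onD[OF y_lip]) auto
      also have "\<dots> \<le> L (real N) * dist s t"
        using L(1) by (intro mult_left_mono) (auto simp: dist_real_def)
      finally show "dist (w s) (w t) \<le> L (real N) * dist s t" .
    qed (rule L(1))
    then have "AE t in lebesgue. w differentiable (at t)" by (rule lipschitz_differentiable_AE)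
    then show "AE t in lebesgue. t \<in> {0<..<real N} \<longrightarrow> y differentiable (at t)"
    proof (rule AE_mp, intro AE_I2 impI)
      fix t assume "w differentiable (at t)" "t \<in> {0<..<real N}"
      then obtain D where D: "(w has_derivative D) (at t)" by (auto simp: differentiable_def)
      have "(y has_derivative D) (at t)"
        by (rule has_derivative_transform_within_open[OF D open_greaterThanLessThan \<open>t \<in> {0<..<real N}\<close>])
           (auto simp: w_def)
      then show "y differentiable (at t)" by (auto simp: differentiable_def)
    qed
  qed
  then have AE: "AE t in lebesgue. 0 < t \<longrightarrow> (\<exists>v\<in>F (y t). (y has_vector_derivative v) (at t))"
  proof (rule AE_mp, intro AE_I2 impI)
    fix t :: real assume *: "\<forall>N::nat. t \<in> {0<..<real N} \<longrightarrow> y differentiable (at t)" and t: "0 < t"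
    obtain N :: nat where "t < real N" using reals_Archimedean2 by blast
    then have "y differentiable (at t)" using * t by auto
    then have "(y has_vector_derivative vector_derivative y (at t)) (at t)"
      by (simp add: vector_derivative_works)
    then show "\<exists>v\<in>F (y t). (y has_vector_derivative v) (at t)" using deriv t by blast
  qed
  have y0: "y 0 = z"
  proof (rule LIMSEQ_unique)
    show "(\<lambda>j. Y (r j) 0) \<longlonglongrightarrow> y 0" by (rule y) simp
    show "(\<lambda>j. Y (r j) 0) \<longlonglongrightarrow> z"
      using LIMSEQ_subseq_LIMSEQ[OF start r] by (simp add: o_def Y0)
  qed
  show thesis
  proof (rule that[OF r y0 _ _ AE])
    show "(\<lambda>j. x (r j) (step_index (g (r j)) t)) \<longlonglongrightarrow> y t" if "t \<ge> 0" for t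
      using y[OF that] by (simp add: Y_def \<iota>_def)
    show "\<exists>L\<ge>0. (\<forall>k m n. m \<le> n \<longrightarrow> step_time (g k) n \<le> R \<longrightarrow>
        norm (x k n - x k m) \<le> L * (step_time (g k) n - step_time (g k) m)) \<and> L-lipschitz_on {0..R} y" for R
      using L y_lip[of R] unfolding \<tau>_def by blast
  qed
qed

section \<open>Solutions of the differential inclusion\<close>

lemma lipschitz_on_imp_abs_continuous_on:
  assumes f: "L-lipschitz_on S f"
  shows "abs_continuous_on S f"
  unfolding abs_continuous_on_def
proof (intro allI impI)
  fix e :: real assume e: "e > 0"
  have L: "L \<ge> 0" using f by (rule lipschitz_on_nonneg)
  show "\<exists>d>0. \<forall>D. finite D \<and> (\<forall>(u, v)\<in>D. u \<le> v \<and> {u..v} \<subseteq> S) \<and>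
        disjoint_family_on (\<lambda>(u, v). {u<..<v}) D \<and> (\<Sum>(u, v)\<in>D. v - u) < d
        \<longrightarrow> (\<Sum>(u, v)\<in>D. norm (f v - f u)) < e"
  proof (intro exI[of _ "e / (L + 1)"] conjI allI impI)
    show "0 < e / (L + 1)" using e L by simp
    fix D assume D: "finite D \<and> (\<forall>(u, v)\<in>D. u \<le> v \<and> {u..v} \<subseteq> S) \<and>
        disjoint_family_on (\<lambda>(u, v). {u<..<v}) D \<and> (\<Sum>(u, v)\<in>D. v - u) < e / (L + 1)"
    have "(\<Sum>(u, v)\<in>D. norm (f v - f u)) \<le> (\<Sum>(u, v)\<in>D. L * (v - u))"
    proof (rule sum_mono, clarify)
      fix u v assume "(u, v) \<in> D"
      then have "u \<le> v" "{u..v} \<subseteq> S" using D by auto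
      then have "u \<in> S" "v \<in> S" by (simp_all add: subset_eq)
      then show "norm (f v - f u) \<le> L * (v - u)"
        using lipschitz_onD[OF f, of v u] \<open>u \<le> v\<close> by (simp add: dist_norm)
    qed
    also have "\<dots> = L * (\<Sum>(u, v)\<in>D. v - u)" by (simp add: sum_distrib_left case_prod_unfold)
    also have "\<dots> \<le> L * (e / (L + 1))" using D L by (intro mult_left_mono) auto
    also have "\<dots> < e" using e L by (simp add: field_simps)
    finally show "(\<Sum>(u, v)\<in>D. norm (f v - f u)) < e" .
  qed
qed

text \<open>Unperturbed Euler schemes with constant steps \<open>1 / (k + 1)\<close> and arbitrarily
  selected velocities are fed into \<open>euler_limit\<close>.\<close>

lemma forward_solution_exists:
  fixes G :: "'a::euclidean_space \<Rightarrow> 'a set"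
  assumes G: "standard_map G"
  obtains y where "y 0 = z" "\<And>R. \<exists>L. L-lipschitz_on {0..R} y"
    "AE t in lebesgue. 0 < t \<longrightarrow> (\<exists>v\<in>G (y t). (y has_vector_derivative v) (at t))"
proof -
  define g :: "nat \<Rightarrow> nat \<Rightarrow> real" where "g = (\<lambda>k n. inverse (real (Suc k)))"
  define x where "x = (\<lambda>k. rec_nat z (\<lambda>n w. w + g k (Suc n) *\<^sub>R (SOME v. v \<in> G w)))"
  have x_0: "x k 0 = z" and x_Suc: "x k (Suc n) = x k n + g k (Suc n) *\<^sub>R (SOME v. v \<in> G (x k n))" for k n
    by (simp_all add: x_def)
  have some: "(SOME v. v \<in> G w) \<in> G w" for w
    using G by (auto simp: standard_map_def some_in_eq)
  have g_pos: "g k n > 0" for k n by (simp add: g_def)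
  have time: "step_time (g k) n = real n * inverse (real (Suc k))" for k n
    by (simp add: step_time_def g_def)
  obtain c where c: "c > 0" "\<And>x v. v \<in> G x \<Longrightarrow> norm v \<le> c * (1 + norm x)"
    using standard_map_linear_growth[OF G] by blast
  \<comment> \<open>A discrete Gronwall inequality: each step multiplies \<open>1 + norm x\<close>
    by at most \<open>1 + c * g k (Suc n)\<close>, which the exponential dominates, so the bound
    depends on the elapsed time and not on the mesh.\<close>
  have growth: "1 + norm (x k n) \<le> (1 + norm z) * exp (c * step_time (g k) n)" for k n
  proof (induction n)
    case (Suc n)
    have "1 + norm (x k (Suc n)) \<le> 1 + norm (x k n) + g k (Suc n) * norm (SOME v. v \<in> G (x k n))"
      unfolding x_Suc using norm_triangle_ineq[of "x k n" "g k (Suc n) *\<^sub>R (SOME v. v \<in> G (x k n))"]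
        g_pos[of k "Suc n"] by simp
    also have "\<dots> \<le> 1 + norm (x k n) + g k (Suc n) * (c * (1 + norm (x k n)))"
      using c(2)[OF some] g_pos[of k "Suc n"] by (intro add_left_mono mult_left_mono) auto
    also have "\<dots> = (1 + norm (x k n)) * (1 + c * g k (Suc n))" by (simp add: algebra_simps)
    also have "\<dots> \<le> ((1 + norm z) * exp (c * step_time (g k) n)) * exp (c * g k (Suc n))"
      using Suc g_pos[of k "Suc n"] c(1) by (intro mult_mono) (auto intro: add_nonneg_nonneg)
    finally show ?case by (simp add: step_time_Suc algebra_simps exp_add)
  qed (simp add: x_0)
  have "\<exists>y. y 0 = z \<and> (\<forall>R. \<exists>L. L-lipschitz_on {0..R} y) \<and>
    (AE t in lebesgue. 0 < t \<longrightarrow> (\<exists>v\<in>G (y t). (y has_vector_derivative v) (at t)))"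
  proof (rule euler_limit[OF G, of g "\<lambda>k. inverse (real (Suc k))" x "\<lambda>k n. 0" z 0])
    show "step_sizes (g k)" for k
    proof
      have "filterlim (\<lambda>n. inverse (real (Suc k)) * real n) at_top sequentially"
        by (rule filterlim_tendsto_pos_mult_at_top[OF tendsto_const _ filterlim_real_sequentially]) simp
      then show "filterlim (step_time (g k)) at_top sequentially"
        unfolding time by (simp add: mult.commute)
    qed (rule g_pos)
    show "perturbed_scheme G (g k) (x k) (\<lambda>n. 0)" for k
      unfolding perturbed_scheme_def using some by (auto simp: x_Suc)
    show "\<exists>B. \<forall>k n. step_time (g k) n \<le> R \<longrightarrow> norm (x k n) \<le> B" for R
    proof (intro exI allI impI)
      fix k n assume "step_time (g k) n \<le> R"
      then have "(1 + norm z) * exp (c * step_time (g k) n) \<le> (1 + norm z) * exp (c * R)"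
        using c(1) by (intro mult_left_mono) auto
      then show "norm (x k n) \<le> (1 + norm z) * exp (c * R)" using growth[of k n] by linarith
    qed
    show "(\<lambda>k. x k 0) \<longlonglongrightarrow> z" by (simp add: x_0)
    show "(\<lambda>k. inverse (real (Suc k))) \<longlonglongrightarrow> 0" by (rule LIMSEQ_inverse_real_of_nat)
  qed (blast | simp add: g_def noise_sum_def)+
  then obtain y where y: "y 0 = z" "\<forall>R. \<exists>L. L-lipschitz_on {0..R} y"
    "AE t in lebesgue. 0 < t \<longrightarrow> (\<exists>v\<in>G (y t). (y has_vector_derivative v) (at t))" by blast
  show ?thesis by (rule that[OF y(1) _ y(3)]) (use y(2) in blast)
qed

lemma AE_lebesgue_uminus:
  assumes "AE t in lebesgue. P (t :: real)"
  shows "AE t in lebesgue. P (- t)"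
proof -
  obtain N where N: "{t. \<not> P t} \<subseteq> N" "N \<in> null_sets lebesgue"
    using assms by (auto simp: eventually_ae_filter)
  then have "negligible N" by (simp add: negligible_iff_null_sets)
  then have "negligible (uminus ` N)"
  proof (rule negligible_locally_Lipschitz_image[rotated])
    show "\<exists>T B. open T \<and> t \<in> T \<and> (\<forall>s\<in>N \<inter> T. norm (- s - - t) \<le> B * norm (s - t))" for t
      by (rule exI[of _ UNIV], rule exI[of _ 1]) auto
  qed simp
  moreover have "{t. \<not> P (- t)} \<subseteq> uminus ` N"
  proof
    fix t assume "t \<in> {t. \<not> P (- t)}"
    then have "- t \<in> N" using N(1) by auto
    then show "t \<in> uminus ` N" by (metis image_eqI minus_minus)
  qed
  ultimately show ?thesis by (intro AE_I'[of "uminus ` N"]) (auto simp: negligible_iff_null_sets)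
qed

text \<open>Solutions live on the whole line, so a curve on the half line is continued to negative times by
  a time-reversed solution of the inclusion for \<open>- F\<close>.\<close>

lemma forward_solution_extends:
  fixes F :: "'a::euclidean_space \<Rightarrow> 'a set"
  assumes F: "standard_map F"
    and lip: "\<And>R. \<exists>L. L-lipschitz_on {0..R} y"
    and y: "AE t in lebesgue. 0 < t \<longrightarrow> (\<exists>v\<in>F (y t). (y has_vector_derivative v) (at t))"
  obtains w where "w \<in> solutions_from F (y 0)" "\<And>t. t \<ge> 0 \<Longrightarrow> w t = y t"
proof -
  obtain b where b: "b 0 = y 0" "\<And>R. \<exists>L. L-lipschitz_on {0..R} b"
    "AE t in lebesgue. 0 < t \<longrightarrow> (\<exists>v\<in>uminus ` F (b t). (b has_vector_derivative v) (at t))"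
    using forward_solution_exists[OF standard_map_uminus[OF F], of "y 0"] by blast
  define w where "w = (\<lambda>t. if t \<le> 0 then b (- t) else y t)"
  have "\<exists>L. L-lipschitz_on {-R..R} w" for R
  proof -
    obtain L1 where L1: "L1-lipschitz_on {0..R} b" using b(2) by blast
    obtain L2 where L2: "L2-lipschitz_on {0..R} y" using lip by blast
    have "L1-lipschitz_on {-R..0} (\<lambda>t. b (- t))"
    proof (rule lipschitz_onI)
      fix s t assume "s \<in> {-R..0}" "t \<in> {-R..0}"
      then show "dist (b (- s)) (b (- t)) \<le> L1 * dist s t"
        using lipschitz_onD[OF L1, of "- s" "- t"] by (simp add: dist_real_def abs_minus_commute)
    qed (rule lipschitz_on_nonneg[OF L1])
    then have "(max L1 L2)-lipschitz_on {-R..R} w"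
      unfolding w_def using L2 b(1) by (intro lipschitz_on_concat_max) auto
    then show ?thesis by blast
  qed
  then have "abs_continuous_on {p..q} w" for p q
  proof -
    obtain L where "L-lipschitz_on {- max \<bar>p\<bar> \<bar>q\<bar>..max \<bar>p\<bar> \<bar>q\<bar>} w"
      using \<open>\<And>R. \<exists>L. L-lipschitz_on {-R..R} w\<close> by blast
    then have "L-lipschitz_on {p..q} w" by (rule lipschitz_on_subset) auto
    then show ?thesis by (rule lipschitz_on_imp_abs_continuous_on)
  qed
  moreover have "AE t in lebesgue. \<exists>v\<in>F (w t). (w has_vector_derivative v) (at t)"
  proof -
    \<comment> \<open>At time 0 the two pieces are only joined continuously and may form a
      corner.\<close>
    have "AE t in lebesgue. (t :: real) \<noteq> 0"
      by (rule AE_I'[of "{0}"]) (auto simp: negligible_iff_null_sets[symmetric])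
    then show ?thesis using y AE_lebesgue_uminus[OF b(3)]
    proof eventually_elim
      case (elim t)
      show ?case
      proof (cases "0 < t")
        case True
        then obtain v where v: "v \<in> F (y t)" "(y has_vector_derivative v) (at t)" using elim by blast
        have "(w has_vector_derivative v) (at t)"
          by (rule has_vector_derivative_transform_within_open[OF v(2) open_greaterThan, of 0])
             (use True in \<open>auto simp: w_def\<close>)
        then show ?thesis using v(1) True by (auto simp: w_def)
      next
        case False
        then have t: "t < 0" using elim by simp
        then obtain v where v: "v \<in> F (b (- t))" "(b has_vector_derivative - v) (at (- t))"
          using elim by auto
        \<comment> \<open>The sign from reversing time cancels the sign in
          \<open>- F\<close>.\<close>
        have "(b \<circ> uminus has_vector_derivative (- 1) *\<^sub>R (- v)) (at t)"
          by (rule vector_diff_chain_at) (use v(2) in \<open>auto intro!: derivative_eq_intros\<close>)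
        then have "((\<lambda>t. b (- t)) has_vector_derivative v) (at t)" by (simp add: o_def)
        then have "(w has_vector_derivative v) (at t)"
          by (rule has_vector_derivative_transform_within_open[OF _ open_lessThan, of _ _ _ 0])
             (use t in \<open>auto simp: w_def\<close>)
        then show ?thesis using v(1) t by (auto simp: w_def)
      qed
    qed
  qed
  moreover have "w t = y t" if "t \<ge> 0" for t using that b(1) by (auto simp: w_def)
  ultimately show ?thesis using that[of w] by (auto simp: solutions_from_def solution_def)
qed

section \<open>Perturbed schemes follow the flow\<close>

text \<open>If no \<open>\<delta>\<close> worked, there would be schemes with step sizes, initial
  errors and noises bounded by \<open>1 / (k + 1)\<close> that miss \<open>W\<close> at some grid
  time in the window. A limit of them is a solution from a point of \<open>C\<close> that lies
  outside \<open>W\<close> at a time between \<open>a\<close> and \<open>b\<close>. The noise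
  horizon \<open>1 / \<delta>\<close> grows along this sequence and finally covers every fixed
  horizon.\<close>

lemma flow_tracking:
  fixes F :: "'a::euclidean_space \<Rightarrow> 'a set" and K :: real
  assumes F: "standard_map F" and M: "bounded M" and C: "compact C" and W: "open W" and a: "0 \<le> a"
    and flow: "\<And>z t. z \<in> C \<Longrightarrow> a \<le> t \<Longrightarrow> t \<le> b \<Longrightarrow> flow F t z \<subseteq> W"
  obtains \<delta> where "\<delta> > 0" "\<And>\<gamma> x u n. step_sizes \<gamma> \<Longrightarrow> (\<And>n. n \<ge> 1 \<Longrightarrow> \<gamma> n \<le> \<delta>) \<Longrightarrow>
    perturbed_scheme F \<gamma> x u \<Longrightarrow> (\<And>n. x n \<in> M) \<Longrightarrow> (\<And>n. n \<ge> 1 \<Longrightarrow> norm (u n) \<le> K) \<Longrightarrow>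
    (\<exists>z\<in>C. dist (x 0) z \<le> \<delta>) \<Longrightarrow>
    (\<And>n. step_time \<gamma> n \<le> 1 / \<delta> \<Longrightarrow> norm (noise_sum \<gamma> u n) \<le> \<delta>) \<Longrightarrow>
    a \<le> step_time \<gamma> n \<Longrightarrow> step_time \<gamma> n \<le> b \<Longrightarrow> x n \<in> W"
proof (rule ccontr)
  note thesisI = that
  define bad where "bad = (\<lambda>\<delta> \<gamma> x u n. step_sizes \<gamma> \<and> (\<forall>n\<ge>1. \<gamma> n \<le> \<delta>) \<and>
    perturbed_scheme F \<gamma> x u \<and> (\<forall>n. x n \<in> M) \<and> (\<forall>n\<ge>1. norm (u n) \<le> K) \<and>
    (\<exists>z\<in>C. dist (x 0) z \<le> \<delta>) \<and>
    (\<forall>n. step_time \<gamma> n \<le> 1 / \<delta> \<longrightarrow> norm (noise_sum \<gamma> u n) \<le> \<delta>) \<and>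
    a \<le> step_time \<gamma> n \<and> step_time \<gamma> n \<le> b \<and> x n \<notin> W)"
  assume "\<not> thesis"
  then have "\<exists>\<gamma> x u n. bad \<delta> \<gamma> x u n" if "\<delta> > 0" for \<delta>
    using that thesisI[of \<delta>] unfolding bad_def by blast
  then have "\<forall>k. \<exists>\<gamma> x u n. bad (inverse (real (Suc k))) \<gamma> x u n" by simp
  then obtain g x u n where bad: "\<And>k. bad (inverse (real (Suc k))) (g k) (x k) (u k) (n k)" by metis
  then obtain z where z: "\<And>k. z k \<in> C" "\<And>k. dist (x k 0) (z k) \<le> inverse (real (Suc k))"
    unfolding bad_def by metis
  \<comment> \<open>Initial points and exit times are made to converge simultaneously, as the grid
    times at which the schemes are outside \<open>W\<close> vary with \<open>k\<close>.\<close>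
  have "compact (C \<times> {a..b})" using C by (intro compact_Times) auto
  then have sc: "seq_compact (C \<times> {a..b})" by (rule compact_imp_seq_compact)
  have mem: "\<forall>k. (z k, step_time (g k) (n k)) \<in> C \<times> {a..b}" using z bad by (auto simp: bad_def)
  obtain l s where l: "l \<in> C \<times> {a..b}" and s: "strict_mono s"
    "((\<lambda>k. (z k, step_time (g k) (n k))) \<circ> s) \<longlonglongrightarrow> l"
    by (rule seq_compactE[OF sc mem])
  obtain z0 T where zT: "l = (z0, T)" "z0 \<in> C" "a \<le> T" "T \<le> b" using l by (cases l) auto
  have z0: "(\<lambda>k. z (s k)) \<longlonglongrightarrow> z0" and T: "(\<lambda>k. step_time (g (s k)) (n (s k))) \<longlonglongrightarrow> T"
    using tendsto_fst[OF s(2)] tendsto_snd[OF s(2)] by (auto simp: zT o_def)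
  define \<mu> where "\<mu> = (\<lambda>k. inverse (real (Suc (s k))))"
  have \<mu>: "\<mu> \<longlonglongrightarrow> 0"
    using LIMSEQ_subseq_LIMSEQ[OF LIMSEQ_inverse_real_of_nat s(1)] by (simp add: \<mu>_def o_def)
  obtain r y where ry: "strict_mono r" "y 0 = z0"
    "\<And>t. t \<ge> 0 \<Longrightarrow> (\<lambda>j. x (s (r j)) (step_index (g (s (r j))) t)) \<longlonglongrightarrow> y t"
    "\<And>R. \<exists>L\<ge>0. (\<forall>k m n. m \<le> n \<longrightarrow> step_time (g (s k)) n \<le> R \<longrightarrow>
        norm (x (s k) n - x (s k) m) \<le> L * (step_time (g (s k)) n - step_time (g (s k)) m)) \<and> L-lipschitz_on {0..R} y"
    "AE t in lebesgue. 0 < t \<longrightarrow> (\<exists>v\<in>F (y t). (y has_vector_derivative v) (at t))"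
  proof (rule euler_limit[OF F, of "\<lambda>k. g (s k)" \<mu> "\<lambda>k. x (s k)" "\<lambda>k. u (s k)" z0 K])
    show "(\<lambda>k. x (s k) 0) \<longlonglongrightarrow> z0"
    proof (rule Lim_transform[OF z0], rule tendsto_norm_zero_cancel)
      show "(\<lambda>k. norm (x (s k) 0 - z (s k))) \<longlonglongrightarrow> 0"
        by (rule tendsto_sandwich[OF _ _ tendsto_const \<mu>]) (use z(2) in \<open>auto simp: dist_norm \<mu>_def\<close>)
    qed
    obtain B where "\<And>w. w \<in> M \<Longrightarrow> norm w \<le> B" using M by (auto simp: bounded_iff)
    then show "\<exists>B. \<forall>k n. step_time (g (s k)) n \<le> R \<longrightarrow> norm (x (s k) n) \<le> B" for R
      using bad unfolding bad_def by blast
    fix R e :: real assume e: "e > 0"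
    have "filterlim (\<lambda>k. real (Suc (s k))) at_top sequentially"
      using s(1) by (intro filterlim_compose[OF filterlim_real_sequentially] filterlim_compose[OF filterlim_Suc filterlim_subseq])
    then have "\<forall>\<^sub>F k in sequentially. R \<le> real (Suc (s k))" by (simp add: filterlim_at_top)
    moreover have "\<forall>\<^sub>F k in sequentially. \<mu> k < e" using order_tendstoD(2)[OF \<mu> e] .
    ultimately show "\<forall>\<^sub>F k in sequentially. \<forall>n. step_time (g (s k)) n \<le> R \<longrightarrow>
                  norm (noise_sum (g (s k)) (u (s k)) n) \<le> e"
    proof eventually_elim
      case (elim k)
      have "norm (noise_sum (g (s k)) (u (s k)) n) \<le> \<mu> k" if "step_time (g (s k)) n \<le> R" for n
        using bad[of "s k"] that elim(1) unfolding bad_def \<mu>_def by (auto simp: inverse_eq_divide)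
      then show ?case using elim(2) by force
    qed
  qed (use bad \<mu> in \<open>auto simp: bad_def \<mu>_def\<close>)
  define G where "G = (\<lambda>j. g (s (r j)))"
  define xx where "xx = (\<lambda>j. x (s (r j)))"
  define nn where "nn = (\<lambda>j. n (s (r j)))"
  obtain L where L: "L \<ge> 0" "\<And>k m n. m \<le> n \<Longrightarrow> step_time (G k) n \<le> b \<Longrightarrow>
      norm (xx k n - xx k m) \<le> L * (step_time (G k) n - step_time (G k) m)"
    using ry(4)[of b] unfolding G_def xx_def by blast
  have steps: "step_sizes (G j)" for j using bad by (auto simp: bad_def G_def)
  have T0: "0 \<le> T" using a zT by simp
  \<comment> \<open>The schemes are known to converge at the fixed time \<open>T\<close>, but leave
    \<open>W\<close> at times that merely tend to \<open>T\<close>; the uniform Lipschitz bound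
    closes the gap.\<close>
  have close: "norm (xx j (nn j) - xx j (step_index (G j) T)) \<le> L * (\<bar>step_time (G j) (nn j) - T\<bar> + \<mu> (r j))" for j
  proof -
    let ?m = "step_index (G j) T"
    have "G j (Suc ?m) \<le> \<mu> (r j)" using bad[of "s (r j)"] by (simp add: bad_def G_def \<mu>_def)
    then have m: "step_time (G j) ?m \<le> T" "T \<le> step_time (G j) ?m + \<mu> (r j)"
      using step_sizes.step_index_bounds[OF steps T0, of j] by (simp_all add: step_time_Suc)
    have nb: "step_time (G j) (nn j) \<le> b" using bad[of "s (r j)"] by (auto simp: bad_def G_def nn_def)
    have "norm (xx j (nn j) - xx j ?m) \<le> L * \<bar>step_time (G j) (nn j) - step_time (G j) ?m\<bar>"
    proof (cases "nn j \<le> ?m")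
      case True
      then show ?thesis using L(2)[OF True, of j] m(1) zT step_sizes.step_time_le[OF steps True]
        by (simp add: norm_minus_commute)
    next
      case False
      then show ?thesis using L(2)[of ?m "nn j" j] nb step_sizes.step_time_le[OF steps, of ?m "nn j" j] by simp
    qed
    also have "\<dots> \<le> L * (\<bar>step_time (G j) (nn j) - T\<bar> + \<mu> (r j))"
      using m L(1) by (intro mult_left_mono) auto
    finally show ?thesis .
  qed
  have lim: "(\<lambda>j. L * (\<bar>step_time (G j) (nn j) - T\<bar> + \<mu> (r j))) \<longlonglongrightarrow> L * (\<bar>T - T\<bar> + 0)"
  proof (intro tendsto_intros)
    show "(\<lambda>j. step_time (G j) (nn j)) \<longlonglongrightarrow> T"
      using LIMSEQ_subseq_LIMSEQ[OF T ry(1)] by (simp add: o_def G_def nn_def)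
    show "(\<lambda>j. \<mu> (r j)) \<longlonglongrightarrow> 0" using LIMSEQ_subseq_LIMSEQ[OF \<mu> ry(1)] by (simp add: o_def)
  qed
  have "(\<lambda>j. xx j (nn j) - xx j (step_index (G j) T)) \<longlonglongrightarrow> 0"
    by (rule Lim_null_comparison[OF always_eventually[OF allI[OF close]]]) (use lim in simp)
  moreover have "(\<lambda>j. xx j (step_index (G j) T)) \<longlonglongrightarrow> y T"
    using ry(3)[OF T0] by (simp add: G_def xx_def)
  ultimately have "(\<lambda>j. xx j (nn j)) \<longlonglongrightarrow> y T" by (rule Lim_transform[rotated])
  moreover have "xx j (nn j) \<in> - W" for j using bad by (auto simp: bad_def xx_def nn_def)
  moreover have "closed (- W)" using W by auto
  ultimately have "y T \<in> - W" using closed_sequentially[of "- W" "\<lambda>j. xx j (nn j)" "y T"] by simp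
  have lip: "\<exists>L. L-lipschitz_on {0..R} y" for R using ry(4) by blast
  obtain w where "w \<in> solutions_from F (y 0)" "\<And>t. t \<ge> 0 \<Longrightarrow> w t = y t"
    using forward_solution_extends[OF F lip ry(5)] by blast
  then have "w T = y T" "w \<in> solutions_from F z0" using T0 ry(2) by auto
  then have "w T \<in> flow F T z0" unfolding flow_def by blast
  then have "y T \<in> flow F T z0" using \<open>w T = y T\<close> by simp
  then show False using \<open>y T \<in> - W\<close> flow[OF zT(2-4)] by blast
qed

section \<open>Convergence of perturbed schemes to an attractor\<close>

text \<open>The same \<open>\<delta>\<close> bounds the fluctuation and, by its reciprocal, sets the
  length of the window. All starting indices from \<open>N\<close> on are included, so the property
  passes to restarts of the scheme at later indices.\<close>

definition small_noise :: "(nat \<Rightarrow> real) \<Rightarrow> (nat \<Rightarrow> 'a::real_normed_vector) \<Rightarrow> nat \<Rightarrow> real \<Rightarrow> bool" where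
  "small_noise \<gamma> u N \<delta> \<longleftrightarrow> (\<forall>n\<ge>N. \<forall>m\<ge>n. step_time \<gamma> m - step_time \<gamma> n \<le> 1 / \<delta> \<longrightarrow>
     norm (noise_sum \<gamma> u m - noise_sum \<gamma> u n) \<le> \<delta>)"

lemma small_noise_mono:
  assumes "small_noise \<gamma> u N \<delta>" "N \<le> N'" "0 < \<delta>" "\<delta> \<le> \<delta>'"
  shows "small_noise \<gamma> u N' \<delta>'"
  unfolding small_noise_def
proof (intro allI impI)
  fix n m assume *: "N' \<le> n" "n \<le> m" "step_time \<gamma> m - step_time \<gamma> n \<le> 1 / \<delta>'"
  have "1 / \<delta>' \<le> 1 / \<delta>" using assms by (simp add: frac_le)
  then have "norm (noise_sum \<gamma> u m - noise_sum \<gamma> u n) \<le> \<delta>"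
    using assms * unfolding small_noise_def by auto
  then show "norm (noise_sum \<gamma> u m - noise_sum \<gamma> u n) \<le> \<delta>'" using assms by simp
qed

lemma step_time_shift: "step_time (\<lambda>n. \<gamma> (N + n)) n = step_time \<gamma> (N + n) - step_time \<gamma> N"
  by (induction n) (simp_all add: step_time_Suc)

lemma noise_sum_shift:
  "noise_sum (\<lambda>n. \<gamma> (N + n)) (\<lambda>n. u (N + n)) n = noise_sum \<gamma> u (N + n) - noise_sum \<gamma> u N"
  by (induction n) (simp_all add: noise_sum_Suc)

lemma (in step_sizes) step_sizes_shift: "step_sizes (\<lambda>n. \<gamma> (N + n))"
proof
  have "filterlim (\<lambda>n. step_time \<gamma> (n + N)) at_top sequentially"
    using unbounded by (rule filterlim_compose) (rule filterlim_add_const_nat_at_top)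
  then have "filterlim (\<lambda>n. - step_time \<gamma> N + step_time \<gamma> (n + N)) at_top sequentially"
    by (rule filterlim_tendsto_add_at_top[OF tendsto_const])
  moreover have "step_time (\<lambda>n. \<gamma> (N + n)) = (\<lambda>n. - step_time \<gamma> N + step_time \<gamma> (n + N))"
    by (rule ext, subst step_time_shift) (simp add: add.commute)
  ultimately show "filterlim (step_time (\<lambda>n. \<gamma> (N + n))) at_top sequentially" by simp
qed (use pos in auto)

lemma flow_tracking_from:
  fixes F :: "'a::euclidean_space \<Rightarrow> 'a set" and K :: real
  assumes "standard_map F" "bounded M" "compact C" "open W" "0 \<le> a"
    and "\<And>z t. z \<in> C \<Longrightarrow> a \<le> t \<Longrightarrow> t \<le> b \<Longrightarrow> flow F t z \<subseteq> W"
  obtains \<delta> where "\<delta> > 0" "\<And>\<gamma> x u N n. step_sizes \<gamma> \<Longrightarrow> (\<And>i. i > N \<Longrightarrow> \<gamma> i \<le> \<delta>) \<Longrightarrow>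
    perturbed_scheme F \<gamma> x u \<Longrightarrow> (\<And>n. x n \<in> M) \<Longrightarrow> (\<And>n. n \<ge> 1 \<Longrightarrow> norm (u n) \<le> K) \<Longrightarrow>
    (\<exists>z\<in>C. dist (x N) z \<le> \<delta>) \<Longrightarrow> small_noise \<gamma> u N \<delta> \<Longrightarrow> N \<le> n \<Longrightarrow>
    a \<le> step_time \<gamma> n - step_time \<gamma> N \<Longrightarrow> step_time \<gamma> n - step_time \<gamma> N \<le> b \<Longrightarrow> x n \<in> W"
proof -
  obtain \<delta> where \<delta>: "\<delta> > 0" "\<And>\<gamma> x u n. step_sizes \<gamma> \<Longrightarrow> (\<And>n. n \<ge> 1 \<Longrightarrow> \<gamma> n \<le> \<delta>) \<Longrightarrow>
    perturbed_scheme F \<gamma> x u \<Longrightarrow> (\<And>n. x n \<in> M) \<Longrightarrow> (\<And>n. n \<ge> 1 \<Longrightarrow> norm (u n) \<le> K) \<Longrightarrow>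
    (\<exists>z\<in>C. dist (x 0) z \<le> \<delta>) \<Longrightarrow>
    (\<And>n. step_time \<gamma> n \<le> 1 / \<delta> \<Longrightarrow> norm (noise_sum \<gamma> u n) \<le> \<delta>) \<Longrightarrow>
    a \<le> step_time \<gamma> n \<Longrightarrow> step_time \<gamma> n \<le> b \<Longrightarrow> x n \<in> W"
    using flow_tracking[OF assms, where K = K] by blast
  show ?thesis
  proof (rule that[OF \<delta>(1)])
    fix \<gamma> :: "nat \<Rightarrow> real" and x u :: "nat \<Rightarrow> 'a" and N n
    assume g: "step_sizes \<gamma>" "\<And>i. i > N \<Longrightarrow> \<gamma> i \<le> \<delta>" and x: "perturbed_scheme F \<gamma> x u" "\<And>n. x n \<in> M"
      and u: "\<And>n. n \<ge> 1 \<Longrightarrow> norm (u n) \<le> K" and start: "\<exists>z\<in>C. dist (x N) z \<le> \<delta>"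
      and noise: "small_noise \<gamma> u N \<delta>" and n: "N \<le> n"
        "a \<le> step_time \<gamma> n - step_time \<gamma> N" "step_time \<gamma> n - step_time \<gamma> N \<le> b"
    have "x (N + (n - N)) \<in> W"
    proof (rule \<delta>(2)[of "\<lambda>n. \<gamma> (N + n)" "\<lambda>n. x (N + n)" "\<lambda>n. u (N + n)" "n - N"])
      show "perturbed_scheme F (\<lambda>n. \<gamma> (N + n)) (\<lambda>n. x (N + n)) (\<lambda>n. u (N + n))"
        using x(1) unfolding perturbed_scheme_def by (metis add_Suc_right)
      show "norm (noise_sum (\<lambda>n. \<gamma> (N + n)) (\<lambda>n. u (N + n)) k) \<le> \<delta>"
        if "step_time (\<lambda>n. \<gamma> (N + n)) k \<le> 1 / \<delta>" for k
        using noise that unfolding small_noise_def noise_sum_shift step_time_shift by simp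
    qed (use g step_sizes.step_sizes_shift x u start n in \<open>auto simp: step_time_shift\<close>)
    then show "x n \<in> W" using n(1) by simp
  qed
qed

text \<open>The closed tails of the reachable set, with \<open>W\<close> removed, form a decreasing
  sequence of compact sets. Were none of them empty, a common point would be an omega-limit point
  outside \<open>W\<close>, hence outside \<open>A\<close>.\<close>

lemma basin_enters:
  fixes F :: "'a::euclidean_space \<Rightarrow> 'a set"
  assumes p: "p \<in> basin F A" and W: "open W" "A \<subseteq> W"
  obtains T where "T \<ge> 0" "\<And>t. t \<ge> T \<Longrightarrow> flow F t p \<subseteq> W"
proof -
  define D where "D = (\<lambda>n::nat. closure (\<Union>s\<in>{real n..}. flow F s p) - W)"
  have bd: "bounded (\<Union>t\<in>{0..}. flow F t p)" and om: "omega_limit F p \<subseteq> A"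
    using p by (auto simp: basin_def)
  have "\<exists>n. D n = {}"
  proof (rule ccontr)
    assume "\<nexists>n. D n = {}"
    then have ne: "\<And>n. D n \<noteq> {}" by auto
    have cpt: "compact (D n)" for n
    proof -
      have "bounded (\<Union>s\<in>{real n..}. flow F s p)" by (rule bounded_subset[OF bd], rule UN_mono) auto
      then have "compact (closure (\<Union>s\<in>{real n..}. flow F s p))" by (simp add: compact_closure)
      then show ?thesis unfolding D_def using W(1) by (rule compact_diff)
    qed
    have mono: "D n \<subseteq> D m" if "m \<le> n" for m n
      unfolding D_def using that by (intro Diff_mono closure_mono UN_mono) auto
    have "\<Inter>(range D) \<noteq> {}" by (rule compact_nest) (fact cpt ne mono)+
    then obtain z where z: "\<And>n. z \<in> D n" by blast
    have "z \<in> omega_limit F p"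
      unfolding omega_limit_def
    proof
      fix t :: real assume "t \<in> {0..}"
      obtain n where n: "t \<le> real n" using real_arch_simple by blast
      have "closure (\<Union>s\<in>{real n..}. flow F s p) \<subseteq> closure (\<Union>s\<in>{t..}. flow F s p)"
        using n by (intro closure_mono UN_mono) auto
      then show "z \<in> closure (\<Union>s\<in>{t..}. flow F s p)" using z[of n] by (auto simp: D_def)
    qed
    then show False using om W(2) z[of 0] by (auto simp: D_def)
  qed
  then obtain n where n: "D n = {}" by blast
  show ?thesis
  proof (rule that[of "real n"])
    fix t assume "t \<ge> real n"
    then have "flow F t p \<subseteq> closure (\<Union>s\<in>{real n..}. flow F s p)"
      by (intro order_trans[OF _ closure_subset]) auto
    then show "flow F t p \<subseteq> W" using n by (auto simp: D_def)
  qed simp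
qed

text \<open>Looking back from index \<open>n\<close> by time \<open>T\<close> need not hit a grid
  time; rounding down costs at most one step, that is, at most one unit of time.\<close>

lemma (in step_sizes) step_time_window:
  assumes "\<And>i. i > N \<Longrightarrow> \<gamma> i \<le> 1" "0 \<le> T" "step_time \<gamma> N + T \<le> step_time \<gamma> n"
  obtains k where "N \<le> k" "k \<le> n" "T \<le> step_time \<gamma> n - step_time \<gamma> k"
    "step_time \<gamma> n - step_time \<gamma> k \<le> T + 1"
proof -
  define k where "k = step_index \<gamma> (step_time \<gamma> n - T)"
  have t: "0 \<le> step_time \<gamma> n - T" using assms(3) step_time_nonneg[of N] by linarith
  have b: "step_time \<gamma> k \<le> step_time \<gamma> n - T" "step_time \<gamma> n - T < step_time \<gamma> (Suc k)"
    using step_index_bounds[OF t] by (simp_all add: k_def)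
  have "N \<le> k" unfolding k_def using assms(3) by (intro step_index_greatest) simp
  moreover have "k \<le> n"
    using step_index_mono[OF t, of "step_time \<gamma> n"] assms(2) by (simp add: k_def step_index_step_time)
  moreover have "\<gamma> (Suc k) \<le> 1" using \<open>N \<le> k\<close> by (intro assms(1)) simp
  ultimately show ?thesis using that b by (simp add: step_time_Suc)
qed

text \<open>\<open>\<delta>\<close> is fixed before \<open>e\<close> and before the scheme. It only
  has to bring the scheme into a neighborhood of \<open>A\<close> and keep it there; the finer
  tolerance that \<open>e\<close> demands is needed only from a late index on, where steps and noise
  are small anyway.\<close>

lemma attractor_capture:
  fixes F :: "'a::euclidean_space \<Rightarrow> 'a set" and K :: real
  assumes F: "standard_map F" and M: "bounded M" and A: "attractor F A" and p: "p \<in> basin F A"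
  obtains \<delta> where "\<delta> > 0" "\<And>\<gamma> x u N e. step_sizes \<gamma> \<Longrightarrow> \<gamma> \<longlonglongrightarrow> 0 \<Longrightarrow> (\<And>i. i > N \<Longrightarrow> \<gamma> i \<le> \<delta>) \<Longrightarrow>
    perturbed_scheme F \<gamma> x u \<Longrightarrow> (\<And>n. x n \<in> M) \<Longrightarrow> (\<And>n. n \<ge> 1 \<Longrightarrow> norm (u n) \<le> K) \<Longrightarrow>
    dist (x N) p \<le> \<delta> \<Longrightarrow> small_noise \<gamma> u N \<delta> \<Longrightarrow> (\<And>e. e > 0 \<Longrightarrow> \<exists>N'. small_noise \<gamma> u N' e) \<Longrightarrow>
    e > 0 \<Longrightarrow> \<forall>\<^sub>F n in sequentially. x n \<in> (\<Union>a\<in>A. ball a e)"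
proof -
  obtain U where A': "A \<noteq> {}" "compact A" and U: "A \<subseteq> interior U"
    "\<And>e. e > 0 \<Longrightarrow> \<exists>T>0. \<forall>t\<ge>T. (\<Union>x\<in>U. flow F t x) \<subseteq> (\<Union>a\<in>A. ball a e)"
    using A unfolding attractor_def by blast
  obtain \<epsilon> where \<epsilon>: "\<epsilon> > 0" "{x. infdist x A \<le> \<epsilon>} \<subseteq> interior U"
    using compact_in_open_separated[OF A' open_interior U(1)] by blast
  \<comment> \<open>\<open>C\<close> is compact, as tracking requires of its starting set, and lies
    in \<open>U\<close>, where attraction is uniform. Since the target \<open>W\<close> is inside
    \<open>C\<close>, each arrival is a legitimate new start.\<close>
  define C where "C = {x. infdist x A \<le> \<epsilon>}"
  define W where "W = (\<Union>a\<in>A. ball a \<epsilon>)"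
  have C: "compact C" "C \<subseteq> U" "\<And>z t. z \<in> C \<Longrightarrow> z \<in> U"
    using compact_infdist_le[OF A' \<epsilon>(1)] \<epsilon>(2) interior_subset[of U] by (auto simp: C_def)
  have WC: "W \<subseteq> C"
  proof
    fix w assume "w \<in> W"
    then obtain a where "a \<in> A" "dist a w < \<epsilon>" by (auto simp: W_def)
    then show "w \<in> C" using infdist_le[of a A w] by (simp add: C_def dist_commute)
  qed
  have W: "open W" "A \<subseteq> W" using \<epsilon>(1) by (auto simp: W_def)
  obtain T0 where T0: "T0 > 0" "\<And>t. t \<ge> T0 \<Longrightarrow> (\<Union>x\<in>U. flow F t x) \<subseteq> W"
    using U(2)[OF \<epsilon>(1)] unfolding W_def by blast
  obtain Tp where Tp: "Tp \<ge> 0" "\<And>t. t \<ge> Tp \<Longrightarrow> flow F t p \<subseteq> W"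
    using basin_enters[OF p W] by blast
  have flow_p: "flow F t z \<subseteq> W" if "z \<in> {p}" "Tp \<le> t" "t \<le> Tp + 1" for z t
    using that Tp(2) by blast
  \<comment> \<open>Windows up to \<open>2 * T0 + 1\<close> make the induction below close: indices
    later than that after \<open>N1\<close> restart at some \<open>k\<close> at most
    \<open>T0 + 1\<close> earlier, which is still more than \<open>T0\<close> after
    \<open>N1\<close> and thus covered by the induction hypothesis.\<close>
  have flow_C: "flow F t z \<subseteq> W" if "z \<in> C" "T0 \<le> t" "t \<le> 2 * T0 + 1" for z t
    using that T0(2)[OF that(2)] C(2) by blast
  obtain \<delta>1 where \<delta>1: "\<delta>1 > 0" "\<And>\<gamma> x u N n. step_sizes \<gamma> \<Longrightarrow> (\<And>i. i > N \<Longrightarrow> \<gamma> i \<le> \<delta>1) \<Longrightarrow>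
    perturbed_scheme F \<gamma> x u \<Longrightarrow> (\<And>n. x n \<in> M) \<Longrightarrow> (\<And>n. n \<ge> 1 \<Longrightarrow> norm (u n) \<le> K) \<Longrightarrow>
    (\<exists>z\<in>{p}. dist (x N) z \<le> \<delta>1) \<Longrightarrow> small_noise \<gamma> u N \<delta>1 \<Longrightarrow> N \<le> n \<Longrightarrow>
    Tp \<le> step_time \<gamma> n - step_time \<gamma> N \<Longrightarrow> step_time \<gamma> n - step_time \<gamma> N \<le> Tp + 1 \<Longrightarrow> x n \<in> W"
    using flow_tracking_from[OF F M compact_sing W(1) Tp(1) flow_p, where K = K] by blast
  obtain \<delta>2 where \<delta>2: "\<delta>2 > 0" "\<And>\<gamma> x u N n. step_sizes \<gamma> \<Longrightarrow> (\<And>i. i > N \<Longrightarrow> \<gamma> i \<le> \<delta>2) \<Longrightarrow>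
    perturbed_scheme F \<gamma> x u \<Longrightarrow> (\<And>n. x n \<in> M) \<Longrightarrow> (\<And>n. n \<ge> 1 \<Longrightarrow> norm (u n) \<le> K) \<Longrightarrow>
    (\<exists>z\<in>C. dist (x N) z \<le> \<delta>2) \<Longrightarrow> small_noise \<gamma> u N \<delta>2 \<Longrightarrow> N \<le> n \<Longrightarrow>
    T0 \<le> step_time \<gamma> n - step_time \<gamma> N \<Longrightarrow> step_time \<gamma> n - step_time \<gamma> N \<le> 2 * T0 + 1 \<Longrightarrow> x n \<in> W"
    using flow_tracking_from[OF F M C(1) W(1) less_imp_le[OF T0(1)] flow_C, where K = K] by blast
  define \<delta> where "\<delta> = min 1 (min \<delta>1 \<delta>2)"
  have \<delta>: "\<delta> > 0" "\<delta> \<le> 1" "\<delta> \<le> \<delta>1" "\<delta> \<le> \<delta>2" using \<delta>1(1) \<delta>2(1) by (auto simp: \<delta>_def)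
  show ?thesis
  proof (rule that[OF \<delta>(1)])
    fix \<gamma> :: "nat \<Rightarrow> real" and x u :: "nat \<Rightarrow> 'a" and N and e :: real
    assume g: "step_sizes \<gamma>" "\<gamma> \<longlonglongrightarrow> 0" "\<And>i. i > N \<Longrightarrow> \<gamma> i \<le> \<delta>"
      and x: "perturbed_scheme F \<gamma> x u" "\<And>n. x n \<in> M"
      and u: "\<And>n. n \<ge> 1 \<Longrightarrow> norm (u n) \<le> K" and start: "dist (x N) p \<le> \<delta>"
      and noise: "small_noise \<gamma> u N \<delta>" "\<And>e. e > 0 \<Longrightarrow> \<exists>N'. small_noise \<gamma> u N' e" and e: "e > 0"
    interpret step_sizes \<gamma> by (rule g)
    have g1: "\<gamma> i \<le> 1" "\<gamma> i \<le> \<delta>1" "\<gamma> i \<le> \<delta>2" if "i > N" for i using g(3)[OF that] \<delta> by linarith+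
    \<comment> \<open>The first index whose time is beyond \<open>Tp\<close> after \<open>N\<close>;
      with steps of at most 1 it falls into the window of \<open>flow_p\<close>.\<close>
    define N1 where "N1 = Suc (step_index \<gamma> (step_time \<gamma> N + Tp))"
    have "0 \<le> step_time \<gamma> N + Tp" using step_time_nonneg[of N] Tp(1) by simp
    note N1b = step_index_bounds[OF this, folded N1_def]
    have "N \<le> step_index \<gamma> (step_time \<gamma> N + Tp)" using Tp(1) by (intro step_index_greatest) simp
    then have N1: "N < N1" by (simp add: N1_def)
    have N1_time: "Tp \<le> step_time \<gamma> N1 - step_time \<gamma> N" "step_time \<gamma> N1 - step_time \<gamma> N \<le> Tp + 1"
      using N1b g1(1)[OF N1] by (simp_all add: N1_def step_time_Suc)
    have "x N1 \<in> W"
      by (rule \<delta>1(2)[OF g(1) g1(2) x u _ small_noise_mono[OF noise(1) order_refl \<delta>(1,3)] _ N1_time])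
         (use start \<delta> N1 in auto)
    have in_W: "x n \<in> W" if "step_time \<gamma> N1 + T0 \<le> step_time \<gamma> n" for n
      using that
    proof (induction n rule: less_induct)
      case (less n)
      have "N1 \<le> n"
      proof (rule ccontr)
        assume "\<not> N1 \<le> n"
        then show False using step_time_le[of n N1] less.prems T0(1) by simp
      qed
      obtain k where k: "N1 \<le> k" "k \<le> n" "T0 \<le> step_time \<gamma> n - step_time \<gamma> k"
        "step_time \<gamma> n - step_time \<gamma> k \<le> 2 * T0 + 1" "x k \<in> C"
      proof (cases "step_time \<gamma> n - step_time \<gamma> N1 \<le> 2 * T0 + 1")
        case True
        then show ?thesis using that[of N1] less.prems \<open>N1 \<le> n\<close> \<open>x N1 \<in> W\<close> WC by auto
      next
        case False
        obtain k where k: "N1 \<le> k" "k \<le> n" "T0 \<le> step_time \<gamma> n - step_time \<gamma> k"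
          "step_time \<gamma> n - step_time \<gamma> k \<le> T0 + 1"
          by (rule step_time_window[of N1 T0 n]) (use g1(1) N1 T0(1) less.prems in auto)
        have "k \<noteq> n" using k(3) T0(1) by auto
        then have "x k \<in> W" using k False by (intro less.IH) auto
        then show ?thesis using that[of k] k T0(1) WC by auto
      qed
      show ?case
        by (rule \<delta>2(2)[OF g(1) g1(3) x u _ small_noise_mono[OF noise(1) _ \<delta>(1,4)] k(2,3,4)])
           (use k(1,5) N1 \<delta>2(1) in \<open>auto intro!: bexI[of _ "x k"]\<close>)
    qed
    obtain T where T: "T > 0" "\<And>t. t \<ge> T \<Longrightarrow> (\<Union>x\<in>U. flow F t x) \<subseteq> (\<Union>a\<in>A. ball a e)"
      using U(2)[OF e] by blast
    have flow_T: "flow F t z \<subseteq> (\<Union>a\<in>A. ball a e)" if "z \<in> C" "T \<le> t" "t \<le> T + 1" for z t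
      using that T(2)[OF that(2)] C(2) by blast
    have op: "open (\<Union>a\<in>A. ball a e)" by auto
    obtain \<delta>3 where \<delta>3: "\<delta>3 > 0" "\<And>\<gamma> x u N n. step_sizes \<gamma> \<Longrightarrow> (\<And>i. i > N \<Longrightarrow> \<gamma> i \<le> \<delta>3) \<Longrightarrow>
      perturbed_scheme F \<gamma> x u \<Longrightarrow> (\<And>n. x n \<in> M) \<Longrightarrow> (\<And>n. n \<ge> 1 \<Longrightarrow> norm (u n) \<le> K) \<Longrightarrow>
      (\<exists>z\<in>C. dist (x N) z \<le> \<delta>3) \<Longrightarrow> small_noise \<gamma> u N \<delta>3 \<Longrightarrow> N \<le> n \<Longrightarrow>
      T \<le> step_time \<gamma> n - step_time \<gamma> N \<Longrightarrow> step_time \<gamma> n - step_time \<gamma> N \<le> T + 1 \<Longrightarrow>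
      x n \<in> (\<Union>a\<in>A. ball a e)"
      using flow_tracking_from[OF F M C(1) op less_imp_le[OF T(1)] flow_T, where K = K] by blast
    obtain N2 where N2: "small_noise \<gamma> u N2 \<delta>3" using noise(2)[OF \<delta>3(1)] by blast
    obtain N3 where N3: "\<And>n. n \<ge> N3 \<Longrightarrow> \<gamma> n < \<delta>3"
      using order_tendstoD(2)[OF g(2) \<delta>3(1)] by (auto simp: eventually_sequentially)
    have "\<forall>\<^sub>F n in sequentially. step_time \<gamma> N1 + T0 \<le> step_time \<gamma> n"
      using unbounded by (simp add: filterlim_at_top)
    then obtain N4 where N4: "\<And>n. n \<ge> N4 \<Longrightarrow> step_time \<gamma> N1 + T0 \<le> step_time \<gamma> n"
      by (auto simp: eventually_sequentially)
    \<comment> \<open>Beyond \<open>L\<close> the steps and the noise meet the tolerance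
      \<open>\<delta>3\<close> and the scheme is in \<open>W\<close>, so every sufficiently late
      point can be tracked from a point of \<open>C\<close> visited about \<open>T\<close>
      earlier.\<close>
    define L where "L = max (max N N2) (max N3 N4)"
    have "\<forall>\<^sub>F n in sequentially. step_time \<gamma> L + T \<le> step_time \<gamma> n"
      using unbounded by (simp add: filterlim_at_top)
    then show "\<forall>\<^sub>F n in sequentially. x n \<in> (\<Union>a\<in>A. ball a e)"
    proof eventually_elim
      case (elim n)
      obtain k where k: "L \<le> k" "k \<le> n" "T \<le> step_time \<gamma> n - step_time \<gamma> k"
        "step_time \<gamma> n - step_time \<gamma> k \<le> T + 1"
        by (rule step_time_window[of L T n]) (use g1(1) T(1) elim in \<open>auto simp: L_def\<close>)
      have "x k \<in> C" using in_W[OF N4] WC k(1) by (auto simp: L_def)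
      show ?case
        by (rule \<delta>3(2)[OF g(1) _ x u _ small_noise_mono[OF N2 _ \<delta>3(1) order_refl] k(2,3,4)])
           (use k(1) N3 \<open>x k \<in> C\<close> \<delta>3(1) in \<open>auto simp: L_def intro!: bexI[of _ "x k"] less_imp_le\<close>)
    qed
  qed
qed

text \<open>An interpolated point is within one increment of a grid point. The three errors, from
  \<open>A\<close> to the grid, from the grid to the path and from the path to \<open>p\<close>,
  each get a third of \<open>e\<close>.\<close>

lemma (in step_sizes) limit_set_interpolation_subset:
  fixes x :: "nat \<Rightarrow> 'a::real_normed_vector"
  assumes A: "closed A" and x: "\<And>e. e > 0 \<Longrightarrow> \<forall>\<^sub>F n in sequentially. x n \<in> (\<Union>a\<in>A. ball a e)"
    and diff: "(\<lambda>n. x (Suc n) - x n) \<longlonglongrightarrow> 0"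
  shows "limit_set (interpolation \<gamma> x) \<subseteq> A"
proof
  fix p assume p: "p \<in> limit_set (interpolation \<gamma> x)"
  have "\<exists>a\<in>A. dist a p < e" if e: "e > 0" for e
  proof -
    have "\<forall>\<^sub>F n in sequentially. x n \<in> (\<Union>a\<in>A. ball a (e / 3))" using e by (intro x) simp
    moreover have "\<forall>\<^sub>F n in sequentially. dist (x (Suc n) - x n) 0 < e / 3"
      using diff e by (intro tendstoD) auto
    ultimately have "\<forall>\<^sub>F n in sequentially. x n \<in> (\<Union>a\<in>A. ball a (e / 3)) \<and> dist (x (Suc n) - x n) 0 < e / 3"
      by (rule eventually_conj)
    then obtain n0 where n0: "\<And>n. n \<ge> n0 \<Longrightarrow> x n \<in> (\<Union>a\<in>A. ball a (e / 3))"
      "\<And>n. n \<ge> n0 \<Longrightarrow> norm (x (Suc n) - x n) < e / 3" by (auto simp: eventually_sequentially)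
    have "p \<in> closure (interpolation \<gamma> x ` {step_time \<gamma> n0..})"
      using p step_time_nonneg[of n0] by (auto simp: limit_set_def)
    then obtain s where s: "s \<ge> step_time \<gamma> n0" "dist (interpolation \<gamma> x s) p < e / 3"
      using e unfolding closure_approachable by (auto dest!: spec[of _ "e / 3"])
    have s0: "0 \<le> s" using s(1) step_time_nonneg[of n0] by linarith
    define i where "i = step_index \<gamma> s"
    have i: "n0 \<le> i" unfolding i_def using s(1) by (rule step_index_greatest)
    have b: "0 \<le> s - step_time \<gamma> i" "s - step_time \<gamma> i \<le> \<gamma> (Suc i)"
      using step_index_bounds[OF s0] by (simp_all add: i_def step_time_Suc)
    have g: "\<gamma> (Suc i) > 0" using pos by simp
    have "interpolation \<gamma> x s = x i + ((s - step_time \<gamma> i) / \<gamma> (Suc i)) *\<^sub>R (x (Suc i) - x i)"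
      using interpolation_eq[of \<gamma> "s - step_time \<gamma> i" i x] pos b by simp
    then have "dist (interpolation \<gamma> x s) (x i) = ((s - step_time \<gamma> i) / \<gamma> (Suc i)) * norm (x (Suc i) - x i)"
      using b g by (simp add: dist_norm)
    also have "\<dots> \<le> 1 * norm (x (Suc i) - x i)" using b g by (intro mult_right_mono) auto
    also have "\<dots> < e / 3" using n0(2)[OF i] by simp
    finally have 1: "dist (interpolation \<gamma> x s) (x i) < e / 3" .
    obtain a where a: "a \<in> A" "dist a (x i) < e / 3" using n0(1)[OF i] by auto
    have "dist a p \<le> dist a (x i) + dist (x i) (interpolation \<gamma> x s) + dist (interpolation \<gamma> x s) p"
      using dist_triangle[of a p "x i"] dist_triangle[of "x i" p "interpolation \<gamma> x s"] by linarith
    also have "\<dots> < e" using 1 a(2) s(2) by (simp add: dist_commute)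
    finally show ?thesis using a(1) by blast
  qed
  then show "p \<in> A" using A by (metis closed_approachable)
qed

section \<open>Exponential bounds for bounded martingale noise\<close>

lemma borel_measurable_component [measurable (raw)]:
  fixes f :: "'a \<Rightarrow> real ^ 'n"
  assumes "f \<in> borel_measurable M"
  shows "(\<lambda>\<omega>. f \<omega> $ i) \<in> borel_measurable M"
  by (rule borel_measurable_continuous_on[OF _ assms, of "\<lambda>v. v $ i"]) (intro continuous_intros)

text \<open>The linear term is kept exact so that a vanishing conditional mean can cancel it. The
  restriction to \<open>\<bar>u\<bar> \<le> 1\<close> is the source of the condition
  \<open>\<bar>\<theta>\<bar> * K \<le> 1\<close> below.\<close>

lemma exp_le_quadratic:
  fixes u :: real
  assumes "\<bar>u\<bar> \<le> 1"
  shows "exp u \<le> 1 + u + u\<^sup>2"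
proof (cases "u \<ge> 0")
  case True
  then show ?thesis using assms by (intro exp_bound) auto
next
  case False
  define w where "w = - u"
  have w: "0 < w" "w \<le> 1" using False assms by (auto simp: w_def)
  have low: "1 + w + w\<^sup>2 / 2 \<le> exp w" using w by (intro exp_lower_Taylor_quadratic) simp
  \<comment> \<open>For negative \<open>u\<close> the claim becomes
    \<open>1 \<le> (1 - w + w\<^sup>2) * exp w\<close>. It already holds with the quadratic Taylor
    polynomial for \<open>exp w\<close>, the excess being this sum.\<close>
  have "0 \<le> w\<^sup>2 / 2 + w ^ 3 / 2 + w ^ 4 / 2" using w by (intro add_nonneg_nonneg) auto
  also have "\<dots> = (1 - w + w\<^sup>2) * (1 + w + w\<^sup>2 / 2) - 1"
    by (simp add: power2_eq_square power3_eq_cube power4_eq_xxxx field_simps)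
  finally have "1 \<le> (1 - w + w\<^sup>2) * (1 + w + w\<^sup>2 / 2)" by simp
  also have "\<dots> \<le> (1 - w + w\<^sup>2) * exp w"
    using low w by (intro mult_left_mono) auto
  finally show ?thesis by (simp add: w_def exp_minus field_simps)
qed

text \<open>Against the \<open>G\<close>-measurable weight \<open>Z\<close> the linear term of the
  expansion integrates to 0, which leaves the factor
  \<open>1 + \<theta>\<^sup>2 * K\<^sup>2\<close>. The weight carries the past, namely an event and
  the exponential accumulated so far, so the bound can be iterated.\<close>

lemma (in prob_space) conditional_exp_moment_le:
  fixes V Z :: "'a \<Rightarrow> real"
  assumes G: "subalgebra M G" and Z: "Z \<in> borel_measurable G" "\<And>\<omega>. 0 \<le> Z \<omega>" "AE \<omega> in M. Z \<omega> \<le> B"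
    and V[measurable]: "V \<in> borel_measurable M" and VK: "AE \<omega> in M. \<bar>V \<omega>\<bar> \<le> K"
    and mean: "AE \<omega> in M. real_cond_exp M G V \<omega> = 0" and \<theta>: "\<bar>\<theta>\<bar> * K \<le> 1"
  shows "(\<integral>\<omega>. Z \<omega> * exp (\<theta> * V \<omega>) \<partial>M) \<le> exp (\<theta>\<^sup>2 * K\<^sup>2) * (\<integral>\<omega>. Z \<omega> \<partial>M)"
proof -
  interpret finite_measure_subalgebra M G by unfold_locales (rule G)
  have [measurable]: "Z \<in> borel_measurable M" using Z(1) by (rule measurable_from_subalg[OF G])
  have iZ: "integrable M Z"
    by (rule integrable_const_bound[of _ B]) (use Z(2,3) in auto)
  have iZV: "integrable M (\<lambda>\<omega>. Z \<omega> * V \<omega>)"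
  proof (rule integrable_const_bound[of _ "B * K"])
    show "AE \<omega> in M. norm (Z \<omega> * V \<omega>) \<le> B * K"
      using Z(3) VK
    proof eventually_elim
      case (elim \<omega>)
      have "\<bar>Z \<omega>\<bar> * \<bar>V \<omega>\<bar> \<le> B * K" using elim Z(2)[of \<omega>] by (intro mult_mono) auto
      then show ?case by (simp add: abs_mult)
    qed
  qed auto
  have "(\<integral>\<omega>. Z \<omega> * V \<omega> \<partial>M) = (\<integral>\<omega>. Z \<omega> * real_cond_exp M G V \<omega> \<partial>M)"
    using real_cond_exp_intg(2)[OF iZV Z(1) V] by simp
  also have "\<dots> = (\<integral>\<omega>. 0 \<partial>M)" by (rule integral_cong_AE) (use mean in auto)
  finally have zero: "(\<integral>\<omega>. Z \<omega> * V \<omega> \<partial>M) = 0" by simp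
  have le: "AE \<omega> in M. Z \<omega> * exp (\<theta> * V \<omega>) \<le> (1 + \<theta>\<^sup>2 * K\<^sup>2) * Z \<omega> + \<theta> * (Z \<omega> * V \<omega>)"
    using VK
  proof eventually_elim
    case (elim \<omega>)
    have "\<bar>\<theta> * V \<omega>\<bar> \<le> \<bar>\<theta>\<bar> * K" using elim by (auto simp: abs_mult intro: mult_left_mono)
    then have "exp (\<theta> * V \<omega>) \<le> 1 + \<theta> * V \<omega> + (\<theta> * V \<omega>)\<^sup>2" using \<theta> by (intro exp_le_quadratic) auto
    also have "(\<theta> * V \<omega>)\<^sup>2 \<le> \<theta>\<^sup>2 * K\<^sup>2"
      unfolding power_mult_distrib using power_mono[OF elim, of 2] by (intro mult_left_mono) auto
    finally have "Z \<omega> * exp (\<theta> * V \<omega>) \<le> Z \<omega> * (1 + \<theta> * V \<omega> + \<theta>\<^sup>2 * K\<^sup>2)"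
      using Z(2)[of \<omega>] by (intro mult_left_mono) auto
    then show ?case by (simp add: algebra_simps)
  qed
  have i2: "integrable M (\<lambda>\<omega>. (1 + \<theta>\<^sup>2 * K\<^sup>2) * Z \<omega> + \<theta> * (Z \<omega> * V \<omega>))"
    using iZ iZV by auto
  have i1: "integrable M (\<lambda>\<omega>. Z \<omega> * exp (\<theta> * V \<omega>))"
    by (rule Bochner_Integration.integrable_bound[OF i2]) (use le Z(2) in \<open>auto elim!: eventually_mono\<close>)
  have "(\<integral>\<omega>. Z \<omega> * exp (\<theta> * V \<omega>) \<partial>M) \<le> (\<integral>\<omega>. (1 + \<theta>\<^sup>2 * K\<^sup>2) * Z \<omega> + \<theta> * (Z \<omega> * V \<omega>) \<partial>M)"
    using i1 i2 le by (rule integral_mono_AE)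
  also have "\<dots> = (1 + \<theta>\<^sup>2 * K\<^sup>2) * (\<integral>\<omega>. Z \<omega> \<partial>M)"
    using iZ iZV zero by (subst Bochner_Integration.integral_add) auto
  also have "\<dots> \<le> exp (\<theta>\<^sup>2 * K\<^sup>2) * (\<integral>\<omega>. Z \<omega> \<partial>M)"
    using Z(2) by (intro mult_right_mono exp_ge_add_one_self) (auto intro: integral_nonneg_AE)
  finally show ?thesis .
qed

text \<open>The conditional mean is prescribed by coordinates because \<open>real_cond_exp\<close>
  is scalar; accordingly the exponential bounds are obtained for single coordinates and recombined
  in \<open>tail_le\<close>.\<close>

locale martingale_noise = prob_space P + step_sizes \<gamma>
  for P :: "'w measure" and \<gamma> +
  fixes \<F> :: "nat \<Rightarrow> 'w measure" and U :: "nat \<Rightarrow> 'w \<Rightarrow> real ^ 'm" and K :: real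
  assumes filtration: "filtration (space P) \<F>" and subalg: "subalgebra P (\<F> n)"
    and decreasing: "n \<ge> 1 \<Longrightarrow> \<gamma> (Suc n) \<le> \<gamma> n"
    and U_adapted: "n \<ge> 1 \<Longrightarrow> U n \<in> borel_measurable (\<F> n)"
    and U_bounded: "n \<ge> 1 \<Longrightarrow> AE \<omega> in P. norm (U n \<omega>) \<le> K"
    and U_mean: "AE \<omega> in P. real_cond_exp P (\<F> n) (\<lambda>\<omega>. U (Suc n) \<omega> $ i) \<omega> = 0"
    and K_pos: "K > 0"
    and exp_summable: "c > 0 \<Longrightarrow> summable (\<lambda>n. exp (- c / \<gamma> (Suc n)))"
begin

definition S :: "nat \<Rightarrow> 'w \<Rightarrow> real ^ 'm" where
  "S n \<omega> = noise_sum \<gamma> (\<lambda>k. U k \<omega>) n"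

lemma sets_F_mono: "m \<le> n \<Longrightarrow> sets (\<F> m) \<subseteq> sets (\<F> n)"
  using filtration by (simp add: filtration_def)

lemma sets_F_subset: "E \<in> sets (\<F> n) \<Longrightarrow> E \<in> events"
  using subalg[of n] by (auto simp: subalgebra_def)

lemma measurable_F_mono:
  assumes "f \<in> borel_measurable (\<F> m)" "m \<le> n"
  shows "f \<in> borel_measurable (\<F> n)"
proof (rule measurable_from_subalg[OF _ assms(1)])
  show "subalgebra (\<F> n) (\<F> m)"
    using sets_F_mono[OF assms(2)] filtration by (simp add: subalgebra_def filtration_def)
qed

lemma U_measurable [measurable]: "n \<ge> 1 \<Longrightarrow> U n \<in> borel_measurable P"
  using U_adapted by (rule measurable_from_subalg[OF subalg])

lemma U_le: "AE \<omega> in P. \<forall>n\<ge>1. norm (U n \<omega>) \<le> K"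
  using U_bounded by (auto simp: AE_all_countable)

lemma S_adapted: "S n \<in> borel_measurable (\<F> n)"
  unfolding S_def noise_sum_def
  by (intro borel_measurable_sum borel_measurable_scaleR measurable_F_mono[OF U_adapted]) auto

lemma S_measurable [measurable]: "S n \<in> borel_measurable P"
  using S_adapted by (rule measurable_from_subalg[OF subalg])

lemma S_lipschitz:
  assumes "\<And>n. n \<ge> 1 \<Longrightarrow> norm (U n \<omega>) \<le> K" "m \<le> n"
  shows "norm (S n \<omega> - S m \<omega>) \<le> K * (step_time \<gamma> n - step_time \<gamma> m)"
  using \<open>m \<le> n\<close>
proof (induction n rule: dec_induct)
  case (step k)
  have "norm (S (Suc k) \<omega> - S m \<omega>) = norm ((S k \<omega> - S m \<omega>) + \<gamma> (Suc k) *\<^sub>R U (Suc k) \<omega>)"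
    by (simp add: S_def noise_sum_Suc algebra_simps)
  also have "\<dots> \<le> norm (S k \<omega> - S m \<omega>) + \<gamma> (Suc k) * norm (U (Suc k) \<omega>)"
    using pos[of "Suc k"] by (intro order_trans[OF norm_triangle_ineq]) simp
  also have "\<gamma> (Suc k) * norm (U (Suc k) \<omega>) \<le> \<gamma> (Suc k) * K"
    using pos[of "Suc k"] assms(1) by (intro mult_left_mono) auto
  finally show ?case using step.IH by (simp add: step_time_Suc algebra_simps)
qed simp

lemma decreasing_le:
  assumes "1 \<le> m" "m \<le> n"
  shows "\<gamma> n \<le> \<gamma> m"
  using assms(2)
proof (induction n rule: dec_induct)
  case (step k)
  then show ?case using decreasing[of k] assms(1) by simp
qed simp

text \<open>The terms of the series for \<open>c = 1\<close> tend to 0, which forces the exponents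
  \<open>- 1 / \<gamma> (Suc n)\<close> to minus infinity.\<close>

lemma step_size_tendsto_0: "\<gamma> \<longlonglongrightarrow> 0"
proof (rule LIMSEQ_imp_Suc, rule tendstoI)
  fix e :: real assume e: "e > 0"
  have "(\<lambda>n. exp (- 1 / \<gamma> (Suc n))) \<longlonglongrightarrow> 0"
    using exp_summable[of 1] by (intro summable_LIMSEQ_zero) simp
  then have "\<forall>\<^sub>F n in sequentially. exp (- 1 / \<gamma> (Suc n)) < exp (- 1 / e)"
    by (rule order_tendstoD(2)) simp
  then show "\<forall>\<^sub>F n in sequentially. dist (\<gamma> (Suc n)) 0 < e"
  proof eventually_elim
    case (elim n)
    then have "1 / e < 1 / \<gamma> (Suc n)" by simp
    then show ?case using pos[of "Suc n"] e by (simp add: field_simps)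
  qed
qed

text \<open>Each step contributes the exponent \<open>\<theta>\<^sup>2 * K\<^sup>2\<close> times its
  squared step size. As the steps decrease, that square is at most \<open>\<gamma> (Suc n)\<close>
  times the step, so the exponents add up to \<open>\<gamma> (Suc n)\<close> times the elapsed
  time.\<close>

lemma exp_moment_le:
  assumes E: "E \<in> sets (\<F> n)" and "n \<le> k" and \<theta>: "\<bar>\<theta>\<bar> * (\<gamma> (Suc n) * K) \<le> 1"
  shows "(\<integral>\<omega>. indicator E \<omega> * exp (\<theta> * (S k \<omega> $ i - S n \<omega> $ i)) \<partial>P)
    \<le> prob E * exp (\<theta>\<^sup>2 * K\<^sup>2 * \<gamma> (Suc n) * (step_time \<gamma> k - step_time \<gamma> n))"
  using \<open>n \<le> k\<close>
proof (induction k rule: dec_induct)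
  case base
  show ?case using sets_F_subset[OF E] by simp
next
  case (step k)
  define Z where "Z = (\<lambda>\<omega>. indicator E \<omega> * exp (\<theta> * (S k \<omega> $ i - S n \<omega> $ i)))"
  define h where "h = \<gamma> (Suc k)"
  have h: "0 < h" "h \<le> \<gamma> (Suc n)" using pos[of "Suc k"] decreasing_le[of "Suc n" "Suc k"] step.hyps by (auto simp: h_def)
  have [measurable]: "E \<in> sets (\<F> k)" using sets_F_mono[OF step.hyps(1)] E by blast
  have [measurable]: "S k \<in> borel_measurable (\<F> k)" "S n \<in> borel_measurable (\<F> k)"
    using S_adapted measurable_F_mono[OF S_adapted step.hyps(1)] by auto
  have "(\<integral>\<omega>. Z \<omega> * exp (\<theta> * (h * (U (Suc k) \<omega> $ i))) \<partial>P) = (\<integral>\<omega>. Z \<omega> * exp (\<theta> * h * (U (Suc k) \<omega> $ i)) \<partial>P)"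
    by (simp add: mult.assoc)
  also have "\<dots> \<le> exp ((\<theta> * h)\<^sup>2 * K\<^sup>2) * (\<integral>\<omega>. Z \<omega> \<partial>P)"
  proof (rule conditional_exp_moment_le[OF subalg, of Z k "exp (\<bar>\<theta>\<bar> * (K * (step_time \<gamma> k - step_time \<gamma> n)))"])
    show "Z \<in> borel_measurable (\<F> k)" unfolding Z_def by measurable
    show "0 \<le> Z \<omega>" for \<omega> by (simp add: Z_def)
    show "AE \<omega> in P. Z \<omega> \<le> exp (\<bar>\<theta>\<bar> * (K * (step_time \<gamma> k - step_time \<gamma> n)))"
      using U_le
    proof eventually_elim
      case (elim \<omega>)
      have "\<bar>S k \<omega> $ i - S n \<omega> $ i\<bar> \<le> K * (step_time \<gamma> k - step_time \<gamma> n)"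
        using S_lipschitz[of \<omega> n k] elim step.hyps component_le_norm_cart[of "S k \<omega> - S n \<omega>" i] by auto
      then have "\<bar>\<theta> * (S k \<omega> $ i - S n \<omega> $ i)\<bar> \<le> \<bar>\<theta>\<bar> * (K * (step_time \<gamma> k - step_time \<gamma> n))"
        unfolding abs_mult by (intro mult_left_mono) auto
      then show ?case by (auto simp: Z_def split: split_indicator)
    qed
    show "AE \<omega> in P. \<bar>U (Suc k) \<omega> $ i\<bar> \<le> K"
      using U_bounded[of "Suc k"] by (auto elim!: eventually_mono intro: order_trans[OF component_le_norm_cart])
    show "AE \<omega> in P. real_cond_exp P (\<F> k) (\<lambda>\<omega>. U (Suc k) \<omega> $ i) \<omega> = 0" by (rule U_mean)
    have "\<bar>\<theta> * h\<bar> * K = \<bar>\<theta>\<bar> * (h * K)" using h by (simp add: abs_mult)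
    also have "\<dots> \<le> \<bar>\<theta>\<bar> * (\<gamma> (Suc n) * K)" using h K_pos by (intro mult_left_mono mult_right_mono) auto
    finally show "\<bar>\<theta> * h\<bar> * K \<le> 1" using \<theta> by simp
  qed measurable
  also have "\<dots> \<le> exp (\<theta>\<^sup>2 * K\<^sup>2 * \<gamma> (Suc n) * h) *
      (prob E * exp (\<theta>\<^sup>2 * K\<^sup>2 * \<gamma> (Suc n) * (step_time \<gamma> k - step_time \<gamma> n)))"
  proof (rule mult_mono)
    have "\<theta>\<^sup>2 * K\<^sup>2 * (h * h) \<le> \<theta>\<^sup>2 * K\<^sup>2 * (\<gamma> (Suc n) * h)"
      using h by (intro mult_left_mono mult_right_mono) auto
    then show "exp ((\<theta> * h)\<^sup>2 * K\<^sup>2) \<le> exp (\<theta>\<^sup>2 * K\<^sup>2 * \<gamma> (Suc n) * h)"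
      by (simp add: power2_eq_square algebra_simps)
    show "(\<integral>\<omega>. Z \<omega> \<partial>P) \<le> prob E * exp (\<theta>\<^sup>2 * K\<^sup>2 * \<gamma> (Suc n) * (step_time \<gamma> k - step_time \<gamma> n))"
      using step.IH by (simp add: Z_def)
    show "0 \<le> (\<integral>\<omega>. Z \<omega> \<partial>P)" by (intro integral_nonneg_AE) (auto simp: Z_def)
  qed simp
  also have "\<dots> = prob E * exp (\<theta>\<^sup>2 * K\<^sup>2 * \<gamma> (Suc n) * (step_time \<gamma> (Suc k) - step_time \<gamma> n))"
    by (simp add: h_def step_time_Suc exp_add[symmetric] algebra_simps)
  also have "(\<integral>\<omega>. Z \<omega> * exp (\<theta> * (h * (U (Suc k) \<omega> $ i))) \<partial>P)
    = (\<integral>\<omega>. indicator E \<omega> * exp (\<theta> * (S (Suc k) \<omega> $ i - S n \<omega> $ i)) \<partial>P)"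
    by (rule Bochner_Integration.integral_cong)
       (simp_all add: Z_def S_def h_def noise_sum_Suc mult.assoc exp_add[symmetric] algebra_simps)
  finally show ?case .
qed

text \<open>A Chernoff bound with \<open>\<theta> = s * a / \<gamma> (Suc n)\<close>, where the sign
  \<open>s\<close> selects the tail. The first entry of the minimum makes \<open>\<theta>\<close>
  admissible for \<open>exp_moment_le\<close>; the second limits the quadratic term to half of the
  gain \<open>a * d / \<gamma> (Suc n)\<close>.\<close>

lemma component_tail_le:
  fixes d T :: real
  assumes d: "d > 0" and T: "T > 0" and s: "\<bar>s\<bar> = 1"
    and E: "E \<in> sets (\<F> n)" and nk: "n \<le> k" "step_time \<gamma> k - step_time \<gamma> n \<le> T"
  defines "a \<equiv> min (1 / K) (d / (2 * K\<^sup>2 * T))"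
  shows "prob {\<omega>\<in>E. s * (S k \<omega> $ i - S n \<omega> $ i) \<ge> d} \<le> prob E * exp (- (a * d / 2) / \<gamma> (Suc n))"
proof -
  let ?g = "\<gamma> (Suc n)"
  let ?D = "\<lambda>\<omega>. S k \<omega> $ i - S n \<omega> $ i"
  have g: "?g > 0" using pos by simp
  have a: "a > 0" "a \<le> 1 / K" "a \<le> d / (2 * K\<^sup>2 * T)" using d T K_pos by (auto simp: a_def)
  have aK: "a * K \<le> 1" using a(2) K_pos by (simp add: field_simps)
  have aT: "a * K\<^sup>2 * T \<le> d / 2" using a(3) K_pos T by (simp add: field_simps)
  have [measurable]: "E \<in> events" using sets_F_subset[OF E] .
  define \<theta> where "\<theta> = s * a / ?g"
  have "\<bar>\<theta>\<bar> * (?g * K) \<le> 1" using g a s aK by (simp add: \<theta>_def abs_mult)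
  note moment = exp_moment_le[OF E nk(1) this, of i]
  have ev: "{\<omega>\<in>E. s * ?D \<omega> \<ge> d} \<in> events"
  proof -
    have "{\<omega>\<in>E. s * ?D \<omega> \<ge> d} = E \<inter> {\<omega>\<in>space P. s * ?D \<omega> \<ge> d}"
      using sets.sets_into_space[OF sets_F_subset[OF E]] by auto
    also have "\<dots> \<in> events" by measurable
    finally show ?thesis .
  qed
  have "integrable P (\<lambda>\<omega>. indicator E \<omega> * exp (\<theta> * ?D \<omega>))"
  proof (rule integrable_const_bound[of _ "exp (\<bar>\<theta>\<bar> * (K * (step_time \<gamma> k - step_time \<gamma> n)))"])
    show "AE \<omega> in P. norm (indicator E \<omega> * exp (\<theta> * ?D \<omega>)) \<le> exp (\<bar>\<theta>\<bar> * (K * (step_time \<gamma> k - step_time \<gamma> n)))"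
      using U_le
    proof eventually_elim
      case (elim \<omega>)
      have "\<bar>?D \<omega>\<bar> \<le> K * (step_time \<gamma> k - step_time \<gamma> n)"
        using S_lipschitz[of \<omega> n k] elim nk component_le_norm_cart[of "S k \<omega> - S n \<omega>" i] by auto
      then have "\<bar>\<theta> * ?D \<omega>\<bar> \<le> \<bar>\<theta>\<bar> * (K * (step_time \<gamma> k - step_time \<gamma> n))"
        unfolding abs_mult by (intro mult_left_mono) auto
      then show ?case by (auto split: split_indicator)
    qed
  qed measurable
  then have int: "integrable P (\<lambda>\<omega>. exp (- (a * d / ?g)) * (indicator E \<omega> * exp (\<theta> * ?D \<omega>)))"
    by (rule integrable_mult_right)
  have "prob {\<omega>\<in>E. s * ?D \<omega> \<ge> d} = (\<integral>\<omega>. indicator {\<omega>\<in>E. s * ?D \<omega> \<ge> d} \<omega> \<partial>P)"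
    using ev by simp
  also have "\<dots> \<le> (\<integral>\<omega>. exp (- (a * d / ?g)) * (indicator E \<omega> * exp (\<theta> * ?D \<omega>)) \<partial>P)"
  proof (rule integral_mono[OF _ int])
    show "integrable P (indicator {\<omega>\<in>E. s * ?D \<omega> \<ge> d} :: _ \<Rightarrow> real)"
      using ev by (simp add: integrable_indicator_iff emeasure_eq_measure)
    fix \<omega>
    show "indicator {\<omega>\<in>E. s * ?D \<omega> \<ge> d} \<omega> \<le> exp (- (a * d / ?g)) * (indicator E \<omega> * exp (\<theta> * ?D \<omega>))"
    proof (cases "\<omega> \<in> E \<and> s * ?D \<omega> \<ge> d")
      case True
      then have "a / ?g * d \<le> a / ?g * (s * ?D \<omega>)" using a g by (intro mult_left_mono) auto
      then have "0 \<le> - (a * d / ?g) + \<theta> * ?D \<omega>" by (simp add: \<theta>_def algebra_simps)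
      then show ?thesis using True by (simp add: exp_add[symmetric])
    qed auto
  qed
  also have "\<dots> = exp (- (a * d / ?g)) * (\<integral>\<omega>. indicator E \<omega> * exp (\<theta> * ?D \<omega>) \<partial>P)" by simp
  also have "\<dots> \<le> exp (- (a * d / ?g)) * (prob E * exp (\<theta>\<^sup>2 * K\<^sup>2 * ?g * (step_time \<gamma> k - step_time \<gamma> n)))"
    using moment by (intro mult_left_mono) auto
  also have "\<dots> = prob E * exp (- (a * d / ?g) + \<theta>\<^sup>2 * K\<^sup>2 * ?g * (step_time \<gamma> k - step_time \<gamma> n))"
    by (simp only: exp_add mult_ac)
  also have "\<dots> \<le> prob E * exp (- (a * d / 2) / ?g)"
  proof (intro mult_left_mono exp_le_cancel_iff[THEN iffD2])
    have "\<theta>\<^sup>2 * ?g = a * a / ?g"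
    proof -
      have "\<theta>\<^sup>2 = a\<^sup>2 / ?g\<^sup>2"
        using s by (simp add: \<theta>_def power_divide power_mult_distrib) (metis abs_1 power2_abs power_one)
      then show ?thesis using g by (simp add: power2_eq_square)
    qed
    have "\<theta>\<^sup>2 * K\<^sup>2 * ?g * (step_time \<gamma> k - step_time \<gamma> n) = (\<theta>\<^sup>2 * ?g) * (K\<^sup>2 * (step_time \<gamma> k - step_time \<gamma> n))"
      by (simp only: mult_ac)
    also have "\<dots> = a / ?g * (a * K\<^sup>2 * (step_time \<gamma> k - step_time \<gamma> n))"
      unfolding \<open>\<theta>\<^sup>2 * ?g = a * a / ?g\<close> by simp
    also have "\<dots> \<le> a / ?g * (a * K\<^sup>2 * T)"
      using a g nk by (intro mult_left_mono) auto
    also have "\<dots> \<le> a / ?g * (d / 2)" using a g aT by (intro mult_left_mono) auto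
    finally show "- (a * d / ?g) + \<theta>\<^sup>2 * K\<^sup>2 * ?g * (step_time \<gamma> k - step_time \<gamma> n) \<le> - (a * d / 2) / ?g"
      by (simp add: field_simps)
  qed simp
  finally show ?thesis .
qed

lemma tail_le:
  fixes d T :: real
  assumes d: "d > 0" and T: "T > 0"
  obtains c where "c > 0" "\<And>n k E. E \<in> sets (\<F> n) \<Longrightarrow> n \<le> k \<Longrightarrow> step_time \<gamma> k - step_time \<gamma> n \<le> T \<Longrightarrow>
    prob {\<omega>\<in>E. norm (S k \<omega> - S n \<omega>) > d} \<le> 2 * real CARD('m) * prob E * exp (- c / \<gamma> (Suc n))"
proof -
  \<comment> \<open>If the norm exceeds \<open>d\<close>, some coordinate is at least
    \<open>d / CARD('m)\<close> in absolute value. Two signs per coordinate give the factor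
    \<open>2 * real CARD('m)\<close>.\<close>
  define b where "b = d / real CARD('m)"
  have b: "b > 0" using d by (simp add: b_def)
  define c where "c = min (1 / K) (b / (2 * K\<^sup>2 * T)) * b / 2"
  have c: "c > 0" using b K_pos T by (simp add: c_def)
  show ?thesis
  proof (rule that[OF c])
    fix n k E assume E: "E \<in> sets (\<F> n)" and nk: "n \<le> k" "step_time \<gamma> k - step_time \<gamma> n \<le> T"
    define B where "B = (\<lambda>(i, s). {\<omega>\<in>E. s * (S k \<omega> $ i - S n \<omega> $ i) \<ge> b})"
    let ?I = "(UNIV :: 'm set) \<times> {1, - 1 :: real}"
    have B_ev: "B j \<in> events" for j
    proof -
      obtain i s where j: "j = (i, s)" by (cases j)
      have "B j = E \<inter> {\<omega>\<in>space P. s * (S k \<omega> $ i - S n \<omega> $ i) \<ge> b}"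
        using sets.sets_into_space[OF sets_F_subset[OF E]] by (auto simp: B_def j)
      also have "\<dots> \<in> events" using sets_F_subset[OF E] by measurable
      finally show ?thesis .
    qed
    have "{\<omega>\<in>E. norm (S k \<omega> - S n \<omega>) > d} \<subseteq> (\<Union>j\<in>?I. B j)"
    proof
      fix \<omega> assume \<omega>: "\<omega> \<in> {\<omega>\<in>E. norm (S k \<omega> - S n \<omega>) > d}"
      have "\<exists>i. \<bar>(S k \<omega> - S n \<omega>) $ i\<bar> \<ge> b"
      proof (rule ccontr)
        assume "\<nexists>i. \<bar>(S k \<omega> - S n \<omega>) $ i\<bar> \<ge> b"
        then have "(\<Sum>i\<in>UNIV. \<bar>(S k \<omega> - S n \<omega>) $ i\<bar>) \<le> (\<Sum>i\<in>(UNIV :: 'm set). b)"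
          by (intro sum_mono) (auto simp: not_le intro: less_imp_le)
        then have "norm (S k \<omega> - S n \<omega>) \<le> d"
          using norm_le_l1_cart[of "S k \<omega> - S n \<omega>"] by (simp add: b_def)
        then show False using \<omega> by simp
      qed
      then obtain i where "\<bar>S k \<omega> $ i - S n \<omega> $ i\<bar> \<ge> b" by auto
      then have "\<omega> \<in> B (i, 1) \<or> \<omega> \<in> B (i, - 1)" using \<omega> by (auto simp: B_def)
      then show "\<omega> \<in> (\<Union>j\<in>?I. B j)" by auto
    qed
    then have "prob {\<omega>\<in>E. norm (S k \<omega> - S n \<omega>) > d} \<le> prob (\<Union>j\<in>?I. B j)"
      using B_ev by (intro finite_measure_mono) auto
    also have "\<dots> \<le> (\<Sum>j\<in>?I. prob (B j))"
      using B_ev by (intro finite_measure_subadditive_finite) auto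
    also have "\<dots> \<le> (\<Sum>j\<in>?I. prob E * exp (- c / \<gamma> (Suc n)))"
      unfolding B_def c_def
      by (intro sum_mono) (auto intro!: component_tail_le[OF b T _ E nk, simplified] component_tail_le[OF b T _ E nk, of "- 1", simplified])
    also have "\<dots> = 2 * real CARD('m) * prob E * exp (- c / \<gamma> (Suc n))"
      by (simp add: card_cartesian_product)
    finally show "prob {\<omega>\<in>E. norm (S k \<omega> - S n \<omega>) > d} \<le> 2 * real CARD('m) * prob E * exp (- c / \<gamma> (Suc n))" .
  qed
qed

text \<open>A union bound over all end indices of a window would involve more and more of them as
  the steps shrink. Checkpoints at spacing \<open>r\<close> suffice, because bounded noise moves by
  at most \<open>\<delta> / 2\<close> between the last checkpoint and the end. Only the starting
  indices remain to be summed, which is what summability is for.\<close>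

lemma small_noise_prob:
  assumes \<delta>: "\<delta> > 0" and e: "e > 0"
  obtains N0 where "\<And>N E. N \<ge> N0 \<Longrightarrow> E \<in> sets (\<F> N) \<Longrightarrow>
    prob {\<omega>\<in>E. \<not> small_noise \<gamma> (\<lambda>k. U k \<omega>) N \<delta>} \<le> e * prob E"
proof -
  \<comment> \<open>The distance to the last checkpoint is at most \<open>2 * r\<close>, and
    \<open>K * (2 * r) = \<delta> / 2\<close>. Then \<open>J\<close> is the number of cells of
    length \<open>r\<close> that cover the horizon \<open>1 / \<delta>\<close>.\<close>
  define r where "r = \<delta> / (4 * K)"
  have r: "r > 0" using \<delta> K_pos by (simp add: r_def)
  define J where "J = nat \<lceil>1 / (\<delta> * r)\<rceil>"
  obtain c where c: "c > 0" "\<And>n k E. E \<in> sets (\<F> n) \<Longrightarrow> n \<le> k \<Longrightarrow> step_time \<gamma> k - step_time \<gamma> n \<le> real J * r + 1 \<Longrightarrow>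
    prob {\<omega>\<in>E. norm (S k \<omega> - S n \<omega>) > \<delta> / 2} \<le> 2 * real CARD('m) * prob E * exp (- c / \<gamma> (Suc n))"
    using tail_le[of "\<delta> / 2" "real J * r + 1"] \<delta> r by (auto simp: add_nonneg_pos)
  \<comment> \<open>\<open>J + 1\<close> checkpoints times the constant of the tail bound.\<close>
  define C where "C = real (Suc J) * (2 * real CARD('m))"
  have C: "C > 0" by (simp add: C_def)
  obtain N1 where N1: "\<And>N. N \<ge> N1 \<Longrightarrow> norm (\<Sum>n. exp (- c / \<gamma> (Suc (n + N)))) < e / C"
    using suminf_exist_split[OF _ exp_summable[OF c(1)], of "e / C"] e C by auto
  obtain N2 where N2: "\<And>n. n \<ge> N2 \<Longrightarrow> \<gamma> n < r"
    using order_tendstoD(2)[OF step_size_tendsto_0 r] by (auto simp: eventually_sequentially)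
  show ?thesis
  proof (rule that[of "max N1 N2"])
    fix N E assume N: "max N1 N2 \<le> N" and E: "E \<in> sets (\<F> N)"
    define k where "k = (\<lambda>n j::nat. step_index \<gamma> (step_time \<gamma> n + real j * r))"
    have t0: "0 \<le> step_time \<gamma> n + real j * r" for n j using step_time_nonneg[of n] r by simp
    have k_ge: "n \<le> k n j" for n j unfolding k_def using r by (intro step_index_greatest) simp
    have k_time: "step_time \<gamma> (k n j) \<le> step_time \<gamma> n + real j * r"
      "step_time \<gamma> n + real j * r < step_time \<gamma> (k n j) + \<gamma> (Suc (k n j))" for n j
      using step_index_bounds[OF t0, of n j] by (simp_all add: k_def step_time_Suc)
    define A where "A = (\<lambda>n. \<Union>j\<in>{..J}. {\<omega>\<in>E. norm (S (k (n + N) j) \<omega> - S (n + N) \<omega>) > \<delta> / 2})"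
    have EF: "E \<in> sets (\<F> (n + N))" for n using E sets_F_mono[of N "n + N"] by auto
    have ev: "{\<omega>\<in>E. norm (S m \<omega> - S n \<omega>) > \<delta> / 2} \<in> events" for m n
    proof -
      have [measurable]: "E \<in> events" using sets_F_subset[OF E] .
      have "{\<omega>\<in>E. norm (S m \<omega> - S n \<omega>) > \<delta> / 2} = E \<inter> {\<omega>\<in>space P. norm (S m \<omega> - S n \<omega>) > \<delta> / 2}"
        using sets.sets_into_space[OF sets_F_subset[OF E]] by auto
      also have "\<dots> \<in> events" by measurable
      finally show ?thesis .
    qed
    have A_ev: "A n \<in> events" for n unfolding A_def using ev by (intro sets.finite_UN) auto
    have A_le: "prob (A n) \<le> C * prob E * exp (- c / \<gamma> (Suc (n + N)))" for n
    proof -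
      have "prob (A n) \<le> (\<Sum>j\<in>{..J}. prob {\<omega>\<in>E. norm (S (k (n + N) j) \<omega> - S (n + N) \<omega>) > \<delta> / 2})"
        unfolding A_def using ev by (intro finite_measure_subadditive_finite) auto
      also have "\<dots> \<le> (\<Sum>j\<in>{..J}. 2 * real CARD('m) * prob E * exp (- c / \<gamma> (Suc (n + N))))"
      proof (rule sum_mono, rule c(2)[OF EF k_ge])
        fix j assume "j \<in> {..J}"
        then have "real j * r \<le> real J * r" using r by (intro mult_right_mono) auto
        then show "step_time \<gamma> (k (n + N) j) - step_time \<gamma> (n + N) \<le> real J * r + 1"
          using k_time(1)[of "n + N" j] by linarith
      qed
      also have "\<dots> = C * prob E * exp (- c / \<gamma> (Suc (n + N)))" by (simp add: C_def)
      finally show ?thesis .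
    qed
    have summ: "summable (\<lambda>n. exp (- c / \<gamma> (Suc (n + N))))"
      using summable_ignore_initial_segment[OF exp_summable[OF c(1)], of N] by simp
    have summA: "summable (\<lambda>n. prob (A n))"
      by (rule summable_comparison_test'[OF summable_mult[OF summ, of "C * prob E"], of 0]) (use A_le in auto)
    have incl: "\<omega> \<in> (\<Union>n. A n)" if u: "\<forall>n\<ge>1. norm (U n \<omega>) \<le> K"
      and \<omega>: "\<omega> \<in> {\<omega>\<in>E. \<not> small_noise \<gamma> (\<lambda>k. U k \<omega>) N \<delta>}" for \<omega>
    proof (rule ccontr)
      assume notA: "\<omega> \<notin> (\<Union>n. A n)"
      have "small_noise \<gamma> (\<lambda>k. U k \<omega>) N \<delta>"
        unfolding small_noise_def S_def[symmetric]
      proof (intro allI impI)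
        fix n m assume nm: "N \<le> n" "n \<le> m" "step_time \<gamma> m - step_time \<gamma> n \<le> 1 / \<delta>"
        define t where "t = step_time \<gamma> m - step_time \<gamma> n"
        have t: "0 \<le> t" "t \<le> 1 / \<delta>" using nm step_time_le by (auto simp: t_def)
        define j where "j = nat \<lfloor>t / r\<rfloor>"
        have "real j = of_int \<lfloor>t / r\<rfloor>" using t r by (simp add: j_def)
        then have "real j \<le> t / r" "t / r < real j + 1" by linarith+
        then have j: "real j * r \<le> t" "t < real j * r + r" using r by (simp_all add: field_simps)
        have "t / r \<le> 1 / (\<delta> * r)" using t r \<delta> by (simp add: field_simps)
        then have "j \<le> J" unfolding j_def J_def by linarith
        have "step_time \<gamma> (k n j) \<le> step_time \<gamma> m" using k_time(1)[of n j] j(1) by (simp add: t_def)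
        have km: "k n j \<le> m"
          unfolding k_def using step_index_mono[OF t0, of n j "step_time \<gamma> m"] j(1)
          by (simp add: t_def step_index_step_time)
        have "\<gamma> (Suc (k n j)) < r" using N2[of "Suc (k n j)"] N nm(1) k_ge[of n j] by simp
        \<comment> \<open>One \<open>r\<close> is lost by rounding \<open>t / r\<close> down, the
          other because \<open>k n j\<close> is the last index before the checkpoint time and the
          following step is shorter than \<open>r\<close>.\<close>
        then have close: "step_time \<gamma> m - step_time \<gamma> (k n j) \<le> 2 * r"
          using k_time(2)[of n j] j(2) by (simp add: t_def)
        have "\<omega> \<notin> A (n - N)" using notA by blast
        then have 1: "norm (S (k n j) \<omega> - S n \<omega>) \<le> \<delta> / 2"
          using \<omega> \<open>j \<le> J\<close> nm(1) by (auto simp: A_def not_less)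
        have "norm (S m \<omega> - S (k n j) \<omega>) \<le> K * (step_time \<gamma> m - step_time \<gamma> (k n j))"
          using u km by (intro S_lipschitz) auto
        also have "\<dots> \<le> K * (2 * r)" using close K_pos by (intro mult_left_mono) auto
        also have "\<dots> = \<delta> / 2" using K_pos by (simp add: r_def)
        finally have "norm (S m \<omega> - S (k n j) \<omega>) \<le> \<delta> / 2" .
        then show "norm (S m \<omega> - S n \<omega>) \<le> \<delta>"
          using 1 norm_triangle_ineq[of "S m \<omega> - S (k n j) \<omega>" "S (k n j) \<omega> - S n \<omega>"] by simp
      qed
      then show False using \<omega> by simp
    qed
    have "AE \<omega> in P. \<omega> \<in> {\<omega>\<in>E. \<not> small_noise \<gamma> (\<lambda>k. U k \<omega>) N \<delta>} \<longrightarrow> \<omega> \<in> (\<Union>n. A n)"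
      using U_le by (rule eventually_mono) (use incl in blast)
    then have "prob {\<omega>\<in>E. \<not> small_noise \<gamma> (\<lambda>k. U k \<omega>) N \<delta>} \<le> prob (\<Union>n. A n)"
      using A_ev by (intro finite_measure_mono_AE) auto
    also have "\<dots> \<le> (\<Sum>n. prob (A n))"
      using A_ev summA by (intro finite_measure_subadditive_countably) auto
    also have "\<dots> \<le> (\<Sum>n. C * prob E * exp (- c / \<gamma> (Suc (n + N))))"
      using A_le summA summable_mult[OF summ] by (intro suminf_le) auto
    also have "\<dots> = C * prob E * (\<Sum>n. exp (- c / \<gamma> (Suc (n + N))))"
      using summ by (rule suminf_mult)
    also have "\<dots> \<le> C * prob E * (e / C)"
      using N1[of N] N C by (intro mult_left_mono) auto
    also have "\<dots> = e * prob E" using C by simp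
    finally show "prob {\<omega>\<in>E. \<not> small_noise \<gamma> (\<lambda>k. U k \<omega>) N \<delta>} \<le> e * prob E" .
  qed
qed

lemma small_noise_measurable [measurable]:
  "Measurable.pred P (\<lambda>\<omega>. small_noise \<gamma> (\<lambda>k. U k \<omega>) N \<delta>)"
  unfolding small_noise_def S_def[symmetric] by measurable

text \<open>With the whole space as past event, the paths on which smallness fails from every index
  on have probability at most \<open>e\<close> for each \<open>e\<close>. Tolerances
  \<open>1 / (j + 1)\<close> suffice by monotonicity and keep the exceptional set a countable
  union.\<close>

lemma small_noise_eventually:
  "AE \<omega> in P. \<forall>e>0. \<exists>N. small_noise \<gamma> (\<lambda>k. U k \<omega>) N e"
proof -
  have "AE \<omega> in P. \<exists>N. small_noise \<gamma> (\<lambda>k. U k \<omega>) N \<delta>" if \<delta>: "\<delta> > 0" for \<delta>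
  proof -
    let ?B = "{\<omega>\<in>space P. \<not> (\<exists>N. small_noise \<gamma> (\<lambda>k. U k \<omega>) N \<delta>)}"
    have "prob ?B \<le> e" if e: "e > 0" for e
    proof -
      obtain N where N: "\<And>n E. n \<ge> N \<Longrightarrow> E \<in> sets (\<F> n) \<Longrightarrow>
          prob {\<omega>\<in>E. \<not> small_noise \<gamma> (\<lambda>k. U k \<omega>) n \<delta>} \<le> e * prob E"
        using small_noise_prob[OF \<delta> e] by blast
      from N[OF order_refl, of "space P"] have "prob {\<omega>\<in>space P. \<not> small_noise \<gamma> (\<lambda>k. U k \<omega>) N \<delta>} \<le> e"
        using subalg[of N] sets.top[of "\<F> N"] by (simp add: subalgebra_def prob_space)
      moreover have "prob ?B \<le> prob {\<omega>\<in>space P. \<not> small_noise \<gamma> (\<lambda>k. U k \<omega>) N \<delta>}"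
        by (intro finite_measure_mono) auto
      ultimately show ?thesis by simp
    qed
    then have "prob ?B \<le> 0" by - (rule field_le_epsilon, simp)
    then have "prob ?B = 0" using measure_nonneg[of P ?B] by linarith
    moreover have "?B \<in> events" by measurable
    ultimately show ?thesis using prob_Collect_eq_0[of "\<lambda>\<omega>. \<not> (\<exists>N. small_noise \<gamma> (\<lambda>k. U k \<omega>) N \<delta>)"] by simp
  qed
  then have "AE \<omega> in P. \<forall>j::nat. \<exists>N. small_noise \<gamma> (\<lambda>k. U k \<omega>) N (inverse (real (Suc j)))"
    by (subst AE_all_countable) auto
  then show ?thesis
  proof eventually_elim
    case (elim \<omega>)
    show ?case
    proof (intro allI impI)
      fix e :: real assume "e > 0"
      then obtain j where j: "inverse (real (Suc j)) < e" using reals_Archimedean by blast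
      obtain N where N: "small_noise \<gamma> (\<lambda>k. U k \<omega>) N (inverse (real (Suc j)))" using elim by blast
      have "small_noise \<gamma> (\<lambda>k. U k \<omega>) N e"
        by (rule small_noise_mono[OF N order_refl]) (use j in auto)
      then show "\<exists>N. small_noise \<gamma> (\<lambda>k. U k \<omega>) N e" ..
    qed
  qed
qed

end

section \<open>Limit sets and attainable points of the interpolated process\<close>

lemma (in step_sizes) interpolation_on_step:
  assumes "0 \<le> s" "s \<le> 1"
  shows "interpolation \<gamma> x (step_time \<gamma> i + s * \<gamma> (Suc i)) = x i + s *\<^sub>R (x (Suc i) - x i)"
proof -
  have g: "\<gamma> (Suc i) > 0" using pos by simp
  have "s * \<gamma> (Suc i) \<le> \<gamma> (Suc i)" using assms g by (simp add: mult_left_le_one_le)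
  then show ?thesis
    using interpolation_eq[of \<gamma> "s * \<gamma> (Suc i)" i x] pos assms g by simp
qed

lemma (in step_sizes) interpolation_step_cases:
  assumes "step_time \<gamma> j \<le> t"
  obtains i s where "j \<le> i" "0 \<le> s" "s \<le> 1" "interpolation \<gamma> x t = x i + s *\<^sub>R (x (Suc i) - x i)"
proof -
  define i where "i = step_index \<gamma> t"
  define s where "s = (t - step_time \<gamma> i) / \<gamma> (Suc i)"
  have t: "0 \<le> t" using assms step_time_nonneg[of j] by linarith
  have g: "\<gamma> (Suc i) > 0" using pos by simp
  have s: "0 \<le> s" "s \<le> 1" "t = step_time \<gamma> i + s * \<gamma> (Suc i)"
    using step_index_bounds[OF t] g by (simp_all add: s_def i_def step_time_Suc)
  have "j \<le> i" unfolding i_def using assms by (rule step_index_greatest)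
  then show ?thesis using that s interpolation_on_step[OF s(1,2), of x i] by simp
qed

lemma rat_dense_unit_interval:
  fixes s :: real
  assumes "0 \<le> s" "s \<le> 1"
  shows "s \<in> closure (of_rat ` {q::rat. 0 \<le> q \<and> q \<le> 1})"
  unfolding closure_approachable
proof (intro allI impI)
  fix e :: real assume e: "e > 0"
  show "\<exists>y\<in>of_rat ` {q::rat. 0 \<le> q \<and> q \<le> 1}. dist y s < e"
  proof (cases "s = 1")
    case True
    then show ?thesis using e by (intro bexI[of _ "of_rat 1"]) auto
  next
    case False
    then obtain y where y: "y \<in> \<rat>" "s < y" "y < min 1 (s + e)"
      using Rats_dense_in_real[of s "min 1 (s + e)"] assms e by auto
    then obtain q where q: "y = of_rat q" by (auto elim: Rats_cases)
    have "0 \<le> (of_rat q :: real)" "(of_rat q :: real) \<le> 1" using y assms q by linarith+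
    then have "0 \<le> q" "q \<le> 1" by simp_all
    then show ?thesis using y q by (intro bexI[of _ y]) (auto simp: dist_real_def)
  qed
qed

text \<open>Rewrites the absence of limit points in \<open>K\<close> with countable quantifiers, for
  the sake of measurability. Compactness turns absence into a positive gap: otherwise nearest points
  of \<open>K\<close> to ever later path points would accumulate at a limit point in
  \<open>K\<close>. The index \<open>j\<close> serves both as starting index and, by its reciprocal,
  as gap.\<close>

lemma (in step_sizes) limit_set_disjoint_iff:
  fixes x :: "nat \<Rightarrow> 'a::euclidean_space"
  assumes K: "compact K" "K \<noteq> {}"
  shows "limit_set (interpolation \<gamma> x) \<inter> K = {} \<longleftrightarrow>
    (\<exists>j. \<forall>i\<ge>j. \<forall>q::rat. 0 \<le> q \<and> q \<le> 1 \<longrightarrow>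
       inverse (real (Suc j)) \<le> infdist (x i + of_rat q *\<^sub>R (x (Suc i) - x i)) K)"
    (is "?L = (\<exists>j. ?R j)")
proof
  assume "\<exists>j. ?R j"
  then obtain j where j: "\<And>i q. i \<ge> j \<Longrightarrow> 0 \<le> q \<and> q \<le> 1 \<Longrightarrow>
       inverse (real (Suc j)) \<le> infdist (x i + of_rat q *\<^sub>R (x (Suc i) - x i)) K" by blast
  have "False" if p: "p \<in> limit_set (interpolation \<gamma> x)" "p \<in> K" for p
  proof -
    have "p \<in> closure (interpolation \<gamma> x ` {step_time \<gamma> j..})"
      using p(1) step_time_nonneg[of j] by (auto simp: limit_set_def)
    then obtain t where t: "step_time \<gamma> j \<le> t" "dist (interpolation \<gamma> x t) p < inverse (real (Suc j))"
      unfolding closure_approachable by (auto dest!: spec[of _ "inverse (real (Suc j))"])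
    obtain i s where i: "j \<le> i" "0 \<le> s" "s \<le> 1" "interpolation \<gamma> x t = x i + s *\<^sub>R (x (Suc i) - x i)"
      by (rule interpolation_step_cases[OF t(1)])
    have "inverse (real (Suc j)) \<le> infdist (x i + s *\<^sub>R (x (Suc i) - x i)) K"
      by (rule continuous_ge_on_closure[OF _ rat_dense_unit_interval[OF i(2,3)],
            where f = "\<lambda>s. infdist (x i + s *\<^sub>R (x (Suc i) - x i)) K"])
         (use j i(1) in \<open>auto intro!: continuous_intros\<close>)
    also have "\<dots> \<le> dist (interpolation \<gamma> x t) p" unfolding i(4) using p(2) by (rule infdist_le)
    finally show False using t(2) by simp
  qed
  then show ?L by blast
next
  assume L: ?L
  show "\<exists>j. ?R j"
  proof (rule ccontr)
    assume "\<nexists>j. ?R j"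
    then have "\<forall>j. \<exists>i q. j \<le> i \<and> 0 \<le> q \<and> q \<le> 1 \<and>
       infdist (x i + of_rat q *\<^sub>R (x (Suc i) - x i)) K < inverse (real (Suc j))"
      by (meson not_le)
    then obtain i q where iq: "\<And>j. j \<le> i j" "\<And>j. (0::rat) \<le> q j" "\<And>j. q j \<le> 1"
      "\<And>j. infdist (x (i j) + of_rat (q j) *\<^sub>R (x (Suc (i j)) - x (i j))) K < inverse (real (Suc j))"
      by metis
    define s where "s = (\<lambda>j. step_time \<gamma> (i j) + of_rat (q j) * \<gamma> (Suc (i j)))"
    have Xs: "interpolation \<gamma> x (s j) = x (i j) + of_rat (q j) *\<^sub>R (x (Suc (i j)) - x (i j))" for j
      unfolding s_def using iq(2,3)[of j] by (intro interpolation_on_step) auto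
    have s_ge: "step_time \<gamma> j \<le> s j" for j
      using step_time_le[OF iq(1)[of j]] iq(2)[of j] pos[of "Suc (i j)"] by (simp add: s_def add_increasing2)
    have "\<forall>j. \<exists>k\<in>K. dist (interpolation \<gamma> x (s j)) k < inverse (real (Suc j))"
      using infdist_attains_inf[OF compact_imp_closed[OF K(1)] K(2)] iq(4) unfolding Xs by metis
    then obtain k where k: "\<And>j. k j \<in> K" "\<And>j. dist (interpolation \<gamma> x (s j)) (k j) < inverse (real (Suc j))"
      by metis
    obtain p r where p: "p \<in> K" "strict_mono r" "(k \<circ> r) \<longlonglongrightarrow> p"
      using seq_compactE[OF compact_imp_seq_compact[OF K(1)], of k] k(1) by blast
    have "p \<in> limit_set (interpolation \<gamma> x)"
      unfolding limit_set_def
    proof (intro INT_I, unfold closure_approachable, intro allI impI)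
      fix t e :: real assume e: "e > 0"
      have "\<forall>\<^sub>F j in sequentially. t \<le> step_time \<gamma> j" using unbounded by (simp add: filterlim_at_top)
      then have "\<forall>\<^sub>F j in sequentially. t \<le> step_time \<gamma> (r j)" by (rule eventually_subseq[OF p(2)])
      moreover have "\<forall>\<^sub>F j in sequentially. inverse (real (Suc (r j))) < e / 2"
        using e by (intro eventually_subseq[OF p(2)] order_tendstoD(2)[OF LIMSEQ_inverse_real_of_nat]) simp
      moreover have "\<forall>\<^sub>F j in sequentially. dist (k (r j)) p < e / 2"
        using tendstoD[OF p(3), of "e / 2"] e by simp
      ultimately have "\<forall>\<^sub>F j in sequentially. t \<le> s (r j) \<and> dist (interpolation \<gamma> x (s (r j))) p < e"
      proof eventually_elim
        case (elim j)
        then show ?case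
          using s_ge[of "r j"] k(2)[of "r j"] dist_triangle[of "interpolation \<gamma> x (s (r j))" p "k (r j)"] by simp
      qed
      then obtain j where "t \<le> s (r j)" "dist (interpolation \<gamma> x (s (r j))) p < e"
        by (auto simp: eventually_sequentially)
      then show "\<exists>y\<in>interpolation \<gamma> x ` {t..}. dist y p < e" by auto
    qed
    then show False using L p(1) by blast
  qed
qed

text \<open>The complement of \<open>A\<close> is exhausted by countably many compact sets, and the
  limit set is contained in \<open>A\<close> if and only if it misses each of them.\<close>

lemma (in step_sizes) limit_set_subset_measurable:
  fixes x :: "nat \<Rightarrow> 'w \<Rightarrow> 'a::euclidean_space"
  assumes [measurable]: "\<And>n. x n \<in> borel_measurable P" and A: "closed A" "A \<noteq> {}"
  shows "{\<omega>\<in>space P. limit_set (interpolation \<gamma> (\<lambda>n. x n \<omega>)) \<subseteq> A} \<in> sets P"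
proof -
  define K where "K = (\<lambda>n. {z. inverse (real (Suc n)) \<le> infdist z A} \<inter> cball 0 (real n))"
  have K: "compact (K n)" for n
  proof -
    have "closed {z. inverse (real (Suc n)) \<le> infdist z A}"
      by (intro closed_Collect_le continuous_intros)
    then show ?thesis unfolding K_def by (intro closed_Int_compact) auto
  qed
  have union: "- A = (\<Union>n. K n)"
  proof (intro equalityI subsetI)
    fix z assume "z \<in> - A"
    then have "infdist z A > 0" using A by (simp add: infdist_pos_not_in_closed)
    then obtain m where m: "inverse (real (Suc m)) < infdist z A" using reals_Archimedean by blast
    obtain l where l: "norm z \<le> real l" using real_arch_simple by blast
    have "inverse (real (Suc (max m l))) \<le> inverse (real (Suc m))" by (simp add: le_imp_inverse_le)
    then have "inverse (real (Suc (max m l))) \<le> infdist z A" using m by linarith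
    moreover have "norm z \<le> real (max m l)" using l by simp
    ultimately have "z \<in> K (max m l)" unfolding K_def by (simp del: of_nat_Suc)
    then show "z \<in> (\<Union>n. K n)" by blast
  next
    fix z assume "z \<in> (\<Union>n. K n)"
    then obtain n where "inverse (real (Suc n)) \<le> infdist z A" by (auto simp: K_def)
    moreover have "0 < inverse (real (Suc n))" by simp
    ultimately show "z \<in> - A" by (auto simp: infdist_zero)
  qed
  have [measurable]: "(\<lambda>\<omega>. infdist (f \<omega>) B) \<in> borel_measurable P" if "f \<in> borel_measurable P"
    for f :: "'w \<Rightarrow> 'a" and B
    by (rule borel_measurable_continuous_on[OF _ that, of "\<lambda>z. infdist z B"]) (intro continuous_intros)
  \<comment> \<open>Empty \<open>K n\<close> are set apart because \<open>infdist\<close> to the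
    empty set is 0, so the gap condition would fail for them although nothing is hit.\<close>
  have "limit_set (interpolation \<gamma> y) \<subseteq> A \<longleftrightarrow> (\<forall>n. K n \<noteq> {} \<longrightarrow>
    (\<exists>j. \<forall>i\<ge>j. \<forall>q::rat. 0 \<le> q \<and> q \<le> 1 \<longrightarrow>
       inverse (real (Suc j)) \<le> infdist (y i + of_rat q *\<^sub>R (y (Suc i) - y i)) (K n)))" for y
  proof -
    have "limit_set (interpolation \<gamma> y) \<subseteq> A \<longleftrightarrow> (\<forall>n. limit_set (interpolation \<gamma> y) \<inter> K n = {})"
      using union by auto
    also have "\<dots> \<longleftrightarrow> (\<forall>n. K n \<noteq> {} \<longrightarrow> limit_set (interpolation \<gamma> y) \<inter> K n = {})" by auto
    also have "\<dots> \<longleftrightarrow> (\<forall>n. K n \<noteq> {} \<longrightarrow> (\<exists>j. \<forall>i\<ge>j. \<forall>q::rat. 0 \<le> q \<and> q \<le> 1 \<longrightarrow>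
       inverse (real (Suc j)) \<le> infdist (y i + of_rat q *\<^sub>R (y (Suc i) - y i)) (K n)))"
      using limit_set_disjoint_iff[OF K] by blast
    finally show ?thesis .
  qed
  then show ?thesis by simp
qed

text \<open>Transfers attainability from real times to a single index. If every late grid point
  avoided the ball almost surely, so would all of them jointly; once increments are below
  \<open>e / 2\<close>, the path between them would then almost surely miss the ball of half the
  radius, contradicting attainability.\<close>

lemma attainable_at_step:
  fixes x :: "nat \<Rightarrow> 'w \<Rightarrow> 'a::euclidean_space"
  assumes P: "prob_space P" and steps: "step_sizes \<gamma>" and \<gamma>: "\<gamma> \<longlonglongrightarrow> 0"
    and x[measurable]: "\<And>n. x n \<in> borel_measurable P"
    and p: "p \<in> attainable_set P (\<lambda>t \<omega>. interpolation \<gamma> (\<lambda>n. x n \<omega>) t) M"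
    and step_le: "AE \<omega> in P. \<forall>n. norm (x (Suc n) \<omega> - x n \<omega>) \<le> C * \<gamma> (Suc n)"
    and e: "e > 0"
  obtains i where "i \<ge> N" "measure P {\<omega>\<in>space P. dist (x i \<omega>) p < e} > 0"
proof (rule ccontr)
  note found = that
  assume contr: "\<not> thesis"
  interpret prob_space P by (rule P)
  interpret step_sizes \<gamma> by (rule steps)
  have "prob {\<omega>\<in>space P. dist (x i \<omega>) p < e} = 0" if "i \<ge> N" for i
    using found[OF that] contr measure_nonneg[of P "{\<omega>\<in>space P. dist (x i \<omega>) p < e}"] by linarith
  then have off: "AE \<omega> in P. \<not> dist (x i \<omega>) p < e" if "i \<ge> N" for i
    using that prob_Collect_eq_0[of "\<lambda>\<omega>. dist (x i \<omega>) p < e"] by simp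
  have far: "AE \<omega> in P. \<forall>i. i \<ge> N \<longrightarrow> \<not> dist (x i \<omega>) p < e"
    unfolding AE_all_countable
  proof
    show "AE \<omega> in P. i \<ge> N \<longrightarrow> \<not> dist (x i \<omega>) p < e" for i
      using off[of i] by (cases "i \<ge> N") auto
  qed
  have "(\<lambda>n. C * \<gamma> (Suc n)) \<longlonglongrightarrow> C * 0" by (intro tendsto_intros LIMSEQ_Suc \<gamma>)
  then have "\<forall>\<^sub>F n in sequentially. C * \<gamma> (Suc n) < e / 2" by (rule order_tendstoD(2)) (use e in simp)
  then obtain N1 where N1: "\<And>n. n \<ge> N1 \<Longrightarrow> C * \<gamma> (Suc n) < e / 2" by (auto simp: eventually_sequentially)
  define N2 where "N2 = max N N1"
  \<comment> \<open>The added 1 makes \<open>t\<close> positive, as the definition of attainable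
    points demands, also if \<open>N2 = 0\<close>.\<close>
  define t where "t = step_time \<gamma> N2 + 1"
  let ?X = "\<lambda>t \<omega>. interpolation \<gamma> (\<lambda>n. x n \<omega>) t"
  have "t > 0" using step_time_nonneg[of N2] by (simp add: t_def)
  then have pos: "prob {\<omega>\<in>space P. \<exists>s\<ge>t. ?X s \<omega> \<in> ball p (e / 2)} > 0"
    using p e unfolding attainable_set_def by (simp del: mem_ball)
  have "\<not> (\<exists>s\<ge>t. ?X s \<omega> \<in> ball p (e / 2))"
    if far: "\<forall>i. i \<ge> N \<longrightarrow> \<not> dist (x i \<omega>) p < e" and le: "\<forall>n. norm (x (Suc n) \<omega> - x n \<omega>) \<le> C * \<gamma> (Suc n)" for \<omega>
  proof
    assume "\<exists>s\<ge>t. ?X s \<omega> \<in> ball p (e / 2)"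
    then obtain s where s: "s \<ge> t" "dist p (?X s \<omega>) < e / 2" by auto
    have "step_time \<gamma> N2 \<le> s" using s(1) by (simp add: t_def)
    then obtain i l where i: "N2 \<le> i" "0 \<le> l" "l \<le> 1"
      "?X s \<omega> = x i \<omega> + l *\<^sub>R (x (Suc i) \<omega> - x i \<omega>)"
      by (rule interpolation_step_cases)
    have "dist (?X s \<omega>) (x i \<omega>) = l * norm (x (Suc i) \<omega> - x i \<omega>)" unfolding i(4) using i(2) by (simp add: dist_norm)
    also have "\<dots> \<le> 1 * norm (x (Suc i) \<omega> - x i \<omega>)" using i by (intro mult_right_mono) auto
    also have "\<dots> < e / 2" using le[rule_format, of i] N1[of i] i(1) by (simp add: N2_def)
    finally have "dist (x i \<omega>) p < e"
      using s(2) dist_triangle[of "x i \<omega>" p "?X s \<omega>"] by (simp add: dist_commute)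
    then show False using far i(1) by (simp add: N2_def)
  qed
  then have "AE \<omega> in P. \<not> (\<exists>s\<ge>t. ?X s \<omega> \<in> ball p (e / 2))"
    using far step_le by (auto elim: eventually_elim2)
  then have "prob {\<omega>\<in>space P. \<exists>s\<ge>t. ?X s \<omega> \<in> ball p (e / 2)} \<le> prob {}"
    by (intro finite_measure_mono_AE) auto
  then show False using pos by simp
qed

theorem theorem1p5:
  fixes M A :: "(real ^ 'm) set"
    and F :: "real ^ 'm \<Rightarrow> (real ^ 'm) set"
    and \<gamma> :: "nat \<Rightarrow> real"
    and P :: "'w measure"
    and \<F> :: "nat \<Rightarrow> 'w measure"
    and x U :: "nat \<Rightarrow> 'w \<Rightarrow> real ^ 'm"
    and X :: "real \<Rightarrow> 'w \<Rightarrow> real ^ 'm"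
  assumes "compact M"
    and "standard_map F"
    and "\<And>n. n \<ge> 1 \<Longrightarrow> \<gamma> n > 0"
    and "\<And>n. n \<ge> 1 \<Longrightarrow> \<gamma> (Suc n) \<le> \<gamma> n"
    and "filterlim (step_time \<gamma>) at_top sequentially"
    and "prob_space P"
    and "filtration (space P) \<F>"
    and "\<And>n. subalgebra P (\<F> n)"
    and "\<And>n. x n \<in> borel_measurable (\<F> n)"
    and "\<And>n. n \<ge> 1 \<Longrightarrow> U n \<in> borel_measurable (\<F> n)"
    and "\<And>n. AE \<omega> in P. x n \<omega> \<in> M"
    and "\<And>n. AE \<omega> in P.
           x (Suc n) \<omega> - x n \<omega> - \<gamma> (Suc n) *\<^sub>R U (Suc n) \<omega> \<in> (\<lambda>v. \<gamma> (Suc n) *\<^sub>R v) ` F (x n \<omega>)"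
    and "\<And>c. c > 0 \<Longrightarrow> summable (\<lambda>n. exp (- c / \<gamma> (Suc n)))"
    and "\<exists>K. \<forall>n\<ge>1. AE \<omega> in P. norm (U n \<omega>) \<le> K"
    and "\<And>n i. AE \<omega> in P. real_cond_exp P (\<F> n) (\<lambda>\<omega>. U (Suc n) \<omega> $ i) \<omega> = 0"
    and "X = (\<lambda>t \<omega>. interpolation \<gamma> (\<lambda>n. x n \<omega>) t)"
    and "A \<subseteq> M"
    and "attractor F A"
    and "attainable_set P X M \<inter> basin F A \<noteq> {}"
  shows "\<P>(\<omega> in P. limit_set (\<lambda>t. X t \<omega>) \<subseteq> A) > 0"
proof -
  note M = assms(1) and F = assms(2) and filtration = assms(7) and subalg = assms(8)
    and x_adapted = assms(9) and xM = assms(11) and scheme = assms(12) and X = assms(16) and A = assms(18)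
  obtain K where K: "\<And>n. n \<ge> 1 \<Longrightarrow> AE \<omega> in P. norm (U n \<omega>) \<le> K" using assms(14) by blast
  \<comment> \<open>A bound on the noise may be 0 or negative on vacuous grounds; the exponential
    estimates divide by it.\<close>
  define K' where "K' = max K 1"
  interpret martingale_noise P \<gamma> \<F> U K'
  proof (intro martingale_noise.intro step_sizes.intro martingale_noise_axioms.intro)
    show "AE \<omega> in P. norm (U n \<omega>) \<le> K'" if "n \<ge> 1" for n
      using K[OF that] by eventually_elim (simp add: K'_def)
  qed (use assms in \<open>auto simp: K'_def\<close>)
  have x_meas[measurable]: "x n \<in> borel_measurable P" for n
    using x_adapted by (rule measurable_from_subalg[OF subalg])
  obtain p where p: "p \<in> attainable_set P X M" "p \<in> basin F A" using assms(19) by blast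
  have A': "closed A" "A \<noteq> {}" using A by (auto simp: attractor_def compact_imp_closed)
  have bM: "bounded M" using M by (rule compact_imp_bounded)
  obtain c where c: "c > 0" "\<And>x v. v \<in> F x \<Longrightarrow> norm v \<le> c * (1 + norm x)"
    using standard_map_linear_growth[OF F] by blast
  obtain B where B: "\<And>w. w \<in> M \<Longrightarrow> norm w \<le> B" using bM by (auto simp: bounded_iff)
  define C where "C = c * (1 + B)"
  have FC: "norm v \<le> C" if "w \<in> M" "v \<in> F w" for v w
    using c(2)[OF that(2)] B[OF that(1)] c(1) unfolding C_def
    by (elim order_trans) (intro mult_left_mono, auto)
  \<comment> \<open>All almost sure properties are gathered, so that what follows for a path in
    \<open>good\<close> is purely deterministic.\<close>
  define good where "good = (\<lambda>\<omega>. (\<forall>n. x n \<omega> \<in> M) \<and> perturbed_scheme F \<gamma> (\<lambda>n. x n \<omega>) (\<lambda>n. U n \<omega>) \<and>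
    (\<forall>n\<ge>1. norm (U n \<omega>) \<le> K') \<and> (\<forall>e>0. \<exists>N. small_noise \<gamma> (\<lambda>k. U k \<omega>) N e))"
  have "AE \<omega> in P. \<forall>n. x n \<omega> \<in> M" using xM by (simp add: AE_all_countable)
  moreover have "AE \<omega> in P. perturbed_scheme F \<gamma> (\<lambda>n. x n \<omega>) (\<lambda>n. U n \<omega>)"
    unfolding perturbed_scheme_def using scheme by (simp add: AE_all_countable)
  ultimately have good: "AE \<omega> in P. good \<omega>"
    using U_le small_noise_eventually unfolding good_def by eventually_elim blast
  have step_le: "norm (x (Suc n) \<omega> - x n \<omega>) \<le> (C + K') * \<gamma> (Suc n)" if "good \<omega>" for \<omega> n
    using that FC unfolding good_def
    by (intro perturbed_scheme_step_le[of F "\<lambda>n. x n \<omega>" "\<lambda>n. U n \<omega>"]) auto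
  obtain \<delta> where \<delta>: "\<delta> > 0" "\<And>g y w N e. step_sizes g \<Longrightarrow> g \<longlonglongrightarrow> 0 \<Longrightarrow> (\<And>i. i > N \<Longrightarrow> g i \<le> \<delta>) \<Longrightarrow>
    perturbed_scheme F g y w \<Longrightarrow> (\<And>n. y n \<in> M) \<Longrightarrow> (\<And>n. n \<ge> 1 \<Longrightarrow> norm (w n) \<le> K') \<Longrightarrow>
    dist (y N) p \<le> \<delta> \<Longrightarrow> small_noise g w N \<delta> \<Longrightarrow> (\<And>e. e > 0 \<Longrightarrow> \<exists>N'. small_noise g w N' e) \<Longrightarrow>
    e > 0 \<Longrightarrow> \<forall>\<^sub>F n in sequentially. y n \<in> (\<Union>a\<in>A. ball a e)"
    using attractor_capture[OF F bM A p(2), where K = K'] by blast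
  obtain N0 where N0: "\<And>N E. N \<ge> N0 \<Longrightarrow> E \<in> sets (\<F> N) \<Longrightarrow>
    prob {\<omega>\<in>E. \<not> small_noise \<gamma> (\<lambda>k. U k \<omega>) N \<delta>} \<le> 1 / 2 * prob E"
    using small_noise_prob[OF \<delta>(1), of "1 / 2"] by auto
  obtain N1 where N1: "\<And>n. n \<ge> N1 \<Longrightarrow> \<gamma> n < \<delta>"
    using order_tendstoD(2)[OF step_size_tendsto_0 \<delta>(1)] by (auto simp: eventually_sequentially)
  obtain N where N: "N \<ge> max N0 N1" "prob {\<omega>\<in>space P. dist (x N \<omega>) p < \<delta>} > 0"
  proof (rule attainable_at_step[OF prob_space_axioms step_sizes_axioms step_size_tendsto_0 x_meas, where N = "max N0 N1"])
    show "AE \<omega> in P. \<forall>n. norm (x (Suc n) \<omega> - x n \<omega>) \<le> (C + K') * \<gamma> (Suc n)"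
      using good by eventually_elim (use step_le in blast)
  qed (use p(1) X \<delta>(1) in auto)
  define E where "E = {\<omega>\<in>space P. dist (x N \<omega>) p < \<delta>}"
  \<comment> \<open>Membership in the past \<open>\<F> N\<close>, rather than only in
    \<open>events\<close>, is what makes the noise estimate after step \<open>N\<close> applicable
    to \<open>E\<close>.\<close>
  have E: "E \<in> sets (\<F> N)"
  proof -
    note x_adapted[of N, measurable]
    have "{\<omega>\<in>space (\<F> N). dist (x N \<omega>) p < \<delta>} \<in> sets (\<F> N)" by measurable
    moreover have "space (\<F> N) = space P" using subalg[of N] by (simp add: subalgebra_def)
    ultimately show ?thesis unfolding E_def by (rule back_subst[where P = "\<lambda>S. {\<omega>\<in>S. dist (x N \<omega>) p < \<delta>} \<in> sets (\<F> N)"])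
  qed
  have [measurable]: "E \<in> events" using sets_F_subset[OF E] .
  define E1 where "E1 = {\<omega>\<in>space P. \<omega> \<in> E \<and> small_noise \<gamma> (\<lambda>k. U k \<omega>) N \<delta>}"
  define E2 where "E2 = {\<omega>\<in>space P. \<omega> \<in> E \<and> \<not> small_noise \<gamma> (\<lambda>k. U k \<omega>) N \<delta>}"
  have ev: "E1 \<in> events" "E2 \<in> events" unfolding E1_def E2_def by measurable
  have "E = E1 \<union> E2" by (auto simp: E1_def E2_def E_def)
  then have "prob E \<le> prob E1 + prob E2" using measure_Un_le[OF ev] by simp
  moreover have "E2 = {\<omega>\<in>E. \<not> small_noise \<gamma> (\<lambda>k. U k \<omega>) N \<delta>}" by (auto simp: E2_def E_def)
  then have "prob E2 \<le> 1 / 2 * prob E" using N0[OF _ E] N(1) by simp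
  moreover have "prob E > 0" using N(2) by (simp add: E_def)
  \<comment> \<open>Large noise takes away at most half of \<open>E\<close>.\<close>
  ultimately have E1: "prob E1 > 0" by simp
  have conv: "limit_set (\<lambda>t. X t \<omega>) \<subseteq> A" if g: "good \<omega>" and \<omega>: "\<omega> \<in> E1" for \<omega>
  proof -
    have "limit_set (interpolation \<gamma> (\<lambda>n. x n \<omega>)) \<subseteq> A"
    proof (rule limit_set_interpolation_subset[OF A'(1)])
      fix e :: real assume e: "e > 0"
      show "\<forall>\<^sub>F n in sequentially. x n \<omega> \<in> (\<Union>a\<in>A. ball a e)"
        by (rule \<delta>(2)[of \<gamma> N "\<lambda>n. x n \<omega>" "\<lambda>n. U n \<omega>", OF step_sizes_axioms step_size_tendsto_0])
           (use g \<omega> e N(1) N1 in \<open>auto simp: good_def E1_def E_def intro: less_imp_le\<close>)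
    next
      have "(\<lambda>n. (C + K') * \<gamma> (Suc n)) \<longlonglongrightarrow> (C + K') * 0"
        by (intro tendsto_intros LIMSEQ_Suc step_size_tendsto_0)
      then show "(\<lambda>n. x (Suc n) \<omega> - x n \<omega>) \<longlonglongrightarrow> 0"
        by (intro Lim_null_comparison[OF always_eventually[OF allI[OF step_le[OF g]]]]) simp
    qed
    then show ?thesis by (simp add: X)
  qed
  \<comment> \<open>The comparison with \<open>E1\<close> rests on this: a non-measurable set would
    be given probability 0.\<close>
  have "{\<omega>\<in>space P. limit_set (\<lambda>t. X t \<omega>) \<subseteq> A} \<in> events"
    using limit_set_subset_measurable[OF x_meas A'] by (simp add: X)
  moreover have "AE \<omega> in P. \<omega> \<in> E1 \<longrightarrow> \<omega> \<in> {\<omega>\<in>space P. limit_set (\<lambda>t. X t \<omega>) \<subseteq> A}"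
    using good by (rule eventually_mono) (use conv in \<open>auto simp: E1_def\<close>)
  ultimately have "prob E1 \<le> prob {\<omega>\<in>space P. limit_set (\<lambda>t. X t \<omega>) \<subseteq> A}"
    by (intro finite_measure_mono_AE)
  then show ?thesis using E1 by linarith
qed

end
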